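(* Let $(X,T^{1,0}X,\mathcal{T})$ be a compact Sasakian manifold. Let $$\mathcal{M}=\{\varphi\in\mathscr{C}^\infty(X,\mathbb{R}):\mathcal{T}\varphi\equiv0,\ \mathcal{V}(\varphi)\text{ is strictly pseudoconvex}\}/\mathbb{R}\cdot 1,$$ where $1$ denotes the constant function one (so functions differing by a constant are identified), equipped with the quotient topology induced by the $\mathscr{C}^\infty$-topology on $\mathscr{C}^\infty(X,\mathbb{R})$, and let $$\mathcal{S}=\{[\varphi]\in\mathcal{M}:(\mathcal{V}(\varphi),\mathcal{T})\text{ is induced by a weighted sphere}\}.$$ Then $\mathcal{S}$ is a set of first category in $\mathcal{M}$.
   Context: $X$ is smooth, connected, orientable, of real dimension $2n+1$, $n\ge1$. A (codimension one) CR structure is a rank-$n$ complex subbundle $T^{1,0}X\subset\mathbb{C}TX$ with $T^{1,0}X\cap\overline{T^{1,0}X}=0$, closed under Lie brackets. It is strictly pseudoconvex if there is a non-vanishing real one form $\alpha$ with $\ker\alpha=\operatorname{Re}T^{1,0}X$ and $\frac{1}{2i}d\alpha(Z,\overline Z)>0$ for all $Z\in T^{1,0}X\setminus\{0\}$. A Sasakian manifold is a triple $(X,T^{1,0}X,\mathcal{T})$ with $T^{1,0}X$ a CR structure and $\mathcal{T}$ a real vector field which is transversal ($\mathbb{C}TX=T^{1,0}X\oplus\overline{T^{1,0}X}\oplus\mathbb{C}\mathcal{T}$) and CR ($[\mathcal{T},Z]$ is a section of $T^{1,0}X$ for every smooth section $Z$ of $T^{1,0}X$), such that the real one form $\alpha$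 defined by $\alpha(\mathcal{T})\equiv1$, $\ker\alpha=\operatorname{Re}T^{1,0}X$ satisfies $\frac{1}{2i}d\alpha(Z,\overline Z)>0$ for all $Z\in T^{1,0}X\setminus\{0\}$. For $\varphi\in\mathscr{C}^\infty(X,\mathbb{R})$ with $\mathcal{T}\varphi\equiv0$ put $\mathcal{V}(\varphi)=\{Z-iZ(\varphi)\mathcal{T}: Z\in T^{1,0}X\}$; this is a CR structure for which $\mathcal{T}$ is transversal and CR, and $\mathcal{V}(\varphi)=\mathcal{V}(\psi)$ iff $\varphi-\psi$ is constant. For $\beta\in\mathbb{R}_+^N$ ($\mathbb{R}_+=(0,\infty)$) let $\mathcal{T}_\beta=i\sum_{j=1}^N\beta_j(z_j\partial_{z_j}-\overline z_j\partial_{\overline z_j})$ on $\mathbb{C}^N$. $(\mathcal{V},\mathcal{T})$ is induced by a weighted sphere if for some $N\in\mathbb{N}$, $\beta\in\mathbb{R}_+^N$ there is a smooth embedding $F\colon X\to\mathbb{C}^N$ which is CR with respect to $\mathcal{V}$ ($F_*\mathcal{V}=\mathbb{C}TF(X)\cap T^{1,0}\mathbb{C}^N$) such that $F(X)\subset\{|z|=1\}$ and $F_*\mathcal{T}=\mathcal{T}_\beta\circ F$. *)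

theory Defs
  imports "HOL-Analysis.Analysis"
begin

section \<open>Smooth manifolds\<close>

fun iter_partial ::
  "'m::finite list \<Rightarrow> (real^'m \<Rightarrow> 'b::real_normed_vector) \<Rightarrow> real^'m \<Rightarrow> 'b" where
  "iter_partial [] f = f"
| "iter_partial (i # is) f = (\<lambda>x. frechet_derivative (iter_partial is f) (at x) (axis i 1))"

text \<open>Only used for open \<open>S\<close>: all iterated partial derivatives exist and are (Frechet)
  differentiable, hence continuous, at every point of \<open>S\<close>.\<close>
definition smooth_on :: "(real^'m::finite) set \<Rightarrow> (real^'m \<Rightarrow> 'b::real_normed_vector) \<Rightarrow> bool" where
  "smooth_on S f \<longleftrightarrow> (\<forall>is. \<forall>x\<in>S. iter_partial is f differentiable (at x))"

text \<open>The manifold \<open>X\<close> is the whole type \<open>'a\<close>, with its class topology and an atlas of pairs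
  \<open>(U, \<phi>)\<close>; the values of \<open>\<phi>\<close> outside \<open>U\<close> play no role.\<close>
type_synonym ('a, 'm) atlas = "('a set \<times> ('a \<Rightarrow> real^'m)) set"

definition smooth_atlas ::
  "('a::{t2_space,second_countable_topology}, 'm::finite) atlas \<Rightarrow> bool" where
  "smooth_atlas A \<longleftrightarrow>
     (\<Union>(U,\<phi>)\<in>A. U) = UNIV \<and>
     (\<forall>(U,\<phi>)\<in>A. open U \<and> open (\<phi> ` U) \<and> homeomorphism U (\<phi> ` U) \<phi> (inv_into U \<phi>)) \<and>
     (\<forall>(U,\<phi>)\<in>A. \<forall>(V,\<psi>)\<in>A. smooth_on (\<phi> ` (U \<inter> V)) (\<psi> \<circ> inv_into U \<phi>))"

definition orientable ::
  "('a::{t2_space,second_countable_topology}, 'm::finite) atlas \<Rightarrow> bool" where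
  "orientable A \<longleftrightarrow>
     (\<exists>B. smooth_atlas B \<and> smooth_atlas (A \<union> B) \<and>
        (\<forall>(U,\<phi>)\<in>B. \<forall>(V,\<psi>)\<in>B. \<forall>x\<in>\<phi> ` (U \<inter> V).
           det (matrix (frechet_derivative (\<psi> \<circ> inv_into U \<phi>) (at x))) > 0))"

definition mfd_smooth_on ::
  "('a, 'm::finite) atlas \<Rightarrow> 'a set \<Rightarrow> ('a \<Rightarrow> 'b::real_normed_vector) \<Rightarrow> bool" where
  "mfd_smooth_on A W f \<longleftrightarrow> (\<forall>(U,\<phi>)\<in>A. smooth_on (\<phi> ` (U \<inter> W)) (f \<circ> inv_into U \<phi>))"

abbreviation mfd_smooth ::
  "('a, 'm::finite) atlas \<Rightarrow> ('a \<Rightarrow> 'b::real_normed_vector) \<Rightarrow> bool" where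
  "mfd_smooth A \<equiv> mfd_smooth_on A UNIV"


section \<open>Complexified tangent vectors\<close>

text \<open>A complexified tangent vector at \<open>p\<close> is a complex linear derivation at \<open>p\<close> of the algebra of
  smooth complex valued functions. It is set to 0 on non-smooth functions, so that equality
  of tangent vectors is equality of HOL functions.\<close>
type_synonym 'a cvec = "('a \<Rightarrow> complex) \<Rightarrow> complex"

definition ctangent :: "('a, 'm::finite) atlas \<Rightarrow> 'a \<Rightarrow> 'a cvec set" where
  "ctangent A p = {v.
     (\<forall>f g. mfd_smooth A f \<and> mfd_smooth A g \<longrightarrow>
        v (\<lambda>x. f x + g x) = v f + v g \<and>
        v (\<lambda>x. f x * g x) = v f * g p + f p * v g) \<and>
     (\<forall>c f. mfd_smooth A f \<longrightarrow> v (\<lambda>x. c * f x) = c * v f) \<and>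
     (\<forall>f. \<not> mfd_smooth A f \<longrightarrow> v f = 0)}"

definition vzero :: "'a cvec" where
  "vzero = (\<lambda>f. 0)"

definition vadd :: "'a cvec \<Rightarrow> 'a cvec \<Rightarrow> 'a cvec" where
  "vadd v w = (\<lambda>f. v f + w f)"

definition vscale :: "complex \<Rightarrow> 'a cvec \<Rightarrow> 'a cvec" where
  "vscale c v = (\<lambda>f. c * v f)"

definition vconj :: "'a cvec \<Rightarrow> 'a cvec" where
  "vconj v = (\<lambda>f. cnj (v (\<lambda>x. cnj (f x))))"

definition rtangent :: "('a, 'm::finite) atlas \<Rightarrow> 'a \<Rightarrow> 'a cvec set" where
  "rtangent A p = {v \<in> ctangent A p. vconj v = v}"

definition smooth_section ::
  "('a, 'm::finite) atlas \<Rightarrow> 'a set \<Rightarrow> ('a \<Rightarrow> 'a cvec set) \<Rightarrow> ('a \<Rightarrow> 'a cvec) \<Rightarrow> bool" where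
  "smooth_section A W L Z \<longleftrightarrow>
     (\<forall>p\<in>W. Z p \<in> L p) \<and> (\<forall>f. mfd_smooth A f \<longrightarrow> mfd_smooth_on A W (\<lambda>p. Z p f))"

definition lie_bracket :: "('a \<Rightarrow> 'a cvec) \<Rightarrow> ('a \<Rightarrow> 'a cvec) \<Rightarrow> 'a \<Rightarrow> 'a cvec" where
  "lie_bracket Z W p = (\<lambda>f. Z p (\<lambda>q. W q f) - W p (\<lambda>q. Z q f))"


section \<open>One-forms\<close>

text \<open>A real one-form is given through its complex linear extension to \<open>\<complex>TX\<close>.\<close>
definition real_one_form ::
  "('a, 'm::finite) atlas \<Rightarrow> ('a \<Rightarrow> 'a cvec \<Rightarrow> complex) \<Rightarrow> bool" where
  "real_one_form A \<alpha> \<longleftrightarrow>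
     (\<forall>p. \<forall>v\<in>ctangent A p. \<forall>w\<in>ctangent A p. \<alpha> p (vadd v w) = \<alpha> p v + \<alpha> p w) \<and>
     (\<forall>p c. \<forall>v\<in>ctangent A p. \<alpha> p (vscale c v) = c * \<alpha> p v) \<and>
     (\<forall>p. \<forall>v\<in>ctangent A p. \<alpha> p (vconj v) = cnj (\<alpha> p v)) \<and>
     (\<forall>Z. smooth_section A UNIV (ctangent A) Z \<longrightarrow> mfd_smooth A (\<lambda>p. \<alpha> p (Z p)))"

definition nonvanishing :: "('a, 'm::finite) atlas \<Rightarrow> ('a \<Rightarrow> 'a cvec \<Rightarrow> complex) \<Rightarrow> bool" where
  "nonvanishing A \<alpha> \<longleftrightarrow> (\<forall>p. \<exists>v\<in>rtangent A p. \<alpha> p v \<noteq> 0)"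

definition ker_form ::
  "('a, 'm::finite) atlas \<Rightarrow> ('a \<Rightarrow> 'a cvec \<Rightarrow> complex) \<Rightarrow> 'a \<Rightarrow> 'a cvec set" where
  "ker_form A \<alpha> p = {v \<in> rtangent A p. \<alpha> p v = 0}"

text \<open>The exterior derivative, evaluated on smooth vector fields by Cartan's formula (without
  a factor 1/2).\<close>
definition ext_deriv ::
  "('a \<Rightarrow> 'a cvec \<Rightarrow> complex) \<Rightarrow> ('a \<Rightarrow> 'a cvec) \<Rightarrow> ('a \<Rightarrow> 'a cvec) \<Rightarrow> 'a \<Rightarrow> complex" where
  "ext_deriv \<alpha> Z W p =
     Z p (\<lambda>q. \<alpha> q (W q)) - W p (\<lambda>q. \<alpha> q (Z q)) - \<alpha> p (lie_bracket Z W p)"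


section \<open>CR structures and Sasakian manifolds\<close>

definition complex_subbundle ::
  "('a::topological_space, 'm::finite) atlas \<Rightarrow> nat \<Rightarrow> ('a \<Rightarrow> 'a cvec set) \<Rightarrow> bool" where
  "complex_subbundle A n L \<longleftrightarrow>
     (\<forall>p. L p \<subseteq> ctangent A p) \<and>
     (\<forall>p. \<exists>U E. open U \<and> p \<in> U \<and>
        (\<forall>i<n. smooth_section A U L (E i)) \<and>
        (\<forall>q\<in>U. bij_betw (\<lambda>c f. \<Sum>i<n. c i * E i q f) ({..<n} \<rightarrow>\<^sub>E UNIV) (L q)))"

definition cr_structure ::
  "('a::topological_space, 'm::finite) atlas \<Rightarrow> nat \<Rightarrow> ('a \<Rightarrow> 'a cvec set) \<Rightarrow> bool" where
  "cr_structure A n L \<longleftrightarrow>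
     complex_subbundle A n L \<and>
     (\<forall>p. L p \<inter> vconj ` L p = {vzero}) \<and>
     (\<forall>Z W. smooth_section A UNIV L Z \<and> smooth_section A UNIV L W \<longrightarrow>
        smooth_section A UNIV L (lie_bracket Z W))"

definition Re_bundle :: "('a \<Rightarrow> 'a cvec set) \<Rightarrow> 'a \<Rightarrow> 'a cvec set" where
  "Re_bundle L p = {vscale (1/2) (vadd v (vconj v)) | v. v \<in> L p}"

text \<open>\<open>d\<alpha>(Z, conj Z) / (2i) > 0\<close> for nonzero \<open>Z\<close> in \<open>L\<close>; every vector of \<open>L p\<close> is the
  value at \<open>p\<close> of a smooth section of \<open>L\<close>, and the expression depends only on that value when
  \<open>\<alpha>\<close> is a one-form.\<close>
definition levi_positive ::
  "('a, 'm::finite) atlas \<Rightarrow> ('a \<Rightarrow> 'a cvec set) \<Rightarrow> ('a \<Rightarrow> 'a cvec \<Rightarrow> complex) \<Rightarrow> bool" where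
  "levi_positive A L \<alpha> \<longleftrightarrow>
     (\<forall>Z p. smooth_section A UNIV L Z \<and> Z p \<noteq> vzero \<longrightarrow>
        (\<exists>r::real. r > 0 \<and>
           1 / (2 * \<i>) * ext_deriv \<alpha> Z (\<lambda>q. vconj (Z q)) p = complex_of_real r))"

definition strictly_pseudoconvex ::
  "('a, 'm::finite) atlas \<Rightarrow> ('a \<Rightarrow> 'a cvec set) \<Rightarrow> bool" where
  "strictly_pseudoconvex A L \<longleftrightarrow>
     (\<exists>\<alpha>. real_one_form A \<alpha> \<and> nonvanishing A \<alpha> \<and>
        (\<forall>p. ker_form A \<alpha> p = Re_bundle L p) \<and> levi_positive A L \<alpha>)"

definition transversal ::
  "('a, 'm::finite) atlas \<Rightarrow> ('a \<Rightarrow> 'a cvec set) \<Rightarrow> ('a \<Rightarrow> 'a cvec) \<Rightarrow> bool" where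
  "transversal A L T \<longleftrightarrow>
     (\<forall>p. bij_betw (\<lambda>(v, w, c). vadd (vadd v w) (vscale c (T p)))
            (L p \<times> vconj ` L p \<times> UNIV) (ctangent A p))"

definition cr_vector_field ::
  "('a, 'm::finite) atlas \<Rightarrow> ('a \<Rightarrow> 'a cvec set) \<Rightarrow> ('a \<Rightarrow> 'a cvec) \<Rightarrow> bool" where
  "cr_vector_field A L T \<longleftrightarrow>
     (\<forall>Z. smooth_section A UNIV L Z \<longrightarrow> smooth_section A UNIV L (lie_bracket T Z))"

definition sasakian ::
  "('a::{t2_space,second_countable_topology}, 'm::finite) atlas \<Rightarrow> nat \<Rightarrow>
     ('a \<Rightarrow> 'a cvec set) \<Rightarrow> ('a \<Rightarrow> 'a cvec) \<Rightarrow> bool" where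
  "sasakian A n L T \<longleftrightarrow>
     n \<ge> 1 \<and> CARD('m) = 2 * n + 1 \<and>
     smooth_atlas A \<and> connected (UNIV :: 'a set) \<and> orientable A \<and>
     cr_structure A n L \<and>
     smooth_section A UNIV (rtangent A) T \<and> transversal A L T \<and> cr_vector_field A L T \<and>
     (\<exists>\<alpha>. real_one_form A \<alpha> \<and> (\<forall>p. \<alpha> p (T p) = 1) \<and>
        (\<forall>p. ker_form A \<alpha> p = Re_bundle L p) \<and> levi_positive A L \<alpha>)"

definition deform ::
  "('a \<Rightarrow> 'a cvec set) \<Rightarrow> ('a \<Rightarrow> 'a cvec) \<Rightarrow> ('a \<Rightarrow> real) \<Rightarrow> 'a \<Rightarrow> 'a cvec set" where
  "deform L T \<phi> p =
     {vadd v (vscale (- \<i> * v (\<lambda>x. complex_of_real (\<phi> x))) (T p)) | v. v \<in> L p}"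


section \<open>Weighted spheres\<close>

text \<open>\<open>\<complex>\<^sup>N\<close> is the set of \<open>z :: nat \<Rightarrow> complex\<close> with \<open>z j = 0\<close> for \<open>j \<ge> N\<close>. The complexified
  tangent vector \<open>\<Sum>j<N. a j \<partial>/\<partial>z\<^sub>j + b j \<partial>/\<partial>(cnj z\<^sub>j)\<close> of \<open>\<complex>\<^sup>N\<close> is the pair \<open>(a, b)\<close>, i.e.
  \<open>a j\<close> and \<open>b j\<close> are its values on the coordinate functions \<open>z\<^sub>j\<close> and \<open>cnj z\<^sub>j\<close>.\<close>
definition complex_space :: "nat \<Rightarrow> (nat \<Rightarrow> complex) set" where
  "complex_space N = {z. \<forall>j\<ge>N. z j = 0}"

definition pushforward ::
  "('a \<Rightarrow> nat \<Rightarrow> complex) \<Rightarrow> nat \<Rightarrow> 'a cvec \<Rightarrow> (nat \<Rightarrow> complex) \<times> (nat \<Rightarrow> complex)" where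
  "pushforward F N v =
     ((\<lambda>j. if j < N then v (\<lambda>x. F x j) else 0), (\<lambda>j. if j < N then v (\<lambda>x. cnj (F x j)) else 0))"

definition T10_space :: "nat \<Rightarrow> ((nat \<Rightarrow> complex) \<times> (nat \<Rightarrow> complex)) set" where
  "T10_space N = complex_space N \<times> {\<lambda>j. 0}"

definition weighted_field ::
  "nat \<Rightarrow> (nat \<Rightarrow> real) \<Rightarrow> (nat \<Rightarrow> complex) \<Rightarrow> (nat \<Rightarrow> complex) \<times> (nat \<Rightarrow> complex)" where
  "weighted_field N \<beta> z =
     ((\<lambda>j. if j < N then \<i> * of_real (\<beta> j) * z j else 0),
      (\<lambda>j. if j < N then - \<i> * of_real (\<beta> j) * cnj (z j) else 0))"

text \<open>On \<open>complex_space N\<close> the product topology of \<open>nat \<Rightarrow> complex\<close> is the usual topology of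
  \<open>\<complex>\<^sup>N\<close>.\<close>
definition smooth_embedding ::
  "('a::topological_space, 'm::finite) atlas \<Rightarrow> nat \<Rightarrow> ('a \<Rightarrow> nat \<Rightarrow> complex) \<Rightarrow> bool" where
  "smooth_embedding A N F \<longleftrightarrow>
     range F \<subseteq> complex_space N \<and>
     (\<forall>j<N. mfd_smooth A (\<lambda>x. F x j)) \<and>
     (\<forall>p. inj_on (pushforward F N) (ctangent A p)) \<and>
     embedding_map euclidean euclidean F"

definition induced_by_weighted_sphere ::
  "('a::topological_space, 'm::finite) atlas \<Rightarrow> ('a \<Rightarrow> 'a cvec set) \<Rightarrow> ('a \<Rightarrow> 'a cvec) \<Rightarrow> bool" where
  "induced_by_weighted_sphere A L T \<longleftrightarrow>
     (\<exists>N \<beta> F. (\<forall>j<N. \<beta> j > 0) \<and> smooth_embedding A N F \<and>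
        (\<forall>p. pushforward F N ` L p = pushforward F N ` ctangent A p \<inter> T10_space N) \<and>
        (\<forall>p. L2_set (\<lambda>j. cmod (F p j)) {..<N} = 1) \<and>
        (\<forall>p. pushforward F N (T p) = weighted_field N \<beta> (F p)))"


section \<open>The smooth topology, quotients and sets of first category\<close>

text \<open>Topology of uniform convergence of all derivatives in charts, on compact subsets of the
  chart domains.\<close>
definition smooth_topology :: "('a, 'm::finite) atlas \<Rightarrow> ('a \<Rightarrow> real) topology" where
  "smooth_topology A = topology_generated_by
     {{g. mfd_smooth A g \<and>
          (\<forall>x\<in>K. \<bar>iter_partial is (g \<circ> inv_into U \<phi>) x - iter_partial is (f \<circ> inv_into U \<phi>) x\<bar> < e)}
      | f U \<phi> K is e.
        mfd_smooth A f \<and> (U, \<phi>) \<in> A \<and> compact K \<and> K \<subseteq> \<phi> ` U \<and> e > 0}"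

definition quotient_topology :: "'b topology \<Rightarrow> ('b \<Rightarrow> 'c) \<Rightarrow> 'c topology" where
  "quotient_topology Y q =
     topology (\<lambda>W. W \<subseteq> q ` topspace Y \<and> openin Y {x \<in> topspace Y. q x \<in> W})"

definition nowhere_dense_in :: "'b topology \<Rightarrow> 'b set \<Rightarrow> bool" where
  "nowhere_dense_in Y S \<longleftrightarrow> S \<subseteq> topspace Y \<and> Y interior_of (Y closure_of S) = {}"

definition first_category_in :: "'b topology \<Rightarrow> 'b set \<Rightarrow> bool" where
  "first_category_in Y S \<longleftrightarrow>
     (\<exists>D :: nat \<Rightarrow> 'b set. (\<forall>k. nowhere_dense_in Y (D k)) \<and> S = (\<Union>k. D k))"

definition admissible ::
  "('a, 'm::finite) atlas \<Rightarrow> ('a \<Rightarrow> 'a cvec set) \<Rightarrow> ('a \<Rightarrow> 'a cvec) \<Rightarrow> ('a \<Rightarrow> real) set" where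
  "admissible A L T =
     {\<phi>. mfd_smooth A \<phi> \<and> (\<forall>p. T p (\<lambda>x. complex_of_real (\<phi> x)) = 0) \<and>
         strictly_pseudoconvex A (deform L T \<phi>)}"

definition const_class :: "('a \<Rightarrow> real) \<Rightarrow> ('a \<Rightarrow> real) set" where
  "const_class \<phi> = {(\<lambda>x. \<phi> x + c) | c. True}"

definition moduli ::
  "('a, 'm::finite) atlas \<Rightarrow> ('a \<Rightarrow> 'a cvec set) \<Rightarrow> ('a \<Rightarrow> 'a cvec) \<Rightarrow> ('a \<Rightarrow> real) set topology" where
  "moduli A L T =
     quotient_topology (subtopology (smooth_topology A) (admissible A L T)) const_class"

definition sphere_induced ::
  "('a::topological_space, 'm::finite) atlas \<Rightarrow> ('a \<Rightarrow> 'a cvec set) \<Rightarrow> ('a \<Rightarrow> 'a cvec) \<Rightarrow>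
     ('a \<Rightarrow> real) set set" where
  "sphere_induced A L T =
     {const_class \<phi> | \<phi>. \<phi> \<in> admissible A L T \<and> induced_by_weighted_sphere A (deform L T \<phi>) T}"

lemma istopology_quotient:
  "istopology (\<lambda>W. W \<subseteq> q ` topspace Y \<and> openin Y {x \<in> topspace Y. q x \<in> W})"
  unfolding istopology_def
proof (intro conjI allI impI; (elim conjE)?)
  fix S T
  assume "openin Y {x \<in> topspace Y. q x \<in> S}" "openin Y {x \<in> topspace Y. q x \<in> T}"
  then have "openin Y ({x \<in> topspace Y. q x \<in> S} \<inter> {x \<in> topspace Y. q x \<in> T})"
    by (rule openin_Int)
  moreover have "{x \<in> topspace Y. q x \<in> S} \<inter> {x \<in> topspace Y. q x \<in> T}
      = {x \<in> topspace Y. q x \<in> S \<inter> T}" by auto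
  ultimately show "openin Y {x \<in> topspace Y. q x \<in> S \<inter> T}" by simp
next
  fix \<K>
  assume "\<forall>K\<in>\<K>. K \<subseteq> q ` topspace Y \<and> openin Y {x \<in> topspace Y. q x \<in> K}"
  then have "openin Y (\<Union>K\<in>\<K>. {x \<in> topspace Y. q x \<in> K})" by blast
  moreover have "(\<Union>K\<in>\<K>. {x \<in> topspace Y. q x \<in> K}) = {x \<in> topspace Y. q x \<in> \<Union>\<K>}"
    by auto
  ultimately show "openin Y {x \<in> topspace Y. q x \<in> \<Union>\<K>}" by simp
qed (auto simp: subset_iff)

lemma openin_quotient_topology:
  "openin (quotient_topology Y q) W \<longleftrightarrow>
     W \<subseteq> q ` topspace Y \<and> openin Y {x \<in> topspace Y. q x \<in> W}"
  by (simp add: quotient_topology_def topology_inverse' istopology_quotient)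

lemma topspace_quotient_topology: "topspace (quotient_topology Y q) = q ` topspace Y"
proof
  show "topspace (quotient_topology Y q) \<subseteq> q ` topspace Y"
    by (metis openin_quotient_topology openin_topspace)
  have "{x \<in> topspace Y. q x \<in> q ` topspace Y} = topspace Y" by auto
  then have "openin (quotient_topology Y q) (q ` topspace Y)"
    by (simp add: openin_quotient_topology)
  then show "q ` topspace Y \<subseteq> topspace (quotient_topology Y q)"
    by (rule openin_subset)
qed

lemma quotient_map_quotient_topology: "quotient_map Y (quotient_topology Y q) q"
  by (auto simp: quotient_map_def topspace_quotient_topology openin_quotient_topology)

lemma topspace_smooth_topology:
  fixes A :: "('a::{t2_space,second_countable_topology}, 'm::finite) atlas"
  assumes "smooth_atlas A"
  shows "topspace (smooth_topology A) = {f. mfd_smooth A f}"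
proof -
  obtain U \<phi> where U: "(U, \<phi>) \<in> A"
    using assms unfolding smooth_atlas_def by (metis (no_types, lifting) UN_E UNIV_I case_prodE)
  show ?thesis
    unfolding smooth_topology_def topology_generated_by_topspace
  proof (intro equalityI subsetI)
    fix f :: "'a \<Rightarrow> real" assume "f \<in> {f. mfd_smooth A f}"
    then have f: "mfd_smooth A f" by simp
    have "{g :: 'a \<Rightarrow> real. mfd_smooth A g \<and> (\<forall>x\<in>{}. \<bar>iter_partial [] (g \<circ> inv_into U \<phi>) x -
       iter_partial [] (f \<circ> inv_into U \<phi>) x\<bar> < (1::real))} = {g. mfd_smooth A g}" by simp
    with f U show "f \<in> \<Union> {{g. mfd_smooth A g \<and>
          (\<forall>x\<in>K. \<bar>iter_partial is (g \<circ> inv_into U \<phi>) x - iter_partial is (f \<circ> inv_into U \<phi>) x\<bar> < e)}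
      | f U \<phi> K is e.
        mfd_smooth A f \<and> (U, \<phi>) \<in> A \<and> compact K \<and> K \<subseteq> \<phi> ` U \<and> e > 0}"
      by (intro UnionI[where X = "{g. mfd_smooth A g}"] CollectI exI[of _ f] exI[of _ U]
            exI[of _ \<phi>] exI[of _ "{}"] exI[of _ "[]"] exI[of _ "1::real"]) auto
  qed blast
qed

lemma topspace_moduli:
  assumes "smooth_atlas A"
  shows "topspace (moduli A L T) = const_class ` admissible A L T"
  using topspace_smooth_topology[OF assms]
  by (auto simp: moduli_def topspace_quotient_topology admissible_def)

end

theory Submission
  imports Defs "HOL-Complex_Analysis.Complex_Analysis"
begin

text \<open>Fix \<open>\<phi>\<^sub>0\<close> in the set in question (which otherwise is empty), and a CR embedding \<open>F\<close> of
  \<open>\<V>(\<phi>\<^sub>0)\<close> into a weighted sphere. On the cone \<open>X \<times> \<real>\<close> the functions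
  \<open>exp (- \<beta>\<^sub>j s) F\<^sub>j\<close> are holomorphic coordinates, so the inverse function theorem yields a
  holomorphic disc through any point in any direction.

  If \<open>\<phi> = \<phi>\<^sub>0 + f\<close> is induced by a sphere embedding \<open>G\<close> with weights \<open>\<gamma>\<close>, then the functions
  \<open>exp (- \<gamma>\<^sub>j (f + s)) G\<^sub>j\<close> are holomorphic on the disc, and \<open>|G| = 1\<close> says that
  \<open>u = f + s\<close> solves \<open>\<Sum>\<^sub>j exp (2 \<gamma>\<^sub>j u) |h\<^sub>j|\<^sup>2 = 1\<close> with holomorphic \<open>h\<^sub>j\<close>. By the implicit function theorem \<open>u\<close> is
  real-analytic on the real diameter of the disc. Quantifying the size of its holomorphic extension by
  \<open>k\<close> gives countably many conditions, closed even for pointwise convergence by Montel's theorem.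

  They have empty interior: the Levi form is affine in the potential, so the strictly pseudoconvex
  potentials form a convex set, and it contains \<open>\<phi>\<^sub>0 + \<epsilon> \<kappa>(|F\<^sub>j|\<^sup>2)\<close> for a flat, non-analytic \<open>\<kappa>\<close>. Moving from \<open>\<phi>\<close> a little
  towards this potential destroys analyticity.\<close>

text \<open>One disc serves every potential, because a CR function of any deformation becomes one of
  the base structure after multiplication by an exponential (\<open>crf_deform\<close>). The height
  \<open>s\<close> of the disc over the manifold is not known beforehand to be analytic along the
  diameter. It is so because \<open>\<phi>0\<close> itself satisfies the analyticity condition, and
  therefore \<open>s\<close> can be eliminated in the final comparison. The obstacle to convexity is
  that strict pseudoconvexity admits any contact form, whose value on \<open>T\<close> may a priori
  have either sign, whereas only the form with value 1 on \<open>T\<close> depends affinely on the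
  potential. Compactness, connectedness and the maximum principle exclude the wrong sign
  (\<open>psc_good\<close>). That a small flat perturbation stays strictly pseudoconvex needs no
  bound on vector fields: both the Levi form of the sphere and its perturbation are compared
  pointwise with the squared length \<open>P\<close> of the pushed-forward vector.\<close>

unbundle no Formal_Power_Series.fps_syntax

subsection \<open>Smooth functions on Euclidean space\<close>

definition pder :: "'m::finite \<Rightarrow> (real^'m \<Rightarrow> 'b::real_normed_vector) \<Rightarrow> real^'m \<Rightarrow> 'b" where
  "pder i f x = frechet_derivative f (at x) (axis i 1)"

text \<open>Differentiability of finite order, stratified so that closure properties can be proved
  by induction. The recursion takes the first derivative of \<open>f\<close> and descends, so that a
  formula such as the product rule feeds directly into the induction hypothesis.\<close>

fun diff_order :: "nat \<Rightarrow> (real^'m::finite) set \<Rightarrow> (real^'m \<Rightarrow> 'b::real_normed_vector) \<Rightarrow> bool" where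
  "diff_order 0 S f \<longleftrightarrow> (\<forall>x\<in>S. f differentiable at x)"
| "diff_order (Suc k) S f \<longleftrightarrow> (\<forall>x\<in>S. f differentiable at x) \<and> (\<forall>i. diff_order k S (pder i f))"

text \<open>\<open>iter_partial\<close> applies the head of the list last. Appending at the end
  therefore changes the innermost derivative, which is the one that \<open>diff_order\<close> takes
  off.\<close>

lemma iter_partial_snoc: "iter_partial (is @ [i]) f = iter_partial is (pder i f)"
proof (induction "is")
  case Nil show ?case by (simp add: pder_def fun_eq_iff)
next
  case (Cons j "is") then show ?case by simp
qed

lemma iter_partial_Cons: "iter_partial (i # is) f = pder i (iter_partial is f)"
  by (auto simp: pder_def)

lemma diff_order_iff:
  "diff_order k S f \<longleftrightarrow> (\<forall>is. length is \<le> k \<longrightarrow> (\<forall>x\<in>S. iter_partial is f differentiable (at x)))"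
proof (induction k arbitrary: f)
  case 0
  then show ?case by simp
next
  case (Suc k)
  show ?case
  proof
    assume *: "diff_order (Suc k) S f"
    show "\<forall>is. length is \<le> Suc k \<longrightarrow> (\<forall>x\<in>S. iter_partial is f differentiable (at x))"
    proof (intro allI impI)
      fix "is" :: "'a list" assume "length is \<le> Suc k"
      then show "\<forall>x\<in>S. iter_partial is f differentiable (at x)"
        using * Suc by (cases "is" rule: rev_cases) (auto simp: iter_partial_snoc simp del: iter_partial.simps(2))
    qed
  next
    assume *: "\<forall>is. length is \<le> Suc k \<longrightarrow> (\<forall>x\<in>S. iter_partial is f differentiable (at x))"
    have "\<forall>x\<in>S. f differentiable at x" using spec[OF *, of "[]"] by simp
    moreover have "diff_order k S (pder i f)" for i
      unfolding Suc
    proof (intro allI impI)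
      fix "is" :: "'a list" assume "length is \<le> k"
      then show "\<forall>x\<in>S. iter_partial is (pder i f) differentiable (at x)"
        using spec[OF *, of "is @ [i]"] by (simp add: iter_partial_snoc)
    qed
    ultimately show "diff_order (Suc k) S f" by simp
  qed
qed

lemma smooth_on_iff: "smooth_on S f \<longleftrightarrow> (\<forall>k. diff_order k S f)"
  unfolding smooth_on_def diff_order_iff by blast

lemma smooth_on_differentiable: "smooth_on S f \<Longrightarrow> x \<in> S \<Longrightarrow> f differentiable at x"
  unfolding smooth_on_def by (metis iter_partial.simps(1))

lemma smooth_on_pder: "smooth_on S f \<Longrightarrow> smooth_on S (pder i f)"
  unfolding smooth_on_def by (metis iter_partial_snoc)

lemma smooth_on_iter: "smooth_on S f \<Longrightarrow> smooth_on S (iter_partial is f)"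
proof (induction "is")
  case (Cons i "is") then show ?case unfolding iter_partial_Cons by (intro smooth_on_pder) simp
qed simp

lemma smooth_on_subset: "smooth_on S f \<Longrightarrow> R \<subseteq> S \<Longrightarrow> smooth_on R f"
  unfolding smooth_on_def by blast

lemma smooth_on_Un: "smooth_on S f \<Longrightarrow> smooth_on R f \<Longrightarrow> smooth_on (S \<union> R) f"
  unfolding smooth_on_def by blast

lemma smooth_on_continuous_on: "smooth_on S f \<Longrightarrow> continuous_on S f"
  by (meson continuous_at_imp_continuous_on differentiable_imp_continuous_within smooth_on_differentiable)

lemma smooth_on_has_derivative:
  assumes "smooth_on S f" "x \<in> S"
  shows "(f has_derivative (\<lambda>v. \<Sum>i\<in>UNIV. (v $ i) *\<^sub>R pder i f x)) (at x)"
proof -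
  have d: "(f has_derivative frechet_derivative f (at x)) (at x)"
    using smooth_on_differentiable[OF assms] by (simp add: frechet_derivative_works)
  then have lin: "linear (frechet_derivative f (at x))" by (rule has_derivative_linear)
  have "frechet_derivative f (at x) v = (\<Sum>i\<in>UNIV. (v $ i) *\<^sub>R pder i f x)" for v
  proof -
    have "frechet_derivative f (at x) v = frechet_derivative f (at x) (\<Sum>i\<in>UNIV. (v $ i) *\<^sub>R axis i 1)"
      by (simp add: basis_expansion flip: scalar_mult_eq_scaleR)
    also have "\<dots> = (\<Sum>i\<in>UNIV. (v $ i) *\<^sub>R pder i f x)"
      by (simp add: linear_sum[OF lin] linear_cmul[OF lin] pder_def)
    finally show ?thesis .
  qed
  then have "frechet_derivative f (at x) = (\<lambda>v. \<Sum>i\<in>UNIV. (v $ i) *\<^sub>R pder i f x)" by blast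
  with d show ?thesis by simp
qed

lemma pder_eqI: "(f has_derivative D) (at x) \<Longrightarrow> pder i f x = D (axis i 1)"
  unfolding pder_def using frechet_derivative_at by metis

lemma pder_cong:
  assumes "open S" "\<And>x. x \<in> S \<Longrightarrow> f x = g x" "x \<in> S"
  shows "pder i f x = pder i g x"
proof -
  have "(f has_derivative D) (at x) \<longleftrightarrow> (g has_derivative D) (at x)" for D
    using assms has_derivative_transform_within_open[of f D x UNIV S g] has_derivative_transform_within_open[of g D x UNIV S f]
    by auto
  then show ?thesis unfolding pder_def frechet_derivative_def by simp
qed

lemma iter_partial_cong:
  assumes "open S" "\<And>x. x \<in> S \<Longrightarrow> f x = g x"
  shows "x \<in> S \<Longrightarrow> iter_partial is f x = iter_partial is g x"
proof (induction "is" arbitrary: x)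
  case Nil
  then show ?case using assms by simp
next
  case (Cons i "is")
  then show ?case unfolding iter_partial_Cons using pder_cong[OF assms(1)] by blast
qed

lemma differentiable_cong_open:
  assumes "open S" "\<And>x. x \<in> S \<Longrightarrow> f x = g x" "x \<in> S"
  shows "f differentiable (at x) \<longleftrightarrow> g differentiable (at x)"
  using assms has_derivative_transform_within_open[of f _ x UNIV S g] has_derivative_transform_within_open[of g _ x UNIV S f]
  unfolding differentiable_def by auto

lemma diff_order_cong:
  assumes "open S" "\<And>x. x \<in> S \<Longrightarrow> f x = g x"
  shows "diff_order k S f \<longleftrightarrow> diff_order k S g"
proof -
  have "iter_partial is f differentiable (at x) \<longleftrightarrow> iter_partial is g differentiable (at x)" if "x \<in> S" for "is" x
    by (rule differentiable_cong_open[OF assms(1) iter_partial_cong[OF assms] that])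
  then show ?thesis unfolding diff_order_iff by auto
qed

lemma smooth_on_cong:
  assumes "open S" "\<And>x. x \<in> S \<Longrightarrow> f x = g x"
  shows "smooth_on S f \<longleftrightarrow> smooth_on S g"
  unfolding smooth_on_iff using diff_order_cong[OF assms(1), of f g] assms(2) by simp

lemma diff_order_mono: "diff_order k S f \<Longrightarrow> j \<le> k \<Longrightarrow> diff_order j S f"
  unfolding diff_order_iff by auto

lemma diff_order_differentiable: "diff_order k S f \<Longrightarrow> x \<in> S \<Longrightarrow> f differentiable at x"
  by (cases k) auto

lemma diff_order_has_derivative: "diff_order k S f \<Longrightarrow> x \<in> S \<Longrightarrow> (f has_derivative frechet_derivative f (at x)) (at x)"
  using diff_order_differentiable frechet_derivative_works by blast

text \<open>Working rule for the closure proofs: on an open set the partial derivatives may be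
  replaced by expressions that agree with them there, and those are handled by induction.\<close>

lemma diff_order_SucI:
  assumes "open S" "\<And>x. x \<in> S \<Longrightarrow> f differentiable at x"
    "\<And>i. diff_order k S (g i)" "\<And>x i. x \<in> S \<Longrightarrow> pder i f x = g i x"
  shows "diff_order (Suc k) S f"
  using assms(2,3) diff_order_cong[OF assms(1), of "pder _ f" "g _"] assms(4) by auto

lemma diff_order_linear:
  assumes S: "open S" and h: "bounded_linear h"
  shows "diff_order k S f \<Longrightarrow> diff_order k S (\<lambda>x. h (f x))"
proof (induction k arbitrary: f)
  case 0
  then show ?case using h by (auto simp: bounded_linear_imp_differentiable differentiable_compose)
next
  case (Suc k)
  have *: "((\<lambda>x. h (f x)) has_derivative (\<lambda>v. h (frechet_derivative f (at x) v))) (at x)" if "x \<in> S" for x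
    using diff_order_has_derivative[OF Suc.prems that] bounded_linear.has_derivative[OF h] by blast
  show ?case
  proof (rule diff_order_SucI[OF S, where g = "\<lambda>i x. h (pder i f x)"])
    show "(\<lambda>x. h (f x)) differentiable (at x)" if "x \<in> S" for x
      using *[OF that] differentiable_def by blast
    show "pder i (\<lambda>x. h (f x)) x = h (pder i f x)" if "x \<in> S" for x i
      using pder_eqI[OF *[OF that]] by (simp add: pder_def)
  qed (use Suc in auto)
qed

lemma diff_order_add:
  assumes S: "open S"
  shows "diff_order k S f \<Longrightarrow> diff_order k S g \<Longrightarrow> diff_order k S (\<lambda>x. f x + g x)"
proof (induction k arbitrary: f g)
  case 0
  then show ?case by auto
next
  case (Suc k)
  have *: "((\<lambda>x. f x + g x) has_derivative (\<lambda>v. frechet_derivative f (at x) v + frechet_derivative g (at x) v)) (at x)" if "x \<in> S" for x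
    using Suc.prems that by (intro has_derivative_add diff_order_has_derivative)
  show ?case
  proof (rule diff_order_SucI[OF S, where g = "\<lambda>i x. pder i f x + pder i g x"])
    show "(\<lambda>x. f x + g x) differentiable (at x)" if "x \<in> S" for x
      using *[OF that] differentiable_def by blast
    show "pder i (\<lambda>x. f x + g x) x = pder i f x + pder i g x" if "x \<in> S" for x i
      using pder_eqI[OF *[OF that]] by (simp add: pder_def)
  qed (use Suc in auto)
qed

lemma pder_const: "pder i (\<lambda>x. c) = (\<lambda>x. 0)"
  by (auto simp: pder_def frechet_derivative_const)

lemma diff_order_const: "diff_order k S (\<lambda>x. c)"
  by (induction k arbitrary: c) (auto simp: pder_const)

lemma diff_order_mult:
  fixes f g :: "real^'m::finite \<Rightarrow> 'b::real_normed_algebra"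
  assumes S: "open S"
  shows "diff_order k S f \<Longrightarrow> diff_order k S g \<Longrightarrow> diff_order k S (\<lambda>x. f x * g x)"
proof (induction k arbitrary: f g)
  case 0
  then show ?case by (auto intro: differentiable_mult)
next
  case (Suc k)
  have *: "((\<lambda>x. f x * g x) has_derivative (\<lambda>v. f x * frechet_derivative g (at x) v + frechet_derivative f (at x) v * g x)) (at x)" if "x \<in> S" for x
    using Suc.prems that by (intro has_derivative_mult diff_order_has_derivative)
  show ?case
  proof (rule diff_order_SucI[OF S, where g = "\<lambda>i x. f x * pder i g x + pder i f x * g x"])
    show "(\<lambda>x. f x * g x) differentiable (at x)" if "x \<in> S" for x
      using *[OF that] differentiable_def by blast
    show "pder i (\<lambda>x. f x * g x) x = f x * pder i g x + pder i f x * g x" if "x \<in> S" for x i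
      using pder_eqI[OF *[OF that]] by (simp add: pder_def)
    have "diff_order k S f" "diff_order k S g" using Suc.prems diff_order_mono by (meson le_SucI order_refl)+
    then show "diff_order k S (\<lambda>x. f x * pder i g x + pder i f x * g x)" for i
      using Suc by (intro diff_order_add S) auto
  qed
qed

text \<open>The outer function comes as a whole sequence of successive derivatives, and the
  induction runs over all its members at once.\<close>

lemma diff_order_compose:
  fixes f :: "real^'m::finite \<Rightarrow> real" and h :: "nat \<Rightarrow> real \<Rightarrow> real"
  assumes S: "open S" and h: "\<And>j x. x \<in> S \<Longrightarrow> (h j has_real_derivative h (Suc j) (f x)) (at (f x))"
  shows "diff_order k S f \<Longrightarrow> diff_order k S (\<lambda>x. h j (f x))"
proof (induction k arbitrary: j)
  case 0
  then show ?case using h has_derivative_compose[where f = f]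
    by (auto simp: differentiable_def has_field_derivative_def) blast
next
  case (Suc k)
  have *: "((\<lambda>x. h j (f x)) has_derivative (\<lambda>v. h (Suc j) (f x) * frechet_derivative f (at x) v)) (at x)" if "x \<in> S" for x
    using has_derivative_compose[OF diff_order_has_derivative[OF Suc.prems that]] h[OF that]
    unfolding has_field_derivative_def by blast
  show ?case
  proof (rule diff_order_SucI[OF S, where g = "\<lambda>i x. h (Suc j) (f x) * pder i f x"])
    show "(\<lambda>x. h j (f x)) differentiable (at x)" if "x \<in> S" for x
      using *[OF that] differentiable_def by blast
    show "pder i (\<lambda>x. h j (f x)) x = h (Suc j) (f x) * pder i f x" if "x \<in> S" for x i
      using pder_eqI[OF *[OF that]] by (simp add: pder_def)
    have "diff_order k S f" using Suc.prems diff_order_mono by (meson le_SucI order_refl)+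
    then show "diff_order k S (\<lambda>x. h (Suc j) (f x) * pder i f x)" for i
      using Suc by (intro diff_order_mult S) auto
  qed
qed

lemma diff_order_inverse:
  fixes f :: "real^'m::finite \<Rightarrow> 'b::real_normed_field"
  assumes S: "open S" and f: "\<And>x. x \<in> S \<Longrightarrow> f x \<noteq> 0"
  shows "diff_order k S f \<Longrightarrow> diff_order k S (\<lambda>x. inverse (f x))"
proof (induction k)
  case 0
  then show ?case using f by (auto intro: differentiable_inverse)
next
  case (Suc k)
  have *: "((\<lambda>x. inverse (f x)) has_derivative (\<lambda>v. - (inverse (f x) * frechet_derivative f (at x) v * inverse (f x)))) (at x)" if "x \<in> S" for x
    using f that by (intro Deriv.has_derivative_inverse diff_order_has_derivative[OF Suc.prems]) auto
  show ?case
  proof (rule diff_order_SucI[OF S, where g = "\<lambda>i x. (-1) * (inverse (f x) * pder i f x * inverse (f x))"])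
    show "(\<lambda>x. inverse (f x)) differentiable (at x)" if "x \<in> S" for x
      using *[OF that] differentiable_def by blast
    show "pder i (\<lambda>x. inverse (f x)) x = (-1) * (inverse (f x) * pder i f x * inverse (f x))" if "x \<in> S" for x i
      using pder_eqI[OF *[OF that]] by (simp add: pder_def)
    have "diff_order k S f" using Suc.prems diff_order_mono by (meson le_SucI order_refl)+
    then show "diff_order k S (\<lambda>x. (-1) * (inverse (f x) * pder i f x * inverse (f x)))" for i
      using Suc by (intro diff_order_mult diff_order_const S) auto
  qed
qed

lemma smooth_on_add: "open S \<Longrightarrow> smooth_on S f \<Longrightarrow> smooth_on S g \<Longrightarrow> smooth_on S (\<lambda>x. f x + g x)"
  by (simp add: smooth_on_iff diff_order_add)
lemma smooth_on_mult:
  fixes f g :: "real^'m::finite \<Rightarrow> 'b::real_normed_algebra"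
  shows "open S \<Longrightarrow> smooth_on S f \<Longrightarrow> smooth_on S g \<Longrightarrow> smooth_on S (\<lambda>x. f x * g x)"
  by (simp add: smooth_on_iff diff_order_mult)
lemma smooth_on_const: "smooth_on S (\<lambda>x. c)"
  by (simp add: smooth_on_iff diff_order_const)
lemma smooth_on_linear: "open S \<Longrightarrow> bounded_linear h \<Longrightarrow> smooth_on S f \<Longrightarrow> smooth_on S (\<lambda>x. h (f x))"
  by (simp add: smooth_on_iff diff_order_linear)
lemma smooth_on_inverse:
  fixes f :: "real^'m::finite \<Rightarrow> 'b::real_normed_field"
  shows "open S \<Longrightarrow> (\<And>x. x \<in> S \<Longrightarrow> f x \<noteq> 0) \<Longrightarrow> smooth_on S f \<Longrightarrow> smooth_on S (\<lambda>x. inverse (f x))"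
  by (simp add: smooth_on_iff diff_order_inverse)
lemma smooth_on_compose:
  fixes f :: "real^'m::finite \<Rightarrow> real"
  assumes "open S" "smooth_on S f" "\<And>j x. (h j has_real_derivative h (Suc j) x) (at x)"
  shows "smooth_on S (\<lambda>x. h 0 (f x))"
  using assms diff_order_compose[OF assms(1), of h f] by (simp add: smooth_on_iff)

lemma pder_add:
  assumes "smooth_on S f" "smooth_on S g" "x \<in> S"
  shows "pder i (\<lambda>x. f x + g x) x = pder i f x + pder i g x"
  unfolding pder_def
  using fun_cong[OF frechet_derivative_at[OF has_derivative_add[OF frechet_derivative_works[THEN iffD1, OF smooth_on_differentiable[OF assms(1,3)]]
    frechet_derivative_works[THEN iffD1, OF smooth_on_differentiable[OF assms(2,3)]]]]] by simp

lemma pder_linear: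
  assumes "smooth_on S f" "x \<in> S" "bounded_linear h"
  shows "pder i (\<lambda>x. h (f x)) x = h (pder i f x)"
  unfolding pder_def
  using fun_cong[OF frechet_derivative_at[OF bounded_linear.has_derivative[OF assms(3) frechet_derivative_works[THEN iffD1, OF smooth_on_differentiable[OF assms(1,2)]]]]]
  by simp

lemma iter_partial_add:
  assumes S: "open S" and f: "smooth_on S f" and g: "smooth_on S g"
  shows "x \<in> S \<Longrightarrow> iter_partial is (\<lambda>x. f x + g x) x = iter_partial is f x + iter_partial is g x"
proof (induction "is" arbitrary: x)
  case (Cons i "is")
  have "pder i (iter_partial is (\<lambda>x. f x + g x)) x = pder i (\<lambda>x. iter_partial is f x + iter_partial is g x) x"
    using Cons by (intro pder_cong[OF S]) auto
  also have "\<dots> = pder i (iter_partial is f) x + pder i (iter_partial is g) x"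
    using Cons.prems by (intro pder_add[where S = S] smooth_on_iter f g)
  finally show ?case unfolding iter_partial_Cons .
qed simp

lemma iter_partial_linear:
  assumes S: "open S" and f: "smooth_on S f" and h: "bounded_linear h"
  shows "x \<in> S \<Longrightarrow> iter_partial is (\<lambda>x. h (f x)) x = h (iter_partial is f x)"
proof (induction "is" arbitrary: x)
  case (Cons i "is")
  have "pder i (iter_partial is (\<lambda>x. h (f x))) x = pder i (\<lambda>x. h (iter_partial is f x)) x"
    using Cons by (intro pder_cong[OF S]) auto
  also have "\<dots> = h (pder i (iter_partial is f) x)"
    using Cons.prems by (intro pder_linear[where S = S] smooth_on_iter f h)
  finally show ?case unfolding iter_partial_Cons .
qed simp

subsection \<open>Flat functions\<close>

text \<open>The family \<open>s\<^sup>-\<^sup>n exp (- 1 / s)\<close>, extended by zero, is closed under differentiation up to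
  linear combinations.\<close>
definition flat :: "nat \<Rightarrow> real \<Rightarrow> real" where
  "flat n s = (if s > 0 then exp (- inverse s) * inverse s ^ n else 0)"

lemma flat_nonneg: "flat n s \<ge> 0" by (simp add: flat_def)

text \<open>With t = 1 / s, a single term t^n / n! of the exponential series is at most exp t. The
  bound serves both the derivative at 0 and the explicit constants in
  \<open>flat_bounds\<close>.\<close>

lemma flat_le: "flat n s \<le> fact n"
proof (cases "s > 0")
  case True
  have "inverse s ^ n / fact n \<le> exp (inverse s)"
  proof -
    have "(\<lambda>k. inverse (fact k) *\<^sub>R (inverse s ^ k)) sums exp (inverse s)" by (rule exp_converges)
    then have "(\<Sum>k\<in>{n}. inverse (fact k) *\<^sub>R (inverse s ^ k)) \<le> exp (inverse s)"
      using True by (intro sum_le_suminf[THEN order_trans] ) (auto simp: sums_iff)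
    then show ?thesis by (simp add: divide_inverse mult.commute)
  qed
  then have "inverse s ^ n \<le> fact n * exp (inverse s)"
    by (subst (asm) pos_divide_le_eq) (auto simp: mult.commute)
  then have "exp (- inverse s) * inverse s ^ n \<le> exp (- inverse s) * (fact n * exp (inverse s))"
 by (intro mult_left_mono) auto
  also have "\<dots> = fact n" by (simp add: exp_minus)
  finally show ?thesis using True by (simp add: flat_def)
qed (simp add: flat_def)

lemma flat_has_derivative:
  "(flat n has_real_derivative flat (n + 2) s - real n * flat (n + 1) s) (at s)"
proof -
  consider "s > 0" | "s < 0" | "s = 0" by linarith
  then show ?thesis
  proof cases
    case 1
    have "((\<lambda>s. exp (- inverse s) * inverse s ^ n) has_real_derivative flat (n + 2) s - real n * flat (n + 1) s) (at s)"
      using 1 apply (auto intro!: derivative_eq_intros simp: flat_def)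
      apply (cases n; simp add: field_simps power2_eq_square)
      done
    then show ?thesis
      by (rule has_field_derivative_transform_within_open[where S = "{0<..}"]) (use 1 in \<open>auto simp: flat_def\<close>)
  next
    case 2
    have "((\<lambda>s. 0) has_real_derivative flat (n + 2) s - real n * flat (n + 1) s) (at s)"
      using 2 by (simp add: flat_def)
    then show ?thesis
      by (rule has_field_derivative_transform_within_open[where S = "{..<0}"]) (use 2 in \<open>auto simp: flat_def\<close>)
  next
    case 3
    have b: "\<bar>flat n h / h\<bar> \<le> fact (n + 2) * \<bar>h\<bar>" for h
    proof (cases "h > 0")
      case True
      \<comment> \<open>The difference quotient at 0 is rewritten with a factor \<open>h\<close> to
        spare, at the price of two more inverse powers, which \<open>flat_le\<close> bounds
        uniformly.\<close>
      have "flat n h / h = h * flat (n + 2) h" using True by (simp add: flat_def field_simps power2_eq_square)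
      also have "\<dots> \<le> h * fact (n + 2)" using True by (intro mult_left_mono flat_le) auto
      finally show ?thesis using True flat_nonneg[of n h] by (simp add: mult.commute)
    next
      case False
      have "0 \<le> fact (n + 2) * \<bar>h\<bar>" by (intro mult_nonneg_nonneg) auto
      then show ?thesis using False by (simp add: flat_def del: fact_Suc)
    qed
    have "((\<lambda>h. fact (n + 2) * \<bar>h\<bar>) \<longlongrightarrow> fact (n + 2) * \<bar>0::real\<bar>) (at 0)" by (intro tendsto_intros)
    then have "((\<lambda>h. fact (n + 2) * \<bar>h\<bar>) \<longlongrightarrow> 0) (at (0::real))" by simp
    then have "((\<lambda>h. flat n h / h) \<longlongrightarrow> 0) (at 0)"
      by (rule Lim_null_comparison[rotated]) (use b in \<open>simp del: fact_Suc\<close>)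
    then show ?thesis using 3 by (simp add: has_field_derivative_iff flat_def)
  qed
qed

lemma diff_order_flat:
  fixes f :: "real^'m::finite \<Rightarrow> real"
  assumes S: "open S"
  shows "diff_order k S f \<Longrightarrow> diff_order k S (\<lambda>x. flat n (f x))"
proof (induction k arbitrary: n)
  case 0
  then show ?case using flat_has_derivative has_derivative_compose[where f = f]
    by (auto simp: differentiable_def has_field_derivative_def) blast
next
  case (Suc k)
  have *: "((\<lambda>x. flat n (f x)) has_derivative (\<lambda>v. (flat (n + 2) (f x) - real n * flat (n + 1) (f x)) * frechet_derivative f (at x) v)) (at x)" if "x \<in> S" for x
    using has_derivative_compose[OF diff_order_has_derivative[OF Suc.prems that]] flat_has_derivative
    unfolding has_field_derivative_def by blast
  show ?case
  proof (rule diff_order_SucI[OF S, where g = "\<lambda>i x. (flat (n + 2) (f x) + (- real n) * flat (n + 1) (f x)) * pder i f x"])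
    show "(\<lambda>x. flat n (f x)) differentiable (at x)" if "x \<in> S" for x
      using *[OF that] differentiable_def by blast
    show "pder i (\<lambda>x. flat n (f x)) x = (flat (n + 2) (f x) + (- real n) * flat (n + 1) (f x)) * pder i f x" if "x \<in> S" for x i
      using pder_eqI[OF *[OF that]] by (simp add: pder_def)
    have "diff_order k S f" using Suc.prems diff_order_mono by (meson le_SucI order_refl)+
    then show "diff_order k S (\<lambda>x. (flat (n + 2) (f x) + (- real n) * flat (n + 1) (f x)) * pder i f x)" for i
      using Suc by (intro diff_order_mult diff_order_add diff_order_const S) auto
  qed
qed

lemma smooth_on_flat:
  fixes f :: "real^'m::finite \<Rightarrow> real"
  assumes "open S" "smooth_on S f"
  shows "smooth_on S (\<lambda>x. flat n (f x))"
  using assms(2) diff_order_flat[OF assms(1)] unfolding smooth_on_iff by blast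

subsection \<open>Smooth functions and tangent vectors on a manifold\<close>

definition chart_vec :: "('a, 'm::finite) atlas \<Rightarrow> 'a set \<Rightarrow> ('a \<Rightarrow> real^'m) \<Rightarrow> 'a \<Rightarrow> real^'m \<Rightarrow> 'a cvec" where
  "chart_vec A U \<phi> p a = (\<lambda>f. if mfd_smooth A f
     then \<Sum>k\<in>UNIV. (a $ k) *\<^sub>R pder k (f \<circ> inv_into U \<phi>) (\<phi> p) else 0)"

locale smooth_mfd =
  fixes A :: "('a::{t2_space,second_countable_topology}, 'm::finite) atlas"
  assumes atlas: "smooth_atlas A"
begin

lemma chart_cover: obtains U \<phi> where "(U, \<phi>) \<in> A" "p \<in> U"
proof -
  have "p \<in> (\<Union>(U, \<phi>)\<in>A. U)" using atlas unfolding smooth_atlas_def by simp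
  then show thesis using that by auto
qed

lemma chart_homeo:
  assumes "(U, \<phi>) \<in> A"
  shows "open U" "open (\<phi> ` U)" "homeomorphism U (\<phi> ` U) \<phi> (inv_into U \<phi>)"
  using atlas assms unfolding smooth_atlas_def by auto

lemma chart_inv:
  assumes "(U, \<phi>) \<in> A"
  shows "continuous_on U \<phi>" "continuous_on (\<phi> ` U) (inv_into U \<phi>)"
    "\<And>q. q \<in> U \<Longrightarrow> inv_into U \<phi> (\<phi> q) = q" "\<And>y. y \<in> \<phi> ` U \<Longrightarrow> \<phi> (inv_into U \<phi> y) = y"
    "\<And>y. y \<in> \<phi> ` U \<Longrightarrow> inv_into U \<phi> y \<in> U"
  using chart_homeo(3)[OF assms] unfolding homeomorphism_def by auto

lemma chart_image_open:
  assumes "(U, \<phi>) \<in> A" "open W"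
  shows "open (\<phi> ` (U \<inter> W))"
proof -
  have "\<phi> ` (U \<inter> W) = inv_into U \<phi> -` W \<inter> \<phi> ` U"
    using chart_inv[OF assms(1)] by force
  then show ?thesis using chart_inv(2)[OF assms(1)] chart_homeo(2)[OF assms(1)] assms(2)
    by (simp add: continuous_on_open_vimage)
qed

lemma msm_chart: "mfd_smooth_on A W f \<Longrightarrow> (U, \<phi>) \<in> A \<Longrightarrow> smooth_on (\<phi> ` (U \<inter> W)) (f \<circ> inv_into U \<phi>)"
  unfolding mfd_smooth_on_def by auto

lemma msmI: "(\<And>U \<phi>. (U, \<phi>) \<in> A \<Longrightarrow> smooth_on (\<phi> ` (U \<inter> W)) (\<lambda>y. f (inv_into U \<phi> y))) \<Longrightarrow> mfd_smooth_on A W f"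
  unfolding mfd_smooth_on_def by (auto simp: o_def)

lemma msmD: "mfd_smooth_on A W f \<Longrightarrow> (U, \<phi>) \<in> A \<Longrightarrow> smooth_on (\<phi> ` (U \<inter> W)) (\<lambda>y. f (inv_into U \<phi> y))"
  using msm_chart by (simp add: o_def)

lemma sm_chart: "mfd_smooth A f \<Longrightarrow> (U, \<phi>) \<in> A \<Longrightarrow> smooth_on (\<phi> ` U) (f \<circ> inv_into U \<phi>)"
  using msm_chart[of UNIV] by simp

lemma msm_subset: "mfd_smooth_on A W f \<Longrightarrow> V \<subseteq> W \<Longrightarrow> mfd_smooth_on A V f"
  unfolding mfd_smooth_on_def by (auto elim!: ballE smooth_on_subset)

lemma msm_Un: "mfd_smooth_on A W f \<Longrightarrow> mfd_smooth_on A V f \<Longrightarrow> mfd_smooth_on A (W \<union> V) f"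
  unfolding mfd_smooth_on_def by (auto simp: Int_Un_distrib image_Un intro!: smooth_on_Un)

lemma msm_cong:
  assumes "open W" "\<And>q. q \<in> W \<Longrightarrow> f q = g q"
  shows "mfd_smooth_on A W f \<longleftrightarrow> mfd_smooth_on A W g"
proof -
  have "smooth_on (\<phi> ` (U \<inter> W)) (f \<circ> inv_into U \<phi>) \<longleftrightarrow> smooth_on (\<phi> ` (U \<inter> W)) (g \<circ> inv_into U \<phi>)"
    if "(U, \<phi>) \<in> A" for U \<phi>
    using chart_inv(3)[OF that] assms(2)
    by (intro smooth_on_cong chart_image_open[OF that assms(1)]) auto
  then show ?thesis unfolding mfd_smooth_on_def by blast
qed

context
  fixes W :: "'a set" assumes W: "open W"
begin

lemma msm_const: "mfd_smooth_on A W (\<lambda>x. c)"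
  unfolding mfd_smooth_on_def by (auto simp: o_def smooth_on_const)

lemma msm_add: "mfd_smooth_on A W f \<Longrightarrow> mfd_smooth_on A W g \<Longrightarrow> mfd_smooth_on A W (\<lambda>x. f x + g x)"
  by (rule msmI, rule smooth_on_add[OF chart_image_open[OF _ W]]) (auto dest: msmD)

lemma msm_mult:
  fixes f g :: "'a \<Rightarrow> 'b::real_normed_algebra"
  shows "mfd_smooth_on A W f \<Longrightarrow> mfd_smooth_on A W g \<Longrightarrow> mfd_smooth_on A W (\<lambda>x. f x * g x)"
  by (rule msmI, rule smooth_on_mult[OF chart_image_open[OF _ W]]) (auto dest: msmD)

lemma msm_linear: "bounded_linear h \<Longrightarrow> mfd_smooth_on A W f \<Longrightarrow> mfd_smooth_on A W (\<lambda>x. h (f x))"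
  by (rule msmI, rule smooth_on_linear[OF chart_image_open[OF _ W]]) (auto dest: msmD)

lemma msm_inverse:
  fixes f :: "'a \<Rightarrow> 'b::real_normed_field"
  assumes "mfd_smooth_on A W f" "\<And>x. x \<in> W \<Longrightarrow> f x \<noteq> 0"
  shows "mfd_smooth_on A W (\<lambda>x. inverse (f x))"
  by (rule msmI, rule smooth_on_inverse[OF chart_image_open[OF _ W]]) (use assms chart_inv(3) in \<open>auto dest: msmD\<close>)

lemma msm_flat: "mfd_smooth_on A W f \<Longrightarrow> mfd_smooth_on A W (\<lambda>x. flat n (f x))"
  by (rule msmI, rule smooth_on_flat[OF chart_image_open[OF _ W]]) (auto dest: msmD)

lemma msm_exp: "mfd_smooth_on A W f \<Longrightarrow> mfd_smooth_on A W (\<lambda>x. exp (f x :: real))"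
  by (rule msmI, rule smooth_on_compose[OF chart_image_open[OF _ W], where h = "\<lambda>_. exp"]) (auto dest: msmD)

lemma msm_uminus: "mfd_smooth_on A W f \<Longrightarrow> mfd_smooth_on A W (\<lambda>x. - f x)"
  using msm_linear[of uminus f] by (simp add: bounded_linear_minus bounded_linear_ident)

lemma msm_diff: "mfd_smooth_on A W f \<Longrightarrow> mfd_smooth_on A W g \<Longrightarrow> mfd_smooth_on A W (\<lambda>x. f x - g x)"
  using msm_add[OF _ msm_uminus, of f g] by simp

lemma msm_sum: "(\<And>i. i \<in> I \<Longrightarrow> mfd_smooth_on A W (f i)) \<Longrightarrow> mfd_smooth_on A W (\<lambda>x. \<Sum>i\<in>I. f i x)"
  by (induction I rule: infinite_finite_induct) (auto intro: msm_const msm_add)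

lemma msm_cnj: "mfd_smooth_on A W f \<Longrightarrow> mfd_smooth_on A W (\<lambda>x. cnj (f x))"
  by (rule msm_linear[OF bounded_linear_cnj])
lemma msm_of_real: "mfd_smooth_on A W f \<Longrightarrow> mfd_smooth_on A W (\<lambda>x. complex_of_real (f x))"
  by (rule msm_linear[OF bounded_linear_of_real])
lemma msm_Re: "mfd_smooth_on A W f \<Longrightarrow> mfd_smooth_on A W (\<lambda>x. Re (f x))"
  by (rule msm_linear[OF bounded_linear_Re])

end

lemmas sm_intros = open_UNIV msm_const msm_add msm_mult msm_inverse msm_flat msm_exp msm_uminus msm_diff
  msm_sum msm_cnj msm_of_real msm_Re

lemma sm_cnj_iff: "mfd_smooth A (\<lambda>x. cnj (f x)) \<longleftrightarrow> mfd_smooth A f"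
  using msm_cnj[OF open_UNIV, of f] msm_cnj[OF open_UNIV, of "\<lambda>x. cnj (f x)"] by auto

lemma sm_continuous:
  assumes "mfd_smooth A f" shows "continuous_on UNIV f"
proof -
  have "continuous (at p) f" for p
  proof -
    obtain U \<phi> where U: "(U, \<phi>) \<in> A" "p \<in> U" by (rule chart_cover)
    have "continuous_on U ((f \<circ> inv_into U \<phi>) \<circ> \<phi>)"
      by (rule continuous_on_compose[OF chart_inv(1)[OF U(1)] smooth_on_continuous_on[OF sm_chart[OF assms U(1)]]])
    then have "continuous_on U f"
      using chart_inv(3)[OF U(1)] by (subst (asm) continuous_on_cong[OF refl, of _ _ f]) auto
    then show ?thesis using chart_homeo(1)[OF U(1)] U(2) by (simp add: continuous_on_eq_continuous_at)
  qed
  then show ?thesis by (simp add: continuous_on_eq_continuous_within)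
qed

lemma msm_coordinate:
  assumes "(U, \<phi>) \<in> A" shows "mfd_smooth_on A U (\<lambda>q. \<phi> q $ k)"
  unfolding mfd_smooth_on_def
proof clarify
  fix V \<psi> assume V: "(V, \<psi>) \<in> A"
  have "smooth_on (\<psi> ` (V \<inter> U)) (\<phi> \<circ> inv_into V \<psi>)"
    using atlas assms V unfolding smooth_atlas_def by blast
  from smooth_on_linear[OF chart_image_open[OF V chart_homeo(1)[OF assms]] _ this, of "\<lambda>x. x $ k"]
  show "smooth_on (\<psi> ` (V \<inter> U)) ((\<lambda>q. \<phi> q $ k) \<circ> inv_into V \<psi>)"
    by (simp add: bounded_linear_vec_nth o_def)
qed

text \<open>The open sets \<open>W\<close> and the complement of \<open>C\<close> cover the
  manifold; the product is smooth on the first and zero on the second.\<close>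

lemma sm_extend:
  fixes f :: "'a \<Rightarrow> 'b::real_normed_algebra"
  assumes "mfd_smooth A \<eta>" "open W" "mfd_smooth_on A W f" "closed C" "C \<subseteq> W" "\<And>q. q \<notin> C \<Longrightarrow> \<eta> q = 0"
  shows "mfd_smooth A (\<lambda>q. \<eta> q * f q)"
proof -
  have "mfd_smooth_on A W (\<lambda>q. \<eta> q * f q)"
    using assms(1,2,3) by (intro msm_mult) (auto intro: msm_subset)
  moreover have "mfd_smooth_on A (- C) (\<lambda>q. \<eta> q * f q)"
    using assms(6) msm_const[of "-C" 0] \<open>closed C\<close> by (subst msm_cong[where g = "\<lambda>_. 0"]) auto
  ultimately have "mfd_smooth_on A (W \<union> - C) (\<lambda>q. \<eta> q * f q)" by (rule msm_Un)
  moreover have "W \<union> - C = UNIV" using assms(5) by blast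
  ultimately show ?thesis by simp
qed

lemma bump:
  assumes U: "(U, \<phi>) \<in> A" and p: "p \<in> U" and W: "open W" "p \<in> W"
  obtains \<eta> :: "'a \<Rightarrow> real" and C where "mfd_smooth A \<eta>" "closed C" "C \<subseteq> U \<inter> W" "\<And>q. q \<notin> C \<Longrightarrow> \<eta> q = 0" "\<eta> p > 0"
proof -
  have "\<phi> p \<in> \<phi> ` (U \<inter> W)" using p W by blast
  then obtain r where r: "r > 0" "cball (\<phi> p) r \<subseteq> \<phi> ` (U \<inter> W)"
    using chart_image_open[OF U W(1)] open_contains_cball by metis
  define C where "C = inv_into U \<phi> ` cball (\<phi> p) r"
  have "compact C" unfolding C_def
    using r(2) by (intro compact_continuous_image continuous_on_subset[OF chart_inv(2)[OF U]]) auto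
  \<comment> \<open>Closed in the whole manifold, not only in the chart: the Hausdorff property
    enters here.\<close>
  then have clC: "closed C" by (rule compact_imp_closed)
  have CU: "C \<subseteq> U \<inter> W" unfolding C_def using r(2) chart_inv(3)[OF U] by force
  \<comment> \<open>The squared distance is spelled out in coordinates so that its smoothness
    follows from \<open>msm_coordinate\<close>.\<close>
  define d where "d q = r\<^sup>2 - (\<Sum>k\<in>UNIV. (\<phi> q $ k - \<phi> p $ k) * (\<phi> q $ k - \<phi> p $ k))" for q
  have d: "d q = r\<^sup>2 - (dist (\<phi> q) (\<phi> p))\<^sup>2" for q
    unfolding d_def by (simp add: dist_norm norm_vec_def L2_set_def sum_nonneg power2_eq_square)
  define \<eta> where "\<eta> q = (if q \<in> U then flat 0 (d q) else 0)" for q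
  have z: "\<eta> q = 0" if "q \<notin> C" for q
  proof (cases "q \<in> U")
    case True
    then have "\<phi> q \<notin> cball (\<phi> p) r" using that chart_inv(3)[OF U True] unfolding C_def by force
    then have "d q \<le> 0" unfolding d using r(1) by (auto simp: dist_commute intro!: power_mono)
    then show ?thesis by (simp add: \<eta>_def flat_def)
  qed (simp add: \<eta>_def)
  have U': "open U" by (rule chart_homeo(1)[OF U])
  have "mfd_smooth_on A U (\<lambda>q. flat 0 (d q))"
    unfolding d_def by (intro sm_intros U' msm_coordinate U)
  then have "mfd_smooth_on A U \<eta>"
    by (subst msm_cong[OF U', where g = "\<lambda>q. flat 0 (d q)"]) (auto simp: \<eta>_def)
  moreover have "mfd_smooth_on A (-C) \<eta>"
    using z msm_const[of "-C" 0] clC by (subst msm_cong[where g = "\<lambda>_. 0"]) auto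
  ultimately have "mfd_smooth_on A (U \<union> - C) \<eta>" by (rule msm_Un)
  moreover have "U \<union> - C = UNIV" using CU by blast
  ultimately have "mfd_smooth A \<eta>" by simp
  moreover have "\<eta> p > 0" using p r(1) by (simp add: \<eta>_def d flat_def)
  ultimately show ?thesis using that[of \<eta> C] clC CU z by blast
qed

section \<open>Complex tangent vectors as derivations\<close>

lemma ctangentD:
  assumes "v \<in> ctangent A p"
  shows "mfd_smooth A f \<Longrightarrow> mfd_smooth A g \<Longrightarrow> v (\<lambda>x. f x + g x) = v f + v g"
    "mfd_smooth A f \<Longrightarrow> mfd_smooth A g \<Longrightarrow> v (\<lambda>x. f x * g x) = v f * g p + f p * v g"
    "mfd_smooth A f \<Longrightarrow> v (\<lambda>x. c * f x) = c * v f"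
    "\<not> mfd_smooth A f \<Longrightarrow> v f = 0"
  using assms unfolding ctangent_def by auto

text \<open>Leibniz on 1 * 1 gives v 1 = 2 (v 1); homogeneity then treats any constant.\<close>

lemma ctangent_const: assumes "v \<in> ctangent A p" shows "v (\<lambda>x. c) = 0"
proof -
  have "mfd_smooth A (\<lambda>x::'a. 1 :: complex)" by (intro sm_intros)
  from ctangentD(2)[OF assms this this] ctangentD(3)[OF assms this, of c]
  show ?thesis by simp
qed

lemma ctangent_sum:
  assumes "v \<in> ctangent A p"
  shows "(\<And>i. i \<in> I \<Longrightarrow> mfd_smooth A (f i)) \<Longrightarrow> v (\<lambda>x. \<Sum>i\<in>I. f i x) = (\<Sum>i\<in>I. v (f i))"
proof (induction I rule: infinite_finite_induct)
  case (insert i I)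
  have "v (\<lambda>x. f i x + (\<Sum>i\<in>I. f i x)) = v (f i) + v (\<lambda>x. \<Sum>i\<in>I. f i x)"
    using insert.prems by (intro ctangentD(1)[OF assms] sm_intros) auto
  then show ?case using insert by simp
qed (auto simp: ctangent_const[OF assms])

lemma vadd_ctangent:
  assumes "v \<in> ctangent A p" "w \<in> ctangent A p" shows "vadd v w \<in> ctangent A p"
  using ctangentD[OF assms(1)] ctangentD[OF assms(2)] unfolding ctangent_def vadd_def
  by (auto simp: algebra_simps)

lemma vscale_ctangent:
  assumes "v \<in> ctangent A p" shows "vscale c v \<in> ctangent A p"
  using ctangentD[OF assms(1)] unfolding ctangent_def vscale_def
  by (auto simp: algebra_simps)

lemma vconj_vconj: "vconj (vconj v) = v"
  by (simp add: vconj_def)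

lemma vconj_ctangent:
  assumes "v \<in> ctangent A p" shows "vconj v \<in> ctangent A p"
proof -
  have "cnj (v (\<lambda>x. cnj (f x) + cnj (g x))) = cnj (v (\<lambda>x. cnj (f x))) + cnj (v (\<lambda>x. cnj (g x)))"
    "cnj (v (\<lambda>x. cnj (f x) * cnj (g x))) = cnj (v (\<lambda>x. cnj (f x))) * g p + f p * cnj (v (\<lambda>x. cnj (g x)))"
    if "mfd_smooth A f" "mfd_smooth A g" for f g
    using that by (subst ctangentD[OF assms]; simp add: sm_cnj_iff)+
  moreover have "cnj (v (\<lambda>x. cnj c * cnj (f x))) = c * cnj (v (\<lambda>x. cnj (f x)))" if "mfd_smooth A f" for c f
    using that by (subst ctangentD[OF assms]; simp add: sm_cnj_iff)
  moreover have "v (\<lambda>x. cnj (f x)) = 0" if "\<not> mfd_smooth A f" for f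
    using that by (subst ctangentD[OF assms]; simp add: sm_cnj_iff)
  ultimately show ?thesis unfolding ctangent_def vconj_def by simp
qed

lemma pder_mult_chart:
  fixes f g :: "'a \<Rightarrow> complex"
  assumes "mfd_smooth A f" "mfd_smooth A g" and U: "(U, \<phi>) \<in> A" "p \<in> U"
  shows "pder k ((\<lambda>x. f x * g x) \<circ> inv_into U \<phi>) (\<phi> p) =
    pder k (f \<circ> inv_into U \<phi>) (\<phi> p) * g p + f p * pder k (g \<circ> inv_into U \<phi>) (\<phi> p)"
proof -
  have *: "\<phi> p \<in> \<phi> ` U" using U by blast
  show ?thesis
    using pder_eqI[OF has_derivative_mult[OF smooth_on_has_derivative[OF sm_chart[OF assms(1) U(1)] *]
      smooth_on_has_derivative[OF sm_chart[OF assms(2) U(1)] *]], of k] chart_inv(3)[OF U]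
    by (simp add: o_def axis_def if_distrib[of "\<lambda>c. c *\<^sub>R _"] sum.delta' cong: if_cong)
qed

lemma chart_vec_ctangent:
  assumes U: "(U, \<phi>) \<in> A" "p \<in> U"
  shows "chart_vec A U \<phi> p a \<in> ctangent A p"
proof -
  have *: "\<phi> p \<in> \<phi> ` U" using U by blast
  have 1: "pder k ((\<lambda>x. f x + g x) \<circ> inv_into U \<phi>) (\<phi> p) = pder k (f \<circ> inv_into U \<phi>) (\<phi> p) + pder k (g \<circ> inv_into U \<phi>) (\<phi> p)"
    if "mfd_smooth A f" "mfd_smooth A g" for f g :: "'a \<Rightarrow> complex" and k
    using pder_add[OF sm_chart[OF that(1) U(1)] sm_chart[OF that(2) U(1)] *] by (simp add: o_def)
  have 2: "pder k ((\<lambda>x. c * f x) \<circ> inv_into U \<phi>) (\<phi> p) = c * pder k (f \<circ> inv_into U \<phi>) (\<phi> p)"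
    if "mfd_smooth A f" for f :: "'a \<Rightarrow> complex" and c k
    using pder_linear[OF sm_chart[OF that(1) U(1)] * bounded_linear_mult_right] by (simp add: o_def)
  show ?thesis unfolding ctangent_def chart_vec_def
    using pder_mult_chart[OF _ _ U]
    by (auto simp: 1 2 sm_intros scaleR_right_distrib sum.distrib sum_distrib_left sum_distrib_right algebra_simps)
qed

lemma chart_vec_rtangent:
  assumes U: "(U, \<phi>) \<in> A" "p \<in> U"
  shows "chart_vec A U \<phi> p a \<in> rtangent A p"
proof -
  have *: "\<phi> p \<in> \<phi> ` U" using U by blast
  have "pder k ((\<lambda>x. cnj (f x)) \<circ> inv_into U \<phi>) (\<phi> p) = cnj (pder k (f \<circ> inv_into U \<phi>) (\<phi> p))"
    if "mfd_smooth A f" for f k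
    using pder_linear[OF sm_chart[OF that(1) U(1)] * bounded_linear_cnj] by (simp add: o_def)
  then have "vconj (chart_vec A U \<phi> p a) = chart_vec A U \<phi> p a"
    by (auto simp: vconj_def chart_vec_def sm_cnj_iff fun_eq_iff)
  then show ?thesis using chart_vec_ctangent[OF U] by (simp add: rtangent_def)
qed

text \<open>The familiar description of derivations at a point by coordinate vectors. It is a
  predicate, to be discharged by counting: the splitting in \<open>transversal\<close> bounds the
  dimension of \<open>ctangent\<close>.\<close>

definition spanned :: bool where
  "spanned \<longleftrightarrow> (\<forall>(U, \<phi>)\<in>A. \<forall>p\<in>U. \<forall>v\<in>ctangent A p. \<exists>a b. v = vadd (chart_vec A U \<phi> p a) (vscale \<i> (chart_vec A U \<phi> p b)))"

text \<open>A dimension count replaces Hadamard's lemma: the coordinate derivations are independent, as is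
  seen on cut-off coordinate functions.\<close>
lemma coordinate_functions:
  assumes U: "(U, \<phi>) \<in> A" "p \<in> U"
  obtains X :: "'m \<Rightarrow> 'a \<Rightarrow> complex" and c :: real where "c > 0" "\<And>k. mfd_smooth A (X k)" "\<And>k q. cnj (X k q) = X k q"
    "\<And>a k. chart_vec A U \<phi> p a (X k) = of_real (c * a $ k)"
proof -
  obtain \<eta> :: "'a \<Rightarrow> real" and C where \<eta>: "mfd_smooth A \<eta>" "closed C" "C \<subseteq> U \<inter> UNIV" "\<And>q. q \<notin> C \<Longrightarrow> \<eta> q = 0" "\<eta> p > 0"
    using bump[OF U open_UNIV UNIV_I] by metis
  define x where "x k q = \<phi> q $ k - \<phi> p $ k" for k q
  define X where "X k q = complex_of_real (\<eta> q * x k q)" for k q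
  have U': "open U" by (rule chart_homeo(1)[OF U(1)])
  have x: "mfd_smooth_on A U (x k)" for k
    unfolding x_def by (intro sm_intros U' msm_coordinate U)
  have X: "mfd_smooth A (X k)" for k
    unfolding X_def using \<eta>(3) by (intro sm_intros sm_extend[OF \<eta>(1) U' x \<eta>(2) _ \<eta>(4)]) auto
  have *: "\<phi> p \<in> \<phi> ` U" using U by blast
  have pd: "pder j (X k \<circ> inv_into U \<phi>) (\<phi> p) = of_real (\<eta> p) * (if j = k then 1 else 0)" for j k
  proof -
    have "pder j (X k \<circ> inv_into U \<phi>) (\<phi> p) = pder j (\<lambda>y. complex_of_real ((\<eta> \<circ> inv_into U \<phi>) y * (y $ k - \<phi> p $ k))) (\<phi> p)"
      using chart_inv(4)[OF U(1)] by (intro pder_cong[OF chart_homeo(2)[OF U(1)] _ *]) (auto simp: X_def x_def)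
    also have "\<dots> = of_real (\<eta> p * axis j 1 $ k)"
    proof (rule pder_eqI[THEN trans])
      have "((\<lambda>y::real^'m. y $ k - \<phi> p $ k) has_derivative (\<lambda>v. v $ k - 0)) (at (\<phi> p))"
        by (intro derivative_intros bounded_linear_imp_has_derivative bounded_linear_vec_nth)
      from bounded_linear.has_derivative[OF bounded_linear_of_real has_derivative_mult[OF smooth_on_has_derivative[OF sm_chart[OF \<eta>(1) U(1)] *] this]]
      show "((\<lambda>y. complex_of_real ((\<eta> \<circ> inv_into U \<phi>) y * (y $ k - \<phi> p $ k))) has_derivative
         (\<lambda>v. complex_of_real (\<eta> p * v $ k))) (at (\<phi> p))"
        using chart_inv(3)[OF U] by simp
    qed simp
    finally show ?thesis by (auto simp: axis_def)
  qed
  have "chart_vec A U \<phi> p a (X k) = of_real (\<eta> p * a $ k)" for a k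
    unfolding chart_vec_def using X
    by (simp add: pd if_distrib[of "\<lambda>c. _ * c"] if_distrib[of "\<lambda>c. _ *\<^sub>R c"] sum.delta' scaleR_conv_of_real mult.commute cong: if_cong)
  then show ?thesis using that[of "\<eta> p" X] \<eta>(5) X by (auto simp: X_def)
qed

text \<open>There are as many vectors \<open>B k\<close> as coordinates. Evaluation on the cut-off
  coordinate functions gives a linear map between spaces of equal dimension, onto because the
  coordinate derivations already reach every value. Hence it is one-to-one, and a tangent vector
  equals the coordinate combination with the same values.\<close>

lemma spannedI:
  assumes "\<And>p. \<exists>B :: 'm \<Rightarrow> 'a cvec. ctangent A p = range (\<lambda>(c::complex^'m) f. \<Sum>k\<in>UNIV. c $ k * B k f)"
  shows "spanned"
  unfolding spanned_def
proof clarify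
  fix U \<phi> p v assume U: "(U, \<phi>) \<in> A" "p \<in> U" and v: "v \<in> ctangent A p"
  obtain B :: "'m \<Rightarrow> 'a cvec" where B: "ctangent A p = range (\<lambda>(c::complex^'m) f. \<Sum>k\<in>UNIV. c $ k * B k f)"
    using assms by blast
  obtain X :: "'m \<Rightarrow> 'a \<Rightarrow> complex" and e :: real where X: "e > 0" "\<And>k. mfd_smooth A (X k)"
    "\<And>a k. chart_vec A U \<phi> p a (X k) = of_real (e * a $ k)"
    using coordinate_functions[OF U] by metis
  define \<Phi> :: "complex^'m \<Rightarrow> complex^'m" where "\<Phi> c = (\<chi> j. \<Sum>k\<in>UNIV. c $ k * B k (X j))" for c
  define V where "V w = vadd (chart_vec A U \<phi> p (\<chi> k. Re (w $ k) / e)) (vscale \<i> (chart_vec A U \<phi> p (\<chi> k. Im (w $ k) / e)))" for w :: "complex^'m"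
  have VX: "V w (X j) = w $ j" for w j
    using X(1) by (simp add: V_def vadd_def vscale_def X(3) complex_eq_iff)
  have V: "\<exists>c. V w = (\<lambda>f. \<Sum>k\<in>UNIV. c $ k * B k f) \<and> \<Phi> c = w" for w
  proof -
    have "V w \<in> ctangent A p" unfolding V_def by (intro vadd_ctangent vscale_ctangent chart_vec_ctangent U)
    then obtain c where c: "V w = (\<lambda>f. \<Sum>k\<in>UNIV. c $ k * B k f)" using B by auto
    then have "\<Phi> c = w" using VX[of w] by (simp add: \<Phi>_def vec_eq_iff)
    with c show ?thesis by blast
  qed
  have "linear \<Phi>"
    by (rule linearI) (auto simp: \<Phi>_def vec_eq_iff sum.distrib algebra_simps scaleR_sum_right)
  moreover have "surj \<Phi>" using V unfolding surj_def by metis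
  ultimately have inj: "inj \<Phi>" using linear_surjective_imp_injective[of \<Phi>] by blast
  obtain c where c: "v = (\<lambda>f. \<Sum>k\<in>UNIV. c $ k * B k f)" using v B by auto
  obtain c' where c': "V (\<Phi> c) = (\<lambda>f. \<Sum>k\<in>UNIV. c' $ k * B k f)" "\<Phi> c' = \<Phi> c" using V by blast
  then have "v = V (\<Phi> c)" using c inj by (simp add: inj_eq)
  then show "\<exists>a b. v = vadd (chart_vec A U \<phi> p a) (vscale \<i> (chart_vec A U \<phi> p b))"
    unfolding V_def by blast
qed

end

subsection \<open>Transversal CR vector fields and the deformed structures\<close>

abbreviation cf :: "('a \<Rightarrow> real) \<Rightarrow> 'a \<Rightarrow> complex" where
  "cf f \<equiv> (\<lambda>x. complex_of_real (f x))"

definition ldef :: "('a \<Rightarrow> 'a cvec) \<Rightarrow> ('a \<Rightarrow> real) \<Rightarrow> 'a \<Rightarrow> 'a cvec \<Rightarrow> 'a cvec" where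
  "ldef T f p v = vadd v (vscale (- \<i> * v (cf f)) (T p))"

lemma deform_eq: "deform L T f p = ldef T f p ` L p"
  unfolding deform_def ldef_def by blast

definition conj_bracket :: "('a \<Rightarrow> 'a cvec) \<Rightarrow> 'a \<Rightarrow> 'a cvec" where
  "conj_bracket Z p = lie_bracket Z (\<lambda>q. vconj (Z q)) p"

lemmas vdefs = vadd_def vscale_def vzero_def

text \<open>The assumptions are chosen to be inherited by every deformation
  (\<open>deform_cr\<close>), so that the theory can be restarted from another base structure.
  \<open>sec\<close> provides sections on which the Levi form can be tested.\<close>

locale cr_mfd = smooth_mfd A
  for A :: "('a::{t2_space,second_countable_topology}, 'm::finite) atlas" +
  fixes L :: "'a \<Rightarrow> 'a cvec set" and T :: "'a \<Rightarrow> 'a cvec"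
  assumes conn: "connected (UNIV :: 'a set)" and comp: "compact (UNIV :: 'a set)"
    and span: "spanned"
    and L_sub: "v \<in> L p \<Longrightarrow> v \<in> ctangent A p"
    and L_add: "v \<in> L p \<Longrightarrow> w \<in> L p \<Longrightarrow> vadd v w \<in> L p"
    and L_scale: "v \<in> L p \<Longrightarrow> vscale c v \<in> L p"
    and T_sec: "smooth_section A UNIV (rtangent A) T"
    and trans: "transversal A L T"
    and cr: "cr_vector_field A L T"
    and sec: "\<exists>Z. smooth_section A UNIV L Z \<and> Z p \<noteq> vzero"
begin

lemma T_tan: "T p \<in> ctangent A p" and T_real: "vconj (T p) = T p"
  using T_sec unfolding smooth_section_def rtangent_def by auto

lemma T_cnj: "cnj (T p (\<lambda>x. cnj (g x))) = T p g"
  using T_real[of p] unfolding vconj_def fun_eq_iff by blast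

lemma T_sec': "smooth_section A UNIV (ctangent A) T"
  using T_sec unfolding smooth_section_def rtangent_def by auto

lemma L_sec: "smooth_section A UNIV L Z \<Longrightarrow> smooth_section A UNIV (ctangent A) Z"
  using L_sub unfolding smooth_section_def by auto

lemma secD:
  assumes "smooth_section A UNIV E Z"
  shows "Z p \<in> E p" "mfd_smooth A f \<Longrightarrow> mfd_smooth A (\<lambda>q. Z q f)"
  using assms unfolding smooth_section_def by auto

lemma sec_conj:
  assumes "smooth_section A UNIV (ctangent A) Z"
  shows "smooth_section A UNIV (ctangent A) (\<lambda>q. vconj (Z q))"
  unfolding smooth_section_def
proof (intro conjI ballI allI impI)
  show "vconj (Z p) \<in> ctangent A p" for p using secD(1)[OF assms] vconj_ctangent by blast
  fix f :: "'a \<Rightarrow> complex" assume "mfd_smooth A f"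
  then have "mfd_smooth A (\<lambda>x. cnj (f x))" by (intro sm_intros)
  from secD(2)[OF assms this] show "mfd_smooth A (\<lambda>q. vconj (Z q) f)"
    unfolding vconj_def by (intro sm_intros)
qed

lemma ctangent_eqI:
  assumes "v \<in> ctangent A p" "w \<in> ctangent A p" "\<And>g. mfd_smooth A g \<Longrightarrow> v g = w g"
  shows "v = w"
proof
  fix g show "v g = w g" using assms(3) ctangentD(4)[OF assms(1)] ctangentD(4)[OF assms(2)] by (cases "mfd_smooth A g") auto
qed

lemma lie_ctangent:
  assumes Z: "smooth_section A UNIV (ctangent A) Z" and W: "smooth_section A UNIV (ctangent A) W"
  shows "lie_bracket Z W p \<in> ctangent A p"
proof -
  note z = secD(1)[OF Z] and w = secD(1)[OF W] and zs = secD(2)[OF Z] and ws = secD(2)[OF W]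
  have 1: "lie_bracket Z W p (\<lambda>x. f x + g x) = lie_bracket Z W p f + lie_bracket Z W p g"
    if fg: "mfd_smooth A f" "mfd_smooth A g" for f g
    using fg by (simp add: lie_bracket_def ctangentD(1)[OF z] ctangentD(1)[OF w] zs ws)
  have 2: "lie_bracket Z W p (\<lambda>x. f x * g x) = lie_bracket Z W p f * g p + f p * lie_bracket Z W p g"
    if fg: "mfd_smooth A f" "mfd_smooth A g" for f g
  proof -
    have s: "mfd_smooth A (\<lambda>q. W q f * g q)" "mfd_smooth A (\<lambda>q. f q * W q g)"
      "mfd_smooth A (\<lambda>q. Z q f * g q)" "mfd_smooth A (\<lambda>q. f q * Z q g)"
      using fg zs ws by (auto intro!: sm_intros)
    show ?thesis
      using fg by (simp add: lie_bracket_def ctangentD(2)[OF w] ctangentD(2)[OF z] ctangentD(1)[OF w] ctangentD(1)[OF z] s zs ws)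
        (simp add: algebra_simps)
  qed
  have 3: "lie_bracket Z W p (\<lambda>x. c * f x) = c * lie_bracket Z W p f" if "mfd_smooth A f" for c f
    using that by (simp add: lie_bracket_def ctangentD(3)[OF w] ctangentD(3)[OF z] zs ws algebra_simps)
  have 4: "lie_bracket Z W p f = 0" if "\<not> mfd_smooth A f" for f
    using that ctangentD(4)[OF z that] ctangentD(4)[OF w that]
    by (simp add: lie_bracket_def ctangent_const[OF z] ctangent_const[OF w])
  show ?thesis unfolding ctangent_def using 1 2 3 4 by blast
qed

lemma vconj_add: "vconj (vadd v w) = vadd (vconj v) (vconj w)"
  and vconj_scale: "vconj (vscale c v) = vscale (cnj c) (vconj v)"
  by (auto simp: vconj_def vdefs)

lemma vconj_cf: "vconj v (cf f) = cnj (v (cf f))"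
  by (simp add: vconj_def)

lemma L_zero: "vzero \<in> L p"
proof -
  obtain Z where "smooth_section A UNIV L Z" using sec by blast
  then have "vscale 0 (Z p) \<in> L p" by (intro L_scale secD)
  then show ?thesis by (simp add: vdefs)
qed

subsubsection \<open>Decomposition of tangent vectors\<close>

text \<open>The second component enters through its conjugate, so that both components lie in
  \<open>L p\<close> and conjugation merely swaps them.\<close>

definition tcomb :: "'a \<Rightarrow> 'a cvec \<Rightarrow> 'a cvec \<Rightarrow> complex \<Rightarrow> 'a cvec" where
  "tcomb p l m c = vadd (vadd l (vconj m)) (vscale c (T p))"

lemma tcomb_unique:
  assumes "l \<in> L p" "m \<in> L p" "l' \<in> L p" "m' \<in> L p" "tcomb p l m c = tcomb p l' m' c'"
  shows "l = l'" "m = m'" "c = c'"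
proof -
  have "inj_on (\<lambda>(v, w, c). vadd (vadd v w) (vscale c (T p))) (L p \<times> vconj ` L p \<times> UNIV)"
    using trans unfolding transversal_def bij_betw_def by blast
  from inj_onD[OF this, of "(l, vconj m, c)" "(l', vconj m', c')"]
  have "l = l' \<and> vconj m = vconj m' \<and> c = c'" using assms unfolding tcomb_def by auto
  then show "l = l'" "m = m'" "c = c'" by (metis vconj_vconj)+
qed

lemma tcomb_exists:
  assumes "v \<in> ctangent A p"
  obtains l m c where "l \<in> L p" "m \<in> L p" "v = tcomb p l m c"
proof -
  have "v \<in> (\<lambda>(v, w, c). vadd (vadd v w) (vscale c (T p))) ` (L p \<times> vconj ` L p \<times> UNIV)"
    using trans assms unfolding transversal_def bij_betw_def by blast
  then show ?thesis using that unfolding tcomb_def by auto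
qed

lemma tcomb_ctangent: "l \<in> L p \<Longrightarrow> m \<in> L p \<Longrightarrow> tcomb p l m c \<in> ctangent A p"
  unfolding tcomb_def by (intro vadd_ctangent vscale_ctangent vconj_ctangent L_sub T_tan)

definition dec :: "'a \<Rightarrow> 'a cvec \<Rightarrow> 'a cvec \<times> 'a cvec \<times> complex" where
  "dec p v = (SOME (l, m, c). l \<in> L p \<and> m \<in> L p \<and> v = tcomb p l m c)"

lemma dec_tcomb:
  assumes "l \<in> L p" "m \<in> L p" shows "dec p (tcomb p l m c) = (l, m, c)"
proof -
  let ?P = "\<lambda>(l', m', c'). l' \<in> L p \<and> m' \<in> L p \<and> tcomb p l m c = tcomb p l' m' c'"
  obtain l' m' c' where e: "dec p (tcomb p l m c) = (l', m', c')" by (metis prod.exhaust)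
  have "?P (dec p (tcomb p l m c))" unfolding dec_def by (rule someI[of ?P "(l, m, c)"]) (use assms in auto)
  then have "l' \<in> L p" "m' \<in> L p" "tcomb p l m c = tcomb p l' m' c'" unfolding e by auto
  from tcomb_unique[OF assms this] show ?thesis unfolding e by simp
qed

text \<open>The form with value 1 on \<open>T p\<close> that annihilates the bundle deformed by
  \<open>f\<close> and its conjugate. The terms with \<open>f\<close> arise from writing
  \<open>l\<close> and \<open>vconj m\<close> as deformed vectors plus multiples of
  \<open>T p\<close>.\<close>

definition nf :: "('a \<Rightarrow> real) \<Rightarrow> 'a \<Rightarrow> 'a cvec \<Rightarrow> complex" where
  "nf f p v = (case dec p v of (l, m, c) \<Rightarrow> c + \<i> * l (cf f) - \<i> * cnj (m (cf f)))"

lemma nf_tcomb: "l \<in> L p \<Longrightarrow> m \<in> L p \<Longrightarrow> nf f p (tcomb p l m c) = c + \<i> * l (cf f) - \<i> * cnj (m (cf f))"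
  by (simp add: nf_def dec_tcomb)

lemma tcomb_add: "vadd (tcomb p l m c) (tcomb p l' m' c') = tcomb p (vadd l l') (vadd m m') (c + c')"
  unfolding tcomb_def vconj_add by (simp add: vdefs algebra_simps)

lemma tcomb_scale: "vscale b (tcomb p l m c) = tcomb p (vscale b l) (vscale (cnj b) m) (b * c)"
  unfolding tcomb_def vconj_scale by (simp add: vdefs algebra_simps)

lemma tcomb_conj: "vconj (tcomb p l m c) = tcomb p m l (cnj c)"
  unfolding tcomb_def vconj_add vconj_scale vconj_vconj T_real by (simp add: vdefs algebra_simps)

lemma nf_add: "v \<in> ctangent A p \<Longrightarrow> w \<in> ctangent A p \<Longrightarrow> nf f p (vadd v w) = nf f p v + nf f p w"
  by (elim tcomb_exists) (simp add: tcomb_add nf_tcomb L_add, simp add: vdefs algebra_simps)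

lemma nf_scale: "v \<in> ctangent A p \<Longrightarrow> nf f p (vscale c v) = c * nf f p v"
  by (elim tcomb_exists) (simp add: tcomb_scale nf_tcomb L_scale, simp add: vdefs algebra_simps)

lemma nf_conj: "v \<in> ctangent A p \<Longrightarrow> nf f p (vconj v) = cnj (nf f p v)"
  by (elim tcomb_exists) (simp add: tcomb_conj nf_tcomb)

lemma tcomb_T: "T p = tcomb p vzero vzero 1"
  by (simp add: tcomb_def vdefs vconj_def)

lemma nf_T: "nf f p (T p) = 1"
  by (subst tcomb_T) (simp add: nf_tcomb L_zero, simp add: vdefs)

definition tinv :: "('a \<Rightarrow> real) \<Rightarrow> bool" where
  "tinv f \<longleftrightarrow> mfd_smooth A f \<and> (\<forall>p. T p (cf f) = 0)"

lemma tinvD: "tinv f \<Longrightarrow> mfd_smooth A f" "tinv f \<Longrightarrow> mfd_smooth A (cf f)" "tinv f \<Longrightarrow> T p (cf f) = 0"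
  unfolding tinv_def by (auto intro: sm_intros)

lemma ldef_tcomb: "ldef T f p v = tcomb p v vzero (- \<i> * v (cf f))"
  by (simp add: ldef_def tcomb_def vdefs vconj_def)

lemma vconj_ldef_tcomb: "vconj (ldef T f p v) = tcomb p vzero v (\<i> * cnj (v (cf f)))"
  by (simp add: ldef_tcomb tcomb_conj)

lemma nf_ldef: "v \<in> L p \<Longrightarrow> nf f p (ldef T f p v) = 0" "v \<in> L p \<Longrightarrow> nf f p (vconj (ldef T f p v)) = 0"
  unfolding ldef_tcomb tcomb_conj by (simp add: nf_tcomb L_zero, simp add: vdefs)+

lemma ldef_ctangent: "v \<in> L p \<Longrightarrow> ldef T f p v \<in> ctangent A p"
  unfolding ldef_tcomb by (intro tcomb_ctangent L_zero)

lemma ldef_scale: "ldef T f p (vscale c v) = vscale c (ldef T f p v)"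
  by (simp add: ldef_def vdefs algebra_simps)

lemma ldef_add: "ldef T f p (vadd v w) = vadd (ldef T f p v) (ldef T f p w)"
  by (simp add: ldef_def vdefs algebra_simps)

lemma ldef_section:
  assumes Z: "smooth_section A UNIV L Z" and f: "tinv f"
  shows "smooth_section A UNIV (deform L T f) (\<lambda>q. ldef T f q (Z q))"
  unfolding smooth_section_def deform_eq
proof (intro conjI ballI allI impI)
  show "ldef T f p (Z p) \<in> ldef T f p ` L p" for p using secD(1)[OF Z] by blast
  fix g :: "'a \<Rightarrow> complex" assume "mfd_smooth A g"
  then show "mfd_smooth A (\<lambda>q. ldef T f q (Z q) g)"
    unfolding ldef_def vdefs by (intro sm_intros secD(2)[OF Z] secD(2)[OF T_sec] tinvD f)
qed

lemma ldef_section':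
  assumes Z: "smooth_section A UNIV L Z" and f: "tinv f"
  shows "smooth_section A UNIV (ctangent A) (\<lambda>q. ldef T f q (Z q))"
  using ldef_section[OF Z f] ldef_ctangent[OF secD(1)[OF Z]] unfolding smooth_section_def by blast

text \<open>Since \<open>T\<close> annihilates \<open>f\<close>, a deformed vector and its source
  have the same value on \<open>f\<close>. This makes the deformation invertible by a formula that
  visibly preserves smoothness.\<close>

lemma deform_section:
  assumes W: "smooth_section A UNIV (deform L T f) W" and f: "tinv f"
  obtains Z where "smooth_section A UNIV L Z" "\<And>q. W q = ldef T f q (Z q)"
proof -
  define Z where "Z q = vadd (W q) (vscale (\<i> * W q (cf f)) (T q))" for q
  have *: "Z q \<in> L q \<and> W q = ldef T f q (Z q)" for q
  proof -
    obtain v where v: "v \<in> L q" "W q = ldef T f q v" using secD(1)[OF W, of q] unfolding deform_eq by blast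
    have e: "W q (cf f) = v (cf f)" unfolding v ldef_def vdefs using tinvD(3)[OF f] by simp
    have "Z q = v" unfolding Z_def e unfolding v(2) by (simp add: ldef_def vdefs)
    then show ?thesis using v by simp
  qed
  have "smooth_section A UNIV L Z"
    unfolding smooth_section_def
  proof (intro conjI ballI allI impI)
    fix g :: "'a \<Rightarrow> complex" assume "mfd_smooth A g"
    then show "mfd_smooth A (\<lambda>q. Z q g)"
      unfolding Z_def vdefs by (intro sm_intros secD(2)[OF W] secD(2)[OF T_sec] tinvD f)
  qed (use * in blast)
  then show ?thesis using that * by blast
qed

lemma ldef_eq_zero: "v \<in> L p \<Longrightarrow> ldef T f p v = vzero \<longleftrightarrow> v = vzero"
proof
  assume v: "v \<in> L p" and "ldef T f p v = vzero"
  then have "tcomb p v vzero (- \<i> * v (cf f)) = tcomb p vzero vzero 0"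
    unfolding ldef_tcomb by (simp add: tcomb_def vdefs vconj_def)
  from tcomb_unique(1)[OF v L_zero L_zero L_zero this] show "v = vzero" .
qed (simp add: ldef_def vdefs)

lemma cr_section:
  assumes "smooth_section A UNIV L Z" shows "smooth_section A UNIV L (lie_bracket T Z)"
  using cr assms unfolding cr_vector_field_def by blast

lemma vconj_lie: "vconj (lie_bracket Z W p) = lie_bracket (\<lambda>q. vconj (Z q)) (\<lambda>q. vconj (W q)) p"
  by (simp add: vconj_def lie_bracket_def)

subsubsection \<open>The Levi form of a deformation\<close>

text \<open>The exterior derivative of \<open>nf f\<close> on a deformed section and its conjugate:
  both are annihilated by \<open>nf f\<close>, so Cartan's formula leaves only the bracket
  term.\<close>

definition lev :: "('a \<Rightarrow> real) \<Rightarrow> ('a \<Rightarrow> 'a cvec) \<Rightarrow> 'a \<Rightarrow> complex" where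
  "lev f Z p = - nf f p (conj_bracket (\<lambda>q. ldef T f q (Z q)) p)"

text \<open>For \<open>T\<close>-invariant \<open>g\<close> this is twice the transversal complex
  Hessian: if [Z, conj Z] = l + conj m + c T, it equals 2 (conj Z (Z g) + l g). The components of
  the bracket correct the second derivatives to a form that depends only on the value of Z at the
  point.\<close>

definition hess :: "('a \<Rightarrow> complex) \<Rightarrow> ('a \<Rightarrow> 'a cvec) \<Rightarrow> 'a \<Rightarrow> complex" where
  "hess g Z p = (case dec p (conj_bracket Z p) of (l, m, c) \<Rightarrow>
     Z p (\<lambda>q. vconj (Z q) g) + vconj (Z p) (\<lambda>q. Z q g) + l g - vconj m g)"

definition levi0 :: "('a \<Rightarrow> 'a cvec) \<Rightarrow> 'a \<Rightarrow> complex" where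
  "levi0 Z p = (case dec p (conj_bracket Z p) of (l, m, c) \<Rightarrow> c)"

lemma conj_bracket_ctangent:
  assumes Z: "smooth_section A UNIV (ctangent A) Z"
  shows "conj_bracket Z p \<in> ctangent A p"
  unfolding conj_bracket_def by (intro lie_ctangent sec_conj Z)

text \<open>The terms quadratic in \<open>f\<close> cancel because \<open>T\<close> is CR and \<open>T f = 0\<close>: the Levi form is affine in \<open>f\<close>.\<close>
lemma lev_affine:
  assumes Z: "smooth_section A UNIV L Z" and f: "tinv f"
  shows "lev f Z p = - (levi0 Z p + \<i> * hess (cf f) Z p)"
proof -
  note Zc = L_sec[OF Z]
  note Zb = sec_conj[OF Zc]
  define a where "a q = Z q (cf f)" for q
  have a: "mfd_smooth A a" unfolding a_def by (intro secD(2)[OF Z] tinvD f)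
  have ab: "mfd_smooth A (\<lambda>q. cnj (a q))" by (intro sm_intros a)
  define W where "W q = vconj (Z q)" for q
  have W: "smooth_section A UNIV (ctangent A) W" unfolding W_def by (rule Zb)
  have Wf: "W q (cf f) = cnj (a q)" for q by (simp add: W_def a_def vconj_cf)
  note z = secD(1)[OF Zc] and w = secD(1)[OF W] and zs = secD(2)[OF Zc] and ws = secD(2)[OF W]
    and t = T_tan and ts = secD(2)[OF T_sec']
  obtain l m b where lm: "l \<in> L p" "m \<in> L p" and br: "conj_bracket Z p = tcomb p l m b"
    using tcomb_exists[OF conj_bracket_ctangent[OF Zc]] by metis
  define k where "k = lie_bracket T Z p"
  have k: "k \<in> L p" unfolding k_def using cr_section[OF Z] secD(1) by blast
  have kf: "k (cf f) = T p a"
    unfolding k_def lie_bracket_def using tinvD(3)[OF f] by (simp add: a_def[abs_def] ctangent_const[OF z])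
  have kb: "vconj k = lie_bracket T W p"
    unfolding k_def vconj_lie T_real W_def ..
  have Tab: "T p (\<lambda>q. cnj (a q)) = cnj (T p a)"
    using T_real[of p] unfolding vconj_def fun_eq_iff by (metis complex_cnj_cnj)
  \<comment> \<open>Components of the bracket of Z - i a T with its conjugate. Since k = [T, Z] lies
    in \<open>L\<close>, the potential contributes only multiples of k, of its conjugate and of
    \<open>T\<close>.\<close>
  define l' where "l' = vadd l (vscale (- \<i> * cnj (a p)) k)"
  define m' where "m' = vadd m (vscale (\<i> * cnj (a p)) k)"
  define b' where "b' = b + \<i> * (Z p (\<lambda>q. cnj (a q)) + W p a) + a p * cnj (T p a) - cnj (a p) * T p a"
  have lm': "l' \<in> L p" "m' \<in> L p" unfolding l'_def m'_def by (intro L_add L_scale lm k)+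
  let ?Zf = "\<lambda>q. ldef T f q (Z q)"
  have Zf: "?Zf q g = Z q g + (- \<i> * a q) * T q g" for q g by (simp add: ldef_def vdefs a_def)
  have Wf': "vconj (?Zf q) g = W q g + (\<i> * cnj (a q)) * T q g" for q g
    by (simp add: ldef_def vconj_add vconj_scale T_real W_def) (simp add: vdefs a_def)
  have "smooth_section A UNIV (ctangent A) ?Zf"
    by (rule ldef_section'[OF Z f])
  then have c1: "conj_bracket ?Zf p \<in> ctangent A p" by (rule conj_bracket_ctangent)
  have "conj_bracket ?Zf p = tcomb p l' m' b'"
  proof (rule ctangent_eqI[OF c1])
    show "tcomb p l' m' b' \<in> ctangent A p" by (intro tcomb_ctangent lm')
    fix g :: "'a \<Rightarrow> complex" assume g: "mfd_smooth A g"
    have s1: "mfd_smooth A (\<lambda>q. (\<i> * cnj (a q)) * T q g)" "mfd_smooth A (\<lambda>q. (- \<i> * a q) * T q g)"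
       "mfd_smooth A (\<lambda>q. \<i> * cnj (a q))" "mfd_smooth A (\<lambda>q. - \<i> * a q)"
      using g a by (auto intro!: sm_intros ts)
    have e1: "v (\<lambda>q. W q g + (\<i> * cnj (a q)) * T q g) = v (\<lambda>q. W q g) + \<i> * v (\<lambda>q. cnj (a q)) * T p g + \<i> * cnj (a p) * v (\<lambda>q. T q g)"
      if v: "v \<in> ctangent A p" for v
      unfolding ctangentD(1)[OF v ws[OF g] s1(1)] ctangentD(2)[OF v s1(3) ts[OF g]] ctangentD(3)[OF v ab] by simp
    have e2: "v (\<lambda>q. Z q g + (- \<i> * a q) * T q g) = v (\<lambda>q. Z q g) + (- \<i>) * v a * T p g + (- \<i>) * a p * v (\<lambda>q. T q g)"
      if v: "v \<in> ctangent A p" for v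
      unfolding ctangentD(1)[OF v zs[OF g] s1(2)] ctangentD(2)[OF v s1(4) ts[OF g]] ctangentD(3)[OF v a] by simp
    have br': "Z p (\<lambda>q. W q g) - W p (\<lambda>q. Z q g) = l g + vconj m g + b * T p g"
      using fun_cong[OF br, of g] by (simp add: conj_bracket_def lie_bracket_def tcomb_def vdefs W_def)
    have kg: "k g = T p (\<lambda>q. Z q g) - Z p (\<lambda>q. T q g)" by (simp add: k_def lie_bracket_def)
    have kbg: "vconj k g = T p (\<lambda>q. W q g) - W p (\<lambda>q. T q g)" by (simp add: kb lie_bracket_def)
    have "conj_bracket ?Zf p g = ?Zf p (\<lambda>q. vconj (?Zf q) g) - vconj (?Zf p) (\<lambda>q. ?Zf q g)"
      by (simp add: conj_bracket_def lie_bracket_def)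
    also have "\<dots> = (Z p (\<lambda>q. W q g) - W p (\<lambda>q. Z q g)) + \<i> * (Z p (\<lambda>q. cnj (a q)) + W p a) * T p g
        - \<i> * cnj (a p) * k g - \<i> * a p * vconj k g + (a p * cnj (T p a) - cnj (a p) * T p a) * T p g"
      unfolding Wf' Zf e1[OF z] e1[OF t] e2[OF w] e2[OF t] kg kbg Tab by (simp add: algebra_simps)
    also have "\<dots> = tcomb p l' m' b' g"
      unfolding br' tcomb_def l'_def m'_def b'_def vconj_add vconj_scale by (simp add: vdefs algebra_simps)
    finally show "conj_bracket ?Zf p g = tcomb p l' m' b' g" .
  qed
  then have "lev f Z p = - (b' + \<i> * l' (cf f) - \<i> * cnj (m' (cf f)))"
    unfolding lev_def by (simp add: nf_tcomb lm')
  \<comment> \<open>The quadratic terms of \<open>b'\<close> cancel against \<open>l'\<close> and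
    \<open>m'\<close> applied to \<open>f\<close>, because [T, Z] f = T (Z f).\<close>
  also have "\<dots> = - (b + \<i> * (Z p (\<lambda>q. cnj (a q)) + W p a + l (cf f) - cnj (m (cf f))))"
    by (simp add: b'_def l'_def m'_def vdefs kf algebra_simps)
  also have "\<dots> = - (levi0 Z p + \<i> * hess (cf f) Z p)"
    unfolding hess_def levi0_def br dec_tcomb[OF lm] by (simp add: vconj_cf) (simp add: a_def[abs_def] W_def vconj_cf)
  finally show ?thesis .
qed

text \<open>The factor \<open>u\<close> makes room for an arbitrary contact form. It is never
  differentiated, since \<open>nf f\<close> vanishes on both arguments.\<close>

lemma ext_deriv_lev:
  assumes \<alpha>: "\<And>q v. v \<in> ctangent A q \<Longrightarrow> \<alpha> q v = u q * nf f q v" and Z: "smooth_section A UNIV L Z" and f: "tinv f"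
  shows "ext_deriv \<alpha> (\<lambda>q. ldef T f q (Z q)) (\<lambda>q. vconj (ldef T f q (Z q))) p = u p * lev f Z p"
proof -
  let ?Zf = "\<lambda>q. ldef T f q (Z q)"
  have t: "?Zf q \<in> ctangent A q" for q by (intro ldef_ctangent secD(1)[OF Z])
  have "smooth_section A UNIV (ctangent A) ?Zf"
    by (rule ldef_section'[OF Z f])
  then have c1: "conj_bracket ?Zf p \<in> ctangent A p" by (rule conj_bracket_ctangent)
  have 0: "\<alpha> q (?Zf q) = 0" "\<alpha> q (vconj (?Zf q)) = 0" for q
    using \<alpha>[OF t, of q] \<alpha>[OF vconj_ctangent[OF t], of q] nf_ldef[OF secD(1)[OF Z], where f = f and p = q] by auto
  show ?thesis
    unfolding ext_deriv_def 0 ctangent_const[OF t] ctangent_const[OF vconj_ctangent[OF t]]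
    using \<alpha>[OF c1] unfolding conj_bracket_def lev_def by simp
qed

definition levi_pos :: "('a \<Rightarrow> real) \<Rightarrow> bool" where
  "levi_pos f \<longleftrightarrow> (\<forall>Z p. smooth_section A UNIV L Z \<and> Z p \<noteq> vzero \<longrightarrow>
     (\<exists>r>0. 1 / (2 * \<i>) * lev f Z p = complex_of_real r))"

text \<open>Strict pseudoconvexity witnessed by the normalised form \<open>nf f\<close> instead of
  by some contact form; in this shape convexity can be read off.\<close>

definition good :: "('a \<Rightarrow> real) \<Rightarrow> bool" where
  "good f \<longleftrightarrow> tinv f \<and> real_one_form A (nf f) \<and> levi_pos f"

lemma nf_ker:
  assumes "tinv f"
  shows "ker_form A (nf f) p = Re_bundle (deform L T f) p"
proof
  show "ker_form A (nf f) p \<subseteq> Re_bundle (deform L T f) p"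
  proof
    fix v assume "v \<in> ker_form A (nf f) p"
    then have v: "v \<in> ctangent A p" "vconj v = v" "nf f p v = 0" by (auto simp: ker_form_def rtangent_def)
    obtain l m c where lm: "l \<in> L p" "m \<in> L p" "v = tcomb p l m c" using tcomb_exists[OF v(1)] .
    \<comment> \<open>A real vector has equal components, and vanishing of \<open>nf f\<close> then
      fixes its \<open>T\<close> coefficient.\<close>
    have "m = l" using v(2) lm tcomb_unique(1)[of m p l l m] by (auto simp: tcomb_conj)
    then have c: "c = - \<i> * l (cf f) + \<i> * cnj (l (cf f))" using v(3) lm by (simp add: nf_tcomb algebra_simps eq_neg_iff_add_eq_0)
    have "v = vscale (1/2) (vadd (ldef T f p (vscale 2 l)) (vconj (ldef T f p (vscale 2 l))))"
      unfolding lm(3) \<open>m = l\<close> c ldef_tcomb tcomb_conj tcomb_add tcomb_scale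
      by (simp add: tcomb_def vdefs vconj_def algebra_simps)
    then show "v \<in> Re_bundle (deform L T f) p"
      unfolding Re_bundle_def deform_eq using L_scale[OF lm(1), of 2] by blast
  qed
  show "Re_bundle (deform L T f) p \<subseteq> ker_form A (nf f) p"
  proof
    fix v assume "v \<in> Re_bundle (deform L T f) p"
    then obtain w where w: "w \<in> L p" "v = vscale (1/2) (vadd (ldef T f p w) (vconj (ldef T f p w)))"
      unfolding Re_bundle_def deform_eq by blast
    let ?w = "ldef T f p w"
    have t: "?w \<in> ctangent A p" "vconj ?w \<in> ctangent A p" using ldef_ctangent[OF w(1)] vconj_ctangent by auto
    have "v \<in> ctangent A p" unfolding w(2) by (intro vscale_ctangent vadd_ctangent t)
    moreover have "vconj v = v" unfolding w(2) vconj_add vconj_scale vconj_vconj by (simp add: vdefs algebra_simps)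
    moreover have "nf f p v = 0" unfolding w(2) using t nf_ldef[OF w(1), of f] by (simp add: nf_scale nf_add vadd_ctangent)
    ultimately show "v \<in> ker_form A (nf f) p" by (simp add: ker_form_def rtangent_def)
  qed
qed

lemma good_imp_psc:
  assumes "good f" shows "strictly_pseudoconvex A (deform L T f)"
proof -
  have f: "tinv f" "real_one_form A (nf f)" "levi_pos f" using assms unfolding good_def by auto
  have "nonvanishing A (nf f)"
    unfolding nonvanishing_def using nf_T T_sec unfolding smooth_section_def by (metis UNIV_I zero_neq_one)
  moreover have "levi_positive A (deform L T f) (nf f)"
    unfolding levi_positive_def
  proof (intro allI impI, elim conjE)
    fix W p assume W: "smooth_section A UNIV (deform L T f) W" "W p \<noteq> vzero"
    obtain Z where Z: "smooth_section A UNIV L Z" "\<And>q. W q = ldef T f q (Z q)" using deform_section[OF W(1) f(1)] by metis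
    have "Z p \<noteq> vzero" using W(2) Z ldef_eq_zero[OF secD(1)[OF Z(1)], of f p] by auto
    then obtain r where "r > 0" "1 / (2 * \<i>) * lev f Z p = complex_of_real r" using f(3) Z(1) unfolding levi_pos_def by blast
    moreover have "W = (\<lambda>q. ldef T f q (Z q))" using Z(2) by blast
    ultimately show "\<exists>r>0. 1 / (2 * \<i>) * ext_deriv (nf f) W (\<lambda>q. vconj (W q)) p = complex_of_real r"
      using ext_deriv_lev[of "nf f" "\<lambda>_. 1" f Z p] Z(1) f(1) by auto
  qed
  ultimately show ?thesis unfolding strictly_pseudoconvex_def using f nf_ker by blast
qed

text \<open>A contact form is \<open>u\<close> times the normalised one, where \<open>u\<close> is
  its value on \<open>T\<close>. The sign of \<open>u\<close> stays open here and is settled in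
  \<open>psc_good\<close>.\<close>

lemma psc_imp:
  assumes f: "tinv f" and sp: "strictly_pseudoconvex A (deform L T f)"
  obtains u :: "'a \<Rightarrow> real" where "continuous_on UNIV u" "\<And>p. u p \<noteq> 0" "real_one_form A (nf f)"
    "\<And>Z p. smooth_section A UNIV L Z \<Longrightarrow> Z p \<noteq> vzero \<Longrightarrow> \<exists>r>0. 1 / (2 * \<i>) * (of_real (u p) * lev f Z p) = complex_of_real r"
proof -
  obtain \<alpha> where \<alpha>: "real_one_form A \<alpha>" "\<And>p. ker_form A \<alpha> p = Re_bundle (deform L T f) p" "levi_positive A (deform L T f) \<alpha>"
    using sp unfolding strictly_pseudoconvex_def by blast
  note rf = \<alpha>(1)[unfolded real_one_form_def]
  have a_add: "\<alpha> p (vadd v w) = \<alpha> p v + \<alpha> p w" if "v \<in> ctangent A p" "w \<in> ctangent A p" for p v w using rf that by blast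
  have a_scale: "\<alpha> p (vscale c v) = c * \<alpha> p v" if "v \<in> ctangent A p" for p c v using rf that by blast
  have a_conj: "\<alpha> p (vconj v) = cnj (\<alpha> p v)" if "v \<in> ctangent A p" for p v using rf that by blast
  have a_sm: "mfd_smooth A (\<lambda>p. \<alpha> p (Z p))" if "smooth_section A UNIV (ctangent A) Z" for Z using rf that by blast
  define u where "u p = Re (\<alpha> p (T p))" for p
  have u: "\<alpha> p (T p) = of_real (u p)" for p
    using a_conj[OF T_tan, of p] T_real[of p] unfolding u_def by (simp add: complex_eq_iff)
  have us: "mfd_smooth A u" unfolding u_def by (intro sm_intros a_sm T_sec')
  have re: "\<alpha> p w + cnj (\<alpha> p w) = 0" if w: "w \<in> deform L T f p" for w p
  proof -
    obtain x where x: "x \<in> L p" "w = ldef T f p x" using w unfolding deform_eq by blast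
    have t: "w \<in> ctangent A p" "vconj w \<in> ctangent A p" using ldef_ctangent[OF x(1)] vconj_ctangent x(2) by auto
    have "vscale (1/2) (vadd w (vconj w)) \<in> ker_form A \<alpha> p" unfolding \<alpha>(2) Re_bundle_def using w by blast
    then have "\<alpha> p (vscale (1/2) (vadd w (vconj w))) = 0" by (simp add: ker_form_def)
    then show ?thesis using t by (simp add: a_scale a_add a_conj vadd_ctangent)
  qed
  \<comment> \<open>The kernel condition speaks of real parts only. Applied to a vector and to its
    multiple by \<open>\<i>\<close>, it kills the real and the imaginary part of the value.\<close>
  have a0: "\<alpha> p (ldef T f p x) = 0" if x: "x \<in> L p" for x p
  proof -
    have "ldef T f p x \<in> deform L T f p" "vscale \<i> (ldef T f p x) \<in> deform L T f p"
      unfolding deform_eq using x L_scale[OF x, of \<i>] by (auto simp: ldef_scale[symmetric])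
    then show ?thesis using re[of "ldef T f p x" p] re[of "vscale \<i> (ldef T f p x)" p] ldef_ctangent[OF x, of f]
      by (simp add: a_scale complex_eq_iff)
  qed
  have au: "\<alpha> p v = of_real (u p) * nf f p v" if v: "v \<in> ctangent A p" for p v
  proof -
    obtain l m c where lm: "l \<in> L p" "m \<in> L p" "v = tcomb p l m c" using tcomb_exists[OF v] .
    define d where "d = c + \<i> * l (cf f) - \<i> * cnj (m (cf f))"
    have e: "v = vadd (vadd (ldef T f p l) (vconj (ldef T f p m))) (vscale d (T p))"
      unfolding lm(3) vconj_ldef_tcomb ldef_tcomb tcomb_add
      by (simp add: tcomb_def vdefs vconj_def d_def T_cnj algebra_simps)
    have t: "ldef T f p l \<in> ctangent A p" "ldef T f p m \<in> ctangent A p" by (intro ldef_ctangent lm)+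
    have "\<alpha> p v = d * of_real (u p)"
      unfolding e using t by (simp add: a_add a_scale a_conj vadd_ctangent vconj_ctangent vscale_ctangent T_tan a0 lm u)
    then show ?thesis by (simp add: lm nf_tcomb d_def)
  qed
  have u0: "u p \<noteq> 0" for p
  proof
    \<comment> \<open>Then \<open>T p\<close> would lie in the real part of the deformed bundle,
      which is also the kernel of \<open>nf f\<close>.\<close>
    assume "u p = 0"
    then have "T p \<in> ker_form A \<alpha> p" using u[of p] T_sec unfolding ker_form_def smooth_section_def by auto
    then have "T p \<in> ker_form A (nf f) p" unfolding \<alpha>(2) nf_ker[OF f] .
    then show False using nf_T[of f p] by (simp add: ker_form_def)
  qed
  have nfs: "mfd_smooth A (\<lambda>p. nf f p (Z p))" if Z: "smooth_section A UNIV (ctangent A) Z" for Z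
  proof -
    have "nf f p (Z p) = inverse (of_real (u p)) * \<alpha> p (Z p)" for p
      using au[OF secD(1)[OF Z], of p] u0[of p] by simp
    then show ?thesis using u0 by (simp only:) (intro sm_intros us a_sm Z, simp)
  qed
  have "real_one_form A (nf f)"
    unfolding real_one_form_def using nf_add nf_scale nf_conj nfs by blast
  moreover have "\<exists>r>0. 1 / (2 * \<i>) * (of_real (u p) * lev f Z p) = complex_of_real r"
    if Z: "smooth_section A UNIV L Z" "Z p \<noteq> vzero" for Z p
  proof -
    have "ldef T f p (Z p) \<noteq> vzero" using ldef_eq_zero[OF secD(1)[OF Z(1)]] Z(2) by blast
    then have "\<exists>r>0. 1 / (2 * \<i>) * ext_deriv \<alpha> (\<lambda>q. ldef T f q (Z q)) (\<lambda>q. vconj (ldef T f q (Z q))) p = complex_of_real r"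
      using \<alpha>(3) ldef_section[OF Z(1) f] unfolding levi_positive_def by blast
    then show ?thesis using ext_deriv_lev[OF au Z(1) f, of p] by simp
  qed
  ultimately show ?thesis using that[of u] sm_continuous[OF us] u0 by blast
qed

subsubsection \<open>Convexity\<close>

lemma ctangent_comb:
  fixes a b :: "'a \<Rightarrow> complex" and s t :: complex
  assumes v: "v \<in> ctangent A p" and a: "mfd_smooth A a" and b: "mfd_smooth A b"
  shows "v (\<lambda>q. s * a q + t * b q) = s * v a + t * v b"
proof -
  have "mfd_smooth A (\<lambda>q. s * a q)" "mfd_smooth A (\<lambda>q. t * b q)" by (intro sm_intros a b)+
  then show ?thesis using a b by (simp add: ctangentD(1,3)[OF v])
qed

lemma tinv_comb:
  assumes "tinv f" "tinv g" shows "tinv (\<lambda>x. s * f x + t * g x)"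
    and "\<And>(v :: 'a cvec) p. v \<in> ctangent A p \<Longrightarrow> v (cf (\<lambda>x. s * f x + t * g x)) = s * v (cf f) + t * v (cf g)"
proof -
  show *: "v (cf (\<lambda>x. s * f x + t * g x)) = s * v (cf f) + t * v (cf g)" if v: "v \<in> ctangent A p" for v :: "'a cvec" and p
    using ctangent_comb[OF v tinvD(2)[OF assms(1)] tinvD(2)[OF assms(2)]] by simp
  show "tinv (\<lambda>x. s * f x + t * g x)"
    unfolding tinv_def using *[OF T_tan] assms by (auto simp: tinv_def intro!: sm_intros)
qed

lemma hess_comb:
  assumes f: "tinv f" and g: "tinv g" and Z: "smooth_section A UNIV L Z"
  shows "hess (cf (\<lambda>x. s * f x + t * g x)) Z p = s * hess (cf f) Z p + t * hess (cf g) Z p"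
proof -
  note Zc = L_sec[OF Z]
  note Zb = sec_conj[OF Zc]
  obtain l m b where lm: "l \<in> L p" "m \<in> L p" and br: "conj_bracket Z p = tcomb p l m b"
    using tcomb_exists[OF conj_bracket_ctangent[OF Zc]] by metis
  note tc = tinv_comb(2)[OF f g]
  have 1: "v (\<lambda>q. s * W q (cf f) + t * W q (cf g)) = s * v (\<lambda>q. W q (cf f)) + t * v (\<lambda>q. W q (cf g))"
    if v: "v \<in> ctangent A p" and W: "smooth_section A UNIV (ctangent A) W" for v :: "'a cvec" and W :: "'a \<Rightarrow> 'a cvec"
    by (intro ctangent_comb[OF v] secD(2)[OF W] tinvD f g)
  show ?thesis unfolding hess_def br dec_tcomb[OF lm] split
    tc[OF secD(1)[OF Zc]] tc[OF secD(1)[OF Zb]] tc[OF L_sub[OF lm(1)]] tc[OF vconj_ctangent[OF L_sub[OF lm(2)]]]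
    1[OF secD(1)[OF Zc] Zb] 1[OF secD(1)[OF Zb] Zc] by (simp add: algebra_simps)
qed

lemma nf_comb:
  assumes f: "tinv f" and g: "tinv g" and v: "v \<in> ctangent A p" and st: "s + t = 1"
  shows "nf (\<lambda>x. s * f x + t * g x) p v = s * nf f p v + t * nf g p v"
proof -
  obtain l m c where lm: "l \<in> L p" "m \<in> L p" "v = tcomb p l m c" using tcomb_exists[OF v] .
  have "s = 1 - t" using st by simp
  then have st': "complex_of_real s = 1 - t" by simp
  have *: "c + \<i> * (s * x1 + t * x2) - \<i> * cnj (s * y1 + t * y2) = s * (c + \<i> * x1 - \<i> * cnj y1) + t * (c + \<i> * x2 - \<i> * cnj y2)" for x1 x2 y1 y2 :: complex
    unfolding st' by (simp add: algebra_simps)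
  show ?thesis
    unfolding lm(3) nf_tcomb[OF lm(1,2)] tinv_comb(2)[OF f g L_sub[OF lm(1)]] tinv_comb(2)[OF f g L_sub[OF lm(2)]]
    by (rule *)
qed

lemma lev_comb:
  assumes f: "tinv f" and g: "tinv g" and Z: "smooth_section A UNIV L Z" and st: "s + t = 1"
  shows "lev (\<lambda>x. s * f x + t * g x) Z p = s * lev f Z p + t * lev g Z p"
proof -
  have "s = 1 - t" using st by simp
  then have st': "complex_of_real s = 1 - t" by simp
  show ?thesis
    unfolding lev_affine[OF Z f] lev_affine[OF Z g] lev_affine[OF Z tinv_comb(1)[OF f g]] hess_comb[OF f g Z]
    by (simp add: st' algebra_simps)
qed

text \<open>The form and its Levi form are both affine in the potential; s + t = 1 preserves their
  constant terms.\<close>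

lemma good_convex:
  assumes f: "good f" and g: "good g" and st: "s + t = 1" "s \<ge> 0" "t \<ge> 0"
  shows "good (\<lambda>x. s * f x + t * g x)"
proof -
  have ti: "tinv f" "tinv g" using f g unfolding good_def by auto
  let ?h = "\<lambda>x. s * f x + t * g x"
  have "mfd_smooth A (\<lambda>p. nf ?h p (Z p))" if Z: "smooth_section A UNIV (ctangent A) Z" for Z
  proof -
    have "mfd_smooth A (\<lambda>p. nf f p (Z p))" "mfd_smooth A (\<lambda>p. nf g p (Z p))"
      using f g Z unfolding good_def real_one_form_def by blast+
    then show ?thesis unfolding nf_comb[OF ti secD(1)[OF Z] st(1)] by (intro sm_intros)
  qed
  then have "real_one_form A (nf ?h)"
    unfolding real_one_form_def using nf_add nf_scale nf_conj by blast
  moreover have "levi_pos ?h"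
    unfolding levi_pos_def
  proof (intro allI impI, elim conjE)
    fix Z p assume Z: "smooth_section A UNIV L Z" "Z p \<noteq> vzero"
    obtain r1 where r1: "r1 > 0" "1 / (2 * \<i>) * lev f Z p = complex_of_real r1" using f Z unfolding good_def levi_pos_def by blast
    obtain r2 where r2: "r2 > 0" "1 / (2 * \<i>) * lev g Z p = complex_of_real r2" using g Z unfolding good_def levi_pos_def by blast
    have "1 / (2 * \<i>) * lev ?h Z p = s * (1 / (2 * \<i>) * lev f Z p) + t * (1 / (2 * \<i>) * lev g Z p)"
      unfolding lev_comb[OF ti Z(1) st(1)] by (simp add: algebra_simps add_divide_distrib)
    also have "\<dots> = complex_of_real (s * r1 + t * r2)" unfolding r1 r2 by simp
    finally have "1 / (2 * \<i>) * lev ?h Z p = complex_of_real (s * r1 + t * r2)" .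
    moreover have "s * r1 + t * r2 > 0"
      using st r1(1) r2(1) by (cases "s = 0") (auto intro: add_pos_nonneg)
    ultimately show "\<exists>r>0. 1 / (2 * \<i>) * lev ?h Z p = complex_of_real r" by blast
  qed
  ultimately show ?thesis unfolding good_def using tinv_comb(1)[OF ti] by blast
qed

end

subsection \<open>The maximum principle\<close>

text \<open>Second derivative test along the line in direction \<open>a\<close>: were the quadratic
  form positive, the derivative along the line would be positive just after 0, and the mean value
  theorem would push \<open>f\<close> above its maximum.\<close>

lemma smooth_max_point:
  fixes f :: "real^'m::finite \<Rightarrow> real"
  assumes S: "open S" and f: "smooth_on S f" and y0: "y0 \<in> S" and mx: "\<And>y. y \<in> S \<Longrightarrow> f y \<le> f y0"
  shows "pder k f y0 = 0" "(\<Sum>k\<in>UNIV. \<Sum>j\<in>UNIV. a $ k * a $ j * pder j (pder k f) y0) \<le> 0"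
proof -
  have z: "pder k f y0 = 0" for k
  proof -
    have "frechet_derivative f (at y0) = (\<lambda>v. 0)"
      using mx smooth_on_differentiable[OF f y0]
      by (intro differential_zero_maxmin[OF y0 S]) (auto simp: frechet_derivative_works)
    then show ?thesis by (simp add: pder_def)
  qed
  show "pder k f y0 = 0" by (rule z)
  define G where "G t = (\<Sum>k\<in>UNIV. a $ k * pder k f (y0 + t *\<^sub>R a))" for t
  define M where "M = (\<Sum>k\<in>UNIV. \<Sum>j\<in>UNIV. a $ k * a $ j * pder j (pder k f) y0)"
  have line: "((\<lambda>t. h (y0 + t *\<^sub>R a)) has_real_derivative (\<Sum>j\<in>UNIV. a $ j * pder j h (y0 + t *\<^sub>R a))) (at t)"
    if h: "smooth_on S h" and t: "y0 + t *\<^sub>R a \<in> S" for h :: "real^'m \<Rightarrow> real" and t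
  proof -
    have "((\<lambda>t. y0 + t *\<^sub>R a) has_derivative (\<lambda>s. s *\<^sub>R a)) (at t)" by (auto intro!: derivative_eq_intros)
    from has_derivative_compose[OF this smooth_on_has_derivative[OF h t]]
    show ?thesis unfolding has_field_derivative_def
      by (rule has_derivative_eq_rhs) (auto simp: sum_distrib_left sum_distrib_right mult_ac)
  qed
  have "((\<lambda>t. y0 + t *\<^sub>R a) \<longlongrightarrow> y0 + 0 *\<^sub>R a) (at 0)" by (intro tendsto_intros)
  then have "eventually (\<lambda>t. y0 + t *\<^sub>R a \<in> S) (at 0)" using S y0 by (auto dest: topological_tendstoD)
  then obtain e where e: "e > 0" "\<And>t. t \<noteq> 0 \<Longrightarrow> \<bar>t\<bar> < e \<Longrightarrow> y0 + t *\<^sub>R a \<in> S"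
    unfolding eventually_at by (auto simp: dist_norm)
  then have e': "y0 + t *\<^sub>R a \<in> S" if "\<bar>t\<bar> < e" for t using that y0 by (cases "t = 0") auto
  have G: "(G has_real_derivative M) (at 0)"
  proof -
    have "(G has_real_derivative (\<Sum>k\<in>UNIV. a $ k * (\<Sum>j\<in>UNIV. a $ j * pder j (pder k f) (y0 + 0 *\<^sub>R a)))) (at 0)"
      unfolding G_def[abs_def] by (intro DERIV_sum DERIV_cmult line smooth_on_pder f e') (use e in auto)
    then show ?thesis by (simp add: M_def sum_distrib_left mult.assoc)
  qed
  have "\<not> M > 0"
  proof
    assume "M > 0"
    then obtain d where d: "d > 0" "\<And>h. 0 < h \<Longrightarrow> h < d \<Longrightarrow> G 0 < G (0 + h)"
      using has_real_derivative_pos_inc_right[of G M 0 UNIV] G by auto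
    define t where "t = min d e / 2"
    have t: "0 < t" "t < d" "t < e" using d(1) e(1) by (auto simp: t_def)
    obtain s where s: "0 < s" "s < t" "f (y0 + t *\<^sub>R a) - f (y0 + 0 *\<^sub>R a) = (t - 0) * G s"
      using MVT2[of 0 t "\<lambda>t. f (y0 + t *\<^sub>R a)" G] t line[OF f e'] unfolding G_def by fastforce
    have "G 0 = 0" by (simp add: G_def z)
    then have "G s > 0" using d(2)[of s] s t by auto
    then have "f (y0 + t *\<^sub>R a) > f y0" using s(3) t by (auto simp: algebra_simps)
    then show False using mx[OF e'[of t]] t by auto
  qed
  then show "(\<Sum>k\<in>UNIV. \<Sum>j\<in>UNIV. a $ k * a $ j * pder j (pder k f) y0) \<le> 0" unfolding M_def by simp
qed

context smooth_mfd begin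

lemma chart_coefficients:
  assumes span: "spanned" and U: "(U, \<phi>) \<in> A" "p \<in> U" and v: "v \<in> ctangent A p"
  obtains \<zeta> :: "complex^'m" where "\<And>g. mfd_smooth A g \<Longrightarrow> v g = (\<Sum>k\<in>UNIV. \<zeta> $ k * pder k (g \<circ> inv_into U \<phi>) (\<phi> p))"
proof -
  obtain a b where ab: "v = vadd (chart_vec A U \<phi> p a) (vscale \<i> (chart_vec A U \<phi> p b))"
    using span U v unfolding spanned_def by blast
  show thesis
    by (rule that[of "\<chi> k. Complex (a $ k) (b $ k)"])
      (simp add: ab vadd_def vscale_def chart_vec_def Complex_eq sum.distrib sum_distrib_left algebra_simps scaleR_conv_of_real)
qed

lemma pder_of_real:
  assumes U: "(U, \<phi>) \<in> A" "p \<in> U" and f: "mfd_smooth A f"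
  shows "pder k (cf f \<circ> inv_into U \<phi>) (\<phi> p) = of_real (pder k (f \<circ> inv_into U \<phi>) (\<phi> p))"
  using pder_linear[OF sm_chart[OF f U(1)] _ bounded_linear_of_real[where 'a = complex], of "\<phi> p" k] U by (simp add: o_def)

lemma ctangent_chain:
  assumes span: "spanned" and v: "v \<in> ctangent A p" and f: "mfd_smooth A f" and hf: "mfd_smooth A (\<lambda>x. h (f x))"
    and h: "(h has_real_derivative h') (at (f p))"
  shows "v (cf (\<lambda>x. h (f x))) = h' * v (cf f)"
proof -
  obtain U \<phi> where U: "(U, \<phi>) \<in> A" "p \<in> U" by (rule chart_cover)
  obtain \<zeta> :: "complex^'m" where \<zeta>: "\<And>g. mfd_smooth A g \<Longrightarrow> v g = (\<Sum>k\<in>UNIV. \<zeta> $ k * pder k (g \<circ> inv_into U \<phi>) (\<phi> p))"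
    using chart_coefficients[OF span U v] by metis
  have *: "\<phi> p \<in> \<phi> ` U" using U by blast
  have "(h has_derivative (*) h') (at ((f \<circ> inv_into U \<phi>) (\<phi> p)))"
    using h chart_inv(3)[OF U] by (simp add: has_field_derivative_def)
  from pder_eqI[OF has_derivative_compose[OF smooth_on_has_derivative[OF sm_chart[OF f U(1)] *] this]]
  have "pder k ((\<lambda>x. h (f x)) \<circ> inv_into U \<phi>) (\<phi> p) = h' * pder k (f \<circ> inv_into U \<phi>) (\<phi> p)" for k
    by (simp add: o_def axis_def if_distrib[of "\<lambda>c. c * _"] cong: if_cong)
  then show ?thesis
    using pder_of_real[OF U f] pder_of_real[OF U hf]
    by (simp add: \<zeta> msm_of_real[OF open_UNIV] f hf sum_distrib_left mult_ac)
qed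

text \<open>At a critical point the derivatives of the coefficients of \<open>Z\<close> drop out.
  The symmetrised second derivative is then twice the sum of the values of the coordinate Hessian on
  the real and on the imaginary part of the coefficient vector.\<close>

lemma manifold_max_point:
  assumes span: "spanned" and h: "mfd_smooth A h" and mx: "\<And>q. h q \<le> h p" and Z: "\<And>q. Z q \<in> ctangent A q" "\<And>f. mfd_smooth A f \<Longrightarrow> mfd_smooth A (\<lambda>q. Z q f)"
  shows "v \<in> ctangent A p \<Longrightarrow> v (cf h) = 0"
    "\<exists>r\<ge>0. Z p (\<lambda>q. vconj (Z q) (cf h)) + vconj (Z p) (\<lambda>q. Z q (cf h)) = - complex_of_real r"
proof -
  obtain U \<phi> where U: "(U, \<phi>) \<in> A" "p \<in> U" by (rule chart_cover)
  define h' where "h' = h \<circ> inv_into U \<phi>"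
  have p': "\<phi> p \<in> \<phi> ` U" using U by blast
  note O = chart_homeo(2)[OF U(1)]
  have hs: "smooth_on (\<phi> ` U) h'" unfolding h'_def by (rule sm_chart[OF h U(1)])
  have "h' y \<le> h' (\<phi> p)" for y unfolding h'_def using mx chart_inv(3)[OF U] by simp
  note mp = smooth_max_point[OF O hs p' this]
  have hz: "pder k h' (\<phi> p) = 0" for k by (rule mp(1))
  have ch: "mfd_smooth A (cf h)" by (intro sm_intros h)
  show "v (cf h) = 0" if v: "v \<in> ctangent A p" for v
  proof -
    obtain \<zeta> :: "complex^'m" where \<zeta>: "\<And>g. mfd_smooth A g \<Longrightarrow> v g = (\<Sum>k\<in>UNIV. \<zeta> $ k * pder k (g \<circ> inv_into U \<phi>) (\<phi> p))"
      using chart_coefficients[OF span U v] by metis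
    show ?thesis using \<zeta>[OF ch] pder_of_real[OF U h] hz unfolding h'_def by simp
  qed
  obtain \<eta> :: "'a \<Rightarrow> real" and C where \<eta>: "mfd_smooth A \<eta>" "closed C" "C \<subseteq> U \<inter> UNIV" "\<And>q. q \<notin> C \<Longrightarrow> \<eta> q = 0" "\<eta> p > 0"
    using bump[OF U open_UNIV UNIV_I] by metis
  define X where "X k q = complex_of_real (\<eta> q * \<phi> q $ k)" for k q
  have U': "open U" by (rule chart_homeo(1)[OF U(1)])
  have X: "mfd_smooth A (X k)" for k
    unfolding X_def using \<eta>(3) by (intro sm_intros sm_extend[OF \<eta>(1) U' msm_coordinate[OF U(1)] \<eta>(2) _ \<eta>(4)]) auto
  have c\<eta>: "mfd_smooth A (cf \<eta>)" by (intro sm_intros \<eta>)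
  \<comment> \<open>Coefficients of \<open>Z\<close> near \<open>p\<close>, obtained by solving the
    Leibniz rule for the product of the cut-off with the k-th coordinate. The coefficients from
    \<open>chart_coefficients\<close> are chosen point by point and carry no smoothness.\<close>
  define \<zeta> where "\<zeta> k q = (Z q (X k) - of_real (\<phi> q $ k) * Z q (cf \<eta>)) * inverse (of_real (\<eta> q))" for k q
  define V where "V = {q \<in> U. \<eta> q \<noteq> 0}"
  have "open (\<eta> -` (- {0}))" using sm_continuous[OF \<eta>(1)] by (intro open_vimage) auto
  then have V: "open V" unfolding V_def using U' by (auto intro!: open_Int simp: vimage_def Collect_conj_eq)
  have VU: "V \<subseteq> U" "p \<in> V" unfolding V_def using U(2) \<eta>(5) by auto
  have exp: "Z q g = (\<Sum>k\<in>UNIV. \<zeta> k q * pder k (g \<circ> inv_into U \<phi>) (\<phi> q))" if q: "q \<in> V" and g: "mfd_smooth A g" for q g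
  proof -
    have qU: "q \<in> U" "\<phi> q \<in> \<phi> ` U" using q VU by auto
    obtain \<xi> :: "complex^'m" where \<xi>: "\<And>g. mfd_smooth A g \<Longrightarrow> Z q g = (\<Sum>k\<in>UNIV. \<xi> $ k * pder k (g \<circ> inv_into U \<phi>) (\<phi> q))"
      using chart_coefficients[OF span U(1) qU(1) Z(1)] by metis
    have pd: "pder j (X k \<circ> inv_into U \<phi>) (\<phi> q) = of_real (\<phi> q $ k) * of_real (pder j (\<eta> \<circ> inv_into U \<phi>) (\<phi> q)) + of_real (\<eta> q) * (if j = k then 1 else 0)" for j k
    proof -
      have "pder j (X k \<circ> inv_into U \<phi>) (\<phi> q) = pder j (\<lambda>y. complex_of_real ((\<eta> \<circ> inv_into U \<phi>) y * (y $ k))) (\<phi> q)"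
        using chart_inv(4)[OF U(1)] by (intro pder_cong[OF O _ qU(2)]) (auto simp: X_def)
      also have "\<dots> = of_real (\<eta> q * axis j 1 $ k + (\<Sum>i\<in>UNIV. (axis j 1 $ i) *\<^sub>R pder i (\<eta> \<circ> inv_into U \<phi>) (\<phi> q)) * \<phi> q $ k)"
      proof (rule pder_eqI)
        have "((\<lambda>y::real^'m. y $ k) has_derivative (\<lambda>v. v $ k)) (at (\<phi> q))"
          by (intro bounded_linear_imp_has_derivative bounded_linear_vec_nth)
        from bounded_linear.has_derivative[OF bounded_linear_of_real has_derivative_mult[OF smooth_on_has_derivative[OF sm_chart[OF \<eta>(1) U(1)] qU(2)] this]]
        show "((\<lambda>y. complex_of_real ((\<eta> \<circ> inv_into U \<phi>) y * (y $ k))) has_derivative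
           (\<lambda>v. complex_of_real (\<eta> q * v $ k + (\<Sum>i\<in>UNIV. (v $ i) *\<^sub>R pder i (\<eta> \<circ> inv_into U \<phi>) (\<phi> q)) * \<phi> q $ k))) (at (\<phi> q))"
          using chart_inv(3)[OF U(1) qU(1)] by simp
      qed
      also have "\<dots> = of_real (\<phi> q $ k) * of_real (pder j (\<eta> \<circ> inv_into U \<phi>) (\<phi> q)) + of_real (\<eta> q) * (if j = k then 1 else 0)"
        by (auto simp: axis_def if_distrib[of "\<lambda>c. c *\<^sub>R _"] if_distrib[of "\<lambda>c. c * _"] cong: if_cong)
      finally show ?thesis .
    qed
    have "\<zeta> k q = \<xi> $ k" for k
    proof -
      have "Z q (X k) = of_real (\<phi> q $ k) * Z q (cf \<eta>) + of_real (\<eta> q) * \<xi> $ k"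
        unfolding \<xi>[OF X] \<xi>[OF c\<eta>] pd pder_of_real[OF U(1) qU(1) \<eta>(1)]
        by (simp add: distrib_left sum.distrib sum_distrib_left mult_ac if_distrib[of "\<lambda>c. _ * c"] cong: if_cong)
      then show ?thesis using q unfolding V_def \<zeta>_def by simp
    qed
    then show ?thesis using \<xi>[OF g] by simp
  qed
  have \<zeta>s: "mfd_smooth_on A V (\<zeta> k)" for k
    unfolding \<zeta>_def
    by (intro msm_mult V msm_diff msm_inverse msm_of_real msm_subset[OF Z(2)[OF X]] msm_subset[OF Z(2)[OF c\<eta>]]
       msm_subset[OF \<eta>(1)] msm_subset[OF msm_coordinate[OF U(1)]]) (auto simp: V_def)
  define W where "W q = vconj (Z q) (cf h)" for q
  have Wc: "W q = cnj (Z q (cf h))" for q by (simp add: W_def vconj_def)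
  have Ws: "mfd_smooth A W" unfolding Wc[abs_def] by (intro sm_intros Z ch)
  have OV: "open (\<phi> ` V)" using chart_image_open[OF U(1) V] VU(1) by (simp add: Int_absorb1)
  have pV: "\<phi> p \<in> \<phi> ` V" using VU by blast
  define c where "c k y = cnj (\<zeta> k (inv_into U \<phi> y))" for k y
  have cs: "smooth_on (\<phi> ` V) (c k)" for k
  proof -
    have "U \<inter> V = V" using VU by blast
    then show ?thesis using msmD[OF msm_cnj[OF V \<zeta>s] U(1)] unfolding c_def by simp
  qed
  have Wy: "(W \<circ> inv_into U \<phi>) y = (\<Sum>k\<in>UNIV. c k y * of_real (pder k h' y))" if y: "y \<in> \<phi> ` V" for y
  proof -
    have yV: "inv_into U \<phi> y \<in> V" "\<phi> (inv_into U \<phi> y) = y" using y VU chart_inv(3)[OF U(1)] by auto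
    show ?thesis
      using exp[OF yV(1) ch] pder_of_real[OF U(1) _ h, of "inv_into U \<phi> y"] yV VU(1)
      by (auto simp: Wc c_def h'_def cnj_sum)
  qed
  \<comment> \<open>The term in which \<open>c k\<close> is differentiated carries the factor
    \<open>pder k h'\<close>, which is zero at the maximum.\<close>
  have pW: "pder j (W \<circ> inv_into U \<phi>) (\<phi> p) = (\<Sum>k\<in>UNIV. cnj (\<zeta> k p) * of_real (pder j (pder k h') (\<phi> p)))" for j
  proof -
    have hk: "smooth_on (\<phi> ` V) (pder k h')" for k using smooth_on_subset[OF smooth_on_pder[OF hs]] VU by blast
    have "((\<lambda>y. \<Sum>k\<in>UNIV. c k y * of_real (pder k h' y)) has_derivative
       (\<lambda>v. \<Sum>k\<in>UNIV. c k (\<phi> p) * of_real (\<Sum>i\<in>UNIV. (v $ i) *\<^sub>R pder i (pder k h') (\<phi> p)) + (\<Sum>i\<in>UNIV. (v $ i) *\<^sub>R pder i (c k) (\<phi> p)) * of_real (pder k h' (\<phi> p)))) (at (\<phi> p))"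
      by (intro has_derivative_sum has_derivative_mult bounded_linear.has_derivative[OF bounded_linear_of_real]
         smooth_on_has_derivative[OF cs pV] smooth_on_has_derivative[OF hk pV])
    from pder_eqI[OF this, where i = j]
    have "pder j (\<lambda>y. \<Sum>k\<in>UNIV. c k y * of_real (pder k h' y)) (\<phi> p) = (\<Sum>k\<in>UNIV. cnj (\<zeta> k p) * of_real (pder j (pder k h') (\<phi> p)))"
      using chart_inv(3)[OF U] by (simp add: hz c_def axis_def if_distrib[of "\<lambda>c. c *\<^sub>R _"] if_distrib[of "\<lambda>c. c * _"] cong: if_cong)
    moreover have "pder j (W \<circ> inv_into U \<phi>) (\<phi> p) = pder j (\<lambda>y. \<Sum>k\<in>UNIV. c k y * of_real (pder k h' y)) (\<phi> p)"
      by (rule pder_cong[OF OV _ pV]) (rule Wy)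
    ultimately show ?thesis by simp
  qed
  define a where "a = (\<chi> k. Re (\<zeta> k p))"
  define b where "b = (\<chi> k. Im (\<zeta> k p))"
  have ZW: "Z p W = (\<Sum>j\<in>UNIV. \<Sum>k\<in>UNIV. \<zeta> j p * cnj (\<zeta> k p) * of_real (pder j (pder k h') (\<phi> p)))"
    unfolding exp[OF VU(2) Ws] pW by (simp add: sum_distrib_left mult.assoc)
  have "Re (Z p W) = (\<Sum>j\<in>UNIV. \<Sum>k\<in>UNIV. (a $ k * a $ j + b $ k * b $ j) * pder j (pder k h') (\<phi> p))"
    unfolding ZW by (simp add: a_def b_def algebra_simps)
  also have "\<dots> = (\<Sum>k\<in>UNIV. \<Sum>j\<in>UNIV. a $ k * a $ j * pder j (pder k h') (\<phi> p)) + (\<Sum>k\<in>UNIV. \<Sum>j\<in>UNIV. b $ k * b $ j * pder j (pder k h') (\<phi> p))"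
    by (subst sum.swap) (simp add: sum.distrib distrib_right)
  also have "\<dots> \<le> 0" using mp(2)[of a] mp(2)[of b] by simp
  finally have neg: "Re (Z p W) \<le> 0" .
  have "vconj (Z p) (\<lambda>q. Z q (cf h)) = cnj (Z p W)"
    by (simp add: vconj_def[of "Z p"] Wc[abs_def])
  then have "Z p (\<lambda>q. vconj (Z q) (cf h)) + vconj (Z p) (\<lambda>q. Z q (cf h)) = - complex_of_real (- 2 * Re (Z p W))"
    by (simp add: W_def[abs_def, symmetric] complex_eq_iff)
  then show "\<exists>r\<ge>0. Z p (\<lambda>q. vconj (Z q) (cf h)) + vconj (Z p) (\<lambda>q. Z q (cf h)) = - complex_of_real r"
    using neg by (intro exI[of _ "- 2 * Re (Z p W)"]) auto
qed

end

context cr_mfd begin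

text \<open>By the maximum principle the Levi forms of two deformations agree in sign at a maximum of the
  difference of their potentials.\<close>
lemma psc_good:
  assumes f: "tinv f" and sp: "strictly_pseudoconvex A (deform L T f)" and g: "good g"
  shows "good f"
proof -
  obtain u :: "'a \<Rightarrow> real" where u: "continuous_on UNIV u" "\<And>p. u p \<noteq> 0" "real_one_form A (nf f)"
    "\<And>Z p. smooth_section A UNIV L Z \<Longrightarrow> Z p \<noteq> vzero \<Longrightarrow> \<exists>r>0. 1 / (2 * \<i>) * (of_real (u p) * lev f Z p) = complex_of_real r"
    using psc_imp[OF f sp] by metis
  have gt: "tinv g" using g unfolding good_def by blast
  define h where "h x = 1 * f x + (-1) * g x" for x
  have h: "tinv h" unfolding h_def by (intro tinv_comb f gt)
  obtain p where p: "\<And>q. h q \<le> h p"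
    using continuous_attains_sup[OF comp _ sm_continuous[OF tinvD(1)[OF h]]] by auto
  obtain Z where Z: "smooth_section A UNIV L Z" "Z p \<noteq> vzero" using sec by blast
  note Zc = L_sec[OF Z(1)]
  have mp: "v \<in> ctangent A p \<Longrightarrow> v (cf h) = 0"
    "\<exists>r\<ge>0. Z p (\<lambda>q. vconj (Z q) (cf h)) + vconj (Z p) (\<lambda>q. Z q (cf h)) = - complex_of_real r" for v
    by (rule manifold_max_point[OF span tinvD(1)[OF h] p], (rule secD[OF Zc] | assumption)+)+
  obtain r where r: "r \<ge> 0" "Z p (\<lambda>q. vconj (Z q) (cf h)) + vconj (Z p) (\<lambda>q. Z q (cf h)) = - complex_of_real r"
    using mp(2) by auto
  obtain l m b where lm: "l \<in> L p" "m \<in> L p" and br: "conj_bracket Z p = tcomb p l m b"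
    using tcomb_exists[OF conj_bracket_ctangent[OF Zc]] by metis
  have "hess (cf h) Z p = - complex_of_real r"
    unfolding hess_def br dec_tcomb[OF lm] using r(2) mp(1)[OF L_sub[OF lm(1)]] mp(1)[OF vconj_ctangent[OF L_sub[OF lm(2)]]] by simp
  moreover have "hess (cf h) Z p = hess (cf f) Z p - hess (cf g) Z p"
    using hess_comb[OF f gt Z(1), of 1 "-1" p] unfolding h_def[abs_def] by simp
  ultimately have hf: "hess (cf f) Z p = hess (cf g) Z p - of_real r" by (simp add: algebra_simps)
  \<comment> \<open>In the affine formula the Hessian has the factor -1/2, so a smaller Hessian
    means a larger Levi form.\<close>
  have "1 / (2 * \<i>) * lev f Z p = 1 / (2 * \<i>) * lev g Z p + of_real (r / 2)"
    unfolding lev_affine[OF Z(1) f] lev_affine[OF Z(1) gt] hf by (simp add: field_simps)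
  moreover obtain s where "s > 0" "1 / (2 * \<i>) * lev g Z p = complex_of_real s"
    using g Z unfolding good_def levi_pos_def by blast
  ultimately have s: "1 / (2 * \<i>) * lev f Z p = complex_of_real (s + r / 2)" "s + r / 2 > 0" using r(1) by auto
  obtain t where t: "t > 0" "1 / (2 * \<i>) * (of_real (u p) * lev f Z p) = complex_of_real t" using u(4)[OF Z] by blast
  have "1 / (2 * \<i>) * (of_real (u p) * lev f Z p) = of_real (u p) * (1 / (2 * \<i>) * lev f Z p)" by simp
  then have "complex_of_real t = of_real (u p * (s + r / 2))" unfolding t(2) s(1) by simp
  then have "t = u p * (s + r / 2)" by (simp only: of_real_eq_iff)
  then have up: "u p > 0" using t(1) s(2) by (metis zero_less_mult_pos2)
  \<comment> \<open>\<open>u\<close> has no zero and the manifold is connected, so the sign found at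
    the maximum is global.\<close>
  have pos: "u q > 0" for q
  proof (rule ccontr)
    assume "\<not> u q > 0"
    then have "0 \<in> u ` UNIV"
      using connectedD_interval[OF connected_continuous_image[OF u(1) conn], of "u q" "u p" 0] up by simp
    then obtain x where "0 = u x" by (rule imageE)
    then show False using u(2)[of x] by simp
  qed
  have "levi_pos f"
    unfolding levi_pos_def
  proof (intro allI impI, elim conjE)
    fix Z q assume "smooth_section A UNIV L Z" "Z q \<noteq> vzero"
    then obtain t where t: "t > 0" "1 / (2 * \<i>) * (of_real (u q) * lev f Z q) = complex_of_real t" using u(4) by blast
    have "of_real (u q) * (1 / (2 * \<i>) * lev f Z q) = complex_of_real t" unfolding t(2)[symmetric] by (rule mult.left_commute)
    then have "1 / (2 * \<i>) * lev f Z q = complex_of_real (t / u q)"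
      using u(2)[of q] by (simp add: field_simps)
    then show "\<exists>r>0. 1 / (2 * \<i>) * lev f Z q = complex_of_real r" using t(1) pos[of q] by (intro exI[of _ "t / u q"]) auto
  qed
  then show ?thesis unfolding good_def using f u(3) by blast
qed

subsection \<open>Deformed and Sasakian structures\<close>

text \<open>The second deformation sees only the value of a vector on \<open>g\<close>, which adding
  a multiple of \<open>T\<close> does not change. This permits moving the origin of the potentials
  to \<open>\<phi>0\<close>.\<close>

lemma deform_deform:
  assumes f: "tinv f" and g: "tinv g"
  shows "deform (deform L T f) T g = deform L T (\<lambda>x. f x + g x)"
proof -
  have "ldef T g p (ldef T f p v) = ldef T (\<lambda>x. f x + g x) p v" if v: "v \<in> L p" for p v
    using tinvD(3)[OF g] tinv_comb(2)[OF f g L_sub[OF v], of 1 1] by (simp add: ldef_def vdefs algebra_simps)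
  then have "deform (deform L T f) T g p = deform L T (\<lambda>x. f x + g x) p" for p
    unfolding deform_eq image_image by (intro image_cong) auto
  then show ?thesis by blast
qed

text \<open>The delicate point is that \<open>T\<close> remains CR: its bracket with a deformed
  section is the deformation of the bracket, because [T, Z] f = T (Z f).\<close>

lemma deform_cr:
  assumes f: "tinv f" shows "cr_mfd A (deform L T f) T"
proof unfold_locales
  show "connected (UNIV :: 'a set)" by (rule conn)
  show "compact (UNIV :: 'a set)" by (rule comp)
  show "spanned" by (rule span)
  show "smooth_section A UNIV (rtangent A) T" by (rule T_sec)
  fix p v
  show "v \<in> ctangent A p" if "v \<in> deform L T f p"
    using that ldef_ctangent unfolding deform_eq by blast
  show "vadd v w \<in> deform L T f p" if "v \<in> deform L T f p" "w \<in> deform L T f p" for w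
    using that unfolding deform_eq by (auto simp: ldef_add[symmetric] intro!: L_add)
  show "vscale c v \<in> deform L T f p" if "v \<in> deform L T f p" for c
    using that unfolding deform_eq by (auto simp: ldef_scale[symmetric] intro!: L_scale)
  show "\<exists>Z. smooth_section A UNIV (deform L T f) Z \<and> Z p \<noteq> vzero"
  proof -
    obtain Z where Z: "smooth_section A UNIV L Z" "Z p \<noteq> vzero" using sec by blast
    have "ldef T f p (Z p) \<noteq> vzero" using ldef_eq_zero[OF secD(1)[OF Z(1)]] Z(2) by blast
    then show ?thesis using ldef_section[OF Z(1) f] by blast
  qed
next
  have comb: "vadd (vadd (ldef T f p l) (vconj (ldef T f p m))) (vscale c (T p)) = tcomb p l m (c - \<i> * l (cf f) + \<i> * cnj (m (cf f)))" for p l m c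
    unfolding vconj_ldef_tcomb ldef_tcomb tcomb_add by (simp add: tcomb_def vdefs vconj_def T_cnj algebra_simps)
  show "transversal A (deform L T f) T"
    unfolding transversal_def
  proof (intro allI bij_betw_imageI inj_onI equalityI subsetI)
    fix p and x y :: "'a cvec \<times> 'a cvec \<times> complex"
    assume "x \<in> deform L T f p \<times> vconj ` deform L T f p \<times> UNIV" "y \<in> deform L T f p \<times> vconj ` deform L T f p \<times> UNIV"
    then obtain l m c l' m' c' where *: "l \<in> L p" "m \<in> L p" "l' \<in> L p" "m' \<in> L p"
      "x = (ldef T f p l, vconj (ldef T f p m), c)" "y = (ldef T f p l', vconj (ldef T f p m'), c')"
      unfolding deform_eq by auto
    assume "(case x of (v, w, c) \<Rightarrow> vadd (vadd v w) (vscale c (T p))) = (case y of (v, w, c) \<Rightarrow> vadd (vadd v w) (vscale c (T p)))"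
    then have "tcomb p l m (c - \<i> * l (cf f) + \<i> * cnj (m (cf f))) = tcomb p l' m' (c' - \<i> * l' (cf f) + \<i> * cnj (m' (cf f)))"
      unfolding * by (simp add: comb)
    from tcomb_unique[OF *(1-4) this] show "x = y" unfolding * by simp
  next
    fix p v assume "v \<in> (\<lambda>(v, w, c). vadd (vadd v w) (vscale c (T p))) ` (deform L T f p \<times> vconj ` deform L T f p \<times> UNIV)"
    then show "v \<in> ctangent A p"
      using ldef_ctangent unfolding deform_eq by (auto intro!: vadd_ctangent vscale_ctangent vconj_ctangent T_tan)
  next
    fix p v assume "v \<in> ctangent A p"
    then obtain l m c where lm: "l \<in> L p" "m \<in> L p" "v = tcomb p l m c" using tcomb_exists by metis
    have "v = vadd (vadd (ldef T f p l) (vconj (ldef T f p m))) (vscale (c + \<i> * l (cf f) - \<i> * cnj (m (cf f))) (T p))"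
      unfolding comb lm(3) by simp
    then show "v \<in> (\<lambda>(v, w, c). vadd (vadd v w) (vscale c (T p))) ` (deform L T f p \<times> vconj ` deform L T f p \<times> UNIV)"
      unfolding deform_eq using lm(1,2) by (intro image_eqI[of _ _ "(ldef T f p l, vconj (ldef T f p m), _)"]) auto
  qed
  show "cr_vector_field A (deform L T f) T"
    unfolding cr_vector_field_def
  proof (intro allI impI)
    fix W assume W: "smooth_section A UNIV (deform L T f) W"
    obtain Z where Z: "smooth_section A UNIV L Z" "\<And>q. W q = ldef T f q (Z q)" using deform_section[OF W f] by metis
    note z = secD(1)[OF L_sec[OF Z(1)]]
    have "lie_bracket T W p = ldef T f p (lie_bracket T Z p)" for p
    proof (rule ctangent_eqI)
      have "smooth_section A UNIV (ctangent A) W" using ldef_section'[OF Z(1) f] unfolding Z(2)[symmetric] .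
      then show "lie_bracket T W p \<in> ctangent A p" by (rule lie_ctangent[OF T_sec'])
      show "ldef T f p (lie_bracket T Z p) \<in> ctangent A p" by (intro ldef_ctangent secD(1)[OF cr_section[OF Z(1)]])
      fix g :: "'a \<Rightarrow> complex" assume g: "mfd_smooth A g"
      define a where "a q = - \<i> * Z q (cf f)" for q
      have as: "mfd_smooth A a" unfolding a_def by (intro sm_intros secD(2)[OF Z(1)] tinvD f)
      have Wg: "W q x = Z q x + a q * T q x" for q x unfolding Z(2) ldef_def vdefs a_def by simp
      have ta: "T p (\<lambda>q. Z q (cf f)) = \<i> * T p a"
        unfolding a_def[abs_def] using ctangentD(3)[OF T_tan secD(2)[OF Z(1) tinvD(2)[OF f]], of p "-\<i>"] by simp
      have "lie_bracket T W p g = T p (\<lambda>q. Z q g + a q * T q g) - (Z p (\<lambda>q. T q g) + a p * T p (\<lambda>q. T q g))"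
        unfolding lie_bracket_def Wg ..
      also have "T p (\<lambda>q. Z q g + a q * T q g) = T p (\<lambda>q. Z q g) + (T p a * T p g + a p * T p (\<lambda>q. T q g))"
      proof -
        have "mfd_smooth A (\<lambda>q. a q * T q g)" by (intro sm_intros as secD(2)[OF T_sec'] g)
        then show ?thesis using ctangentD(1)[OF T_tan secD(2)[OF Z(1) g]] ctangentD(2)[OF T_tan as secD(2)[OF T_sec' g]] by simp
      qed
      finally have "lie_bracket T W p g = T p (\<lambda>q. Z q g) - Z p (\<lambda>q. T q g) + T p a * T p g" by simp
      then show "lie_bracket T W p g = ldef T f p (lie_bracket T Z p) g"
        unfolding ldef_def vdefs lie_bracket_def using tinvD(3)[OF f] by (simp add: ta ctangent_const[OF z])
    qed
    then have "lie_bracket T W = (\<lambda>q. ldef T f q (lie_bracket T Z q))" by blast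
    then show "smooth_section A UNIV (deform L T f) (lie_bracket T W)" using ldef_section[OF cr_section[OF Z(1)] f] by simp
  qed
qed

end

section \<open>From a Sasakian manifold to the setting of \<open>cr_mfd\<close>\<close>

lemma sum_lessThan_add:
  fixes f :: "nat \<Rightarrow> 'b::comm_monoid_add"
  shows "(\<Sum>i<m + k. f i) = (\<Sum>i<m. f i) + (\<Sum>i<k. f (m + i))"
  by (induction k) (auto simp: add.assoc)

text \<open>Local frames give the linear structure of \<open>L\<close>. Together with their
  conjugates and \<open>T\<close> they make 2 n + 1 spanning vectors, the number of coordinates, as
  \<open>spannedI\<close> requires. A cut-off frame vector extended by zero is the section for
  \<open>sec\<close>.\<close>

lemma sasakian_cr_mfd:
  fixes A :: "('a::{t2_space,second_countable_topology}, 'm::finite) atlas"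
  assumes s: "sasakian A n L T" and c: "compact (UNIV :: 'a set)"
  shows "cr_mfd A L T"
proof -
  have n: "n \<ge> 1" "CARD('m) = 2 * n + 1" and at: "smooth_atlas A" and conn: "connected (UNIV :: 'a set)"
    and cr: "cr_structure A n L" and T: "smooth_section A UNIV (rtangent A) T" and tr: "transversal A L T"
    and crT: "cr_vector_field A L T"
    using s unfolding sasakian_def by auto
  interpret smooth_mfd A by unfold_locales (rule at)
  have sb: "complex_subbundle A n L" using cr unfolding cr_structure_def by blast
  have frame: "\<exists>U E. open U \<and> p \<in> U \<and> (\<forall>i<n. smooth_section A U L (E i)) \<and>
        (\<forall>q\<in>U. bij_betw (\<lambda>c f. \<Sum>i<n. c i * E i q f) ({..<n} \<rightarrow>\<^sub>E UNIV) (L q))" for p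
    using sb unfolding complex_subbundle_def by blast
  have Lsub: "v \<in> ctangent A p" if "v \<in> L p" for v p using that sb unfolding complex_subbundle_def by blast
  have img: "\<exists>e. (\<forall>i<n. e i \<in> L p) \<and> (\<forall>v. v \<in> L p \<longleftrightarrow> (\<exists>c. v = (\<lambda>f. \<Sum>i<n. c i * e i f)))" for p
  proof -
    obtain U E where U: "p \<in> U" "\<forall>i<n. smooth_section A U L (E i)"
      "\<forall>q\<in>U. bij_betw (\<lambda>c f. \<Sum>i<n. c i * E i q f) ({..<n} \<rightarrow>\<^sub>E UNIV) (L q)" using frame[of p] by blast
    have im: "L p = (\<lambda>c f. \<Sum>i<n. c i * E i p f) ` ({..<n} \<rightarrow>\<^sub>E UNIV)" using U(1,3) unfolding bij_betw_def by blast
    have "v \<in> L p \<longleftrightarrow> (\<exists>c. v = (\<lambda>f. \<Sum>i<n. c i * E i p f))" for v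
    proof
      assume "v \<in> L p" then show "\<exists>c. v = (\<lambda>f. \<Sum>i<n. c i * E i p f)" unfolding im by blast
    next
      assume "\<exists>c. v = (\<lambda>f. \<Sum>i<n. c i * E i p f)"
      then obtain c where "v = (\<lambda>f. \<Sum>i<n. c i * E i p f)" by blast
      \<comment> \<open>The coefficient space consists of extensional functions, hence the
        restriction.\<close>
      then show "v \<in> L p" unfolding im by (intro image_eqI[of _ _ "restrict c {..<n}"]) auto
    qed
    moreover have "\<forall>i<n. E i p \<in> L p" using U(1,2) unfolding smooth_section_def by blast
    ultimately show ?thesis by (intro exI[of _ "\<lambda>i. E i p"]) blast
  qed
  have Ladd: "vadd v w \<in> L p" if vw: "v \<in> L p" "w \<in> L p" for v w p
  proof -
    obtain e where e: "\<forall>v. v \<in> L p \<longleftrightarrow> (\<exists>c. v = (\<lambda>f. \<Sum>i<n. c i * e i f))" using img[of p] by blast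
    obtain c1 where "v = (\<lambda>f. \<Sum>i<n. c1 i * e i f)" using iffD1[OF spec[OF e] vw(1)] by blast
    moreover obtain c2 where "w = (\<lambda>f. \<Sum>i<n. c2 i * e i f)" using iffD1[OF spec[OF e] vw(2)] by blast
    ultimately have "vadd v w = (\<lambda>f. \<Sum>i<n. (c1 i + c2 i) * e i f)" by (simp add: vdefs sum.distrib distrib_right)
    then show ?thesis unfolding spec[OF e] by (intro exI[of _ "\<lambda>i. c1 i + c2 i"])
  qed
  have Lscale: "vscale c v \<in> L p" if vw: "v \<in> L p" for v c p
  proof -
    obtain e where e: "\<forall>v. v \<in> L p \<longleftrightarrow> (\<exists>c. v = (\<lambda>f. \<Sum>i<n. c i * e i f))" using img[of p] by blast
    obtain c1 where "v = (\<lambda>f. \<Sum>i<n. c1 i * e i f)" using iffD1[OF spec[OF e] vw] by blast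
    then have "vscale c v = (\<lambda>f. \<Sum>i<n. (c * c1 i) * e i f)" by (simp add: vdefs sum_distrib_left mult.assoc)
    then show ?thesis unfolding spec[OF e] by (intro exI[of _ "\<lambda>i. c * c1 i"])
  qed
  have Tt: "T p \<in> ctangent A p" for p using T unfolding smooth_section_def rtangent_def by auto
  have "spanned"
  proof (rule spannedI)
    fix p
    obtain e where e: "\<And>i. i < n \<Longrightarrow> e i \<in> L p" "\<And>v. v \<in> L p \<longleftrightarrow> (\<exists>c. v = (\<lambda>f. \<Sum>i<n. c i * e i f))" using img[of p] by auto
    obtain ix :: "nat \<Rightarrow> 'm" where ix: "bij_betw ix {..<2 * n + 1} UNIV"
      using ex_bij_betw_nat_finite[of "UNIV :: 'm set"] n(2) by (auto simp: lessThan_atLeast0)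
    \<comment> \<open>Frame, conjugate frame and \<open>T p\<close> in one list of length 2 n + 1,
      transported to the index type by \<open>ix\<close>.\<close>
    define B0 where "B0 i = (if i < n then e i else if i < 2 * n then vconj (e (i - n)) else T p)" for i
    define B where "B k = B0 (inv_into {..<2 * n + 1} ix k)" for k
    have Bix: "B (ix i) = B0 i" if "i < 2 * n + 1" for i
      unfolding B_def using ix that by (simp add: bij_betw_def inv_into_f_f)
    have sumB: "(\<Sum>k\<in>UNIV. c $ k * B k f) = (\<Sum>i<n. c $ ix i * e i f) + (\<Sum>i<n. c $ ix (n + i) * vconj (e i) f) + c $ ix (2 * n) * T p f" for c :: "complex^'m" and f
    proof -
      have "(\<Sum>k\<in>UNIV. c $ k * B k f) = (\<Sum>i<2 * n + 1. c $ ix i * B0 i f)"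
        using sum.reindex_bij_betw[OF ix, of "\<lambda>k. c $ k * B k f"] by (simp add: Bix cong: sum.cong_simp)
      also have "\<dots> = (\<Sum>i<2 * n. c $ ix i * B0 i f) + c $ ix (2 * n) * T p f" by (simp add: B0_def)
      also have "(\<Sum>i<2 * n. c $ ix i * B0 i f) = (\<Sum>i<n. c $ ix i * B0 i f) + (\<Sum>i<n. c $ ix (n + i) * B0 (n + i) f)"
        unfolding mult_2 by (rule sum_lessThan_add)
      also have "(\<Sum>i<n. c $ ix i * B0 i f) = (\<Sum>i<n. c $ ix i * e i f)" by (intro sum.cong) (auto simp: B0_def)
      also have "(\<Sum>i<n. c $ ix (n + i) * B0 (n + i) f) = (\<Sum>i<n. c $ ix (n + i) * vconj (e i) f)" by (intro sum.cong) (auto simp: B0_def)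
      finally show ?thesis .
    qed
    have vc: "vconj (\<lambda>f. \<Sum>i<n. c i * e i f) = (\<lambda>f. \<Sum>i<n. cnj (c i) * vconj (e i) f)" for c
      by (simp add: vconj_def cnj_sum)
    have rng: "ctangent A p = (\<lambda>(v, w, c). vadd (vadd v w) (vscale c (T p))) ` (L p \<times> vconj ` L p \<times> UNIV)"
      using tr unfolding transversal_def bij_betw_def by metis
    have "ctangent A p = range (\<lambda>(c::complex^'m) f. \<Sum>k\<in>UNIV. c $ k * B k f)"
    proof (intro equalityI subsetI)
      fix v assume "v \<in> ctangent A p"
      then obtain l m c where lm: "l \<in> L p" "m \<in> L p" "v = vadd (vadd l (vconj m)) (vscale c (T p))" unfolding rng by auto
      obtain c1 where c1: "l = (\<lambda>f. \<Sum>i<n. c1 i * e i f)" using iffD1[OF e(2) lm(1)] by blast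
      obtain c2 where c2: "m = (\<lambda>f. \<Sum>i<n. c2 i * e i f)" using iffD1[OF e(2) lm(2)] by blast
      define c' :: "complex^'m" where "c' = (\<chi> k. let i = inv_into {..<2 * n + 1} ix k in if i < n then c1 i else if i < 2 * n then cnj (c2 (i - n)) else c)"
      have ci: "c' $ ix i = (if i < n then c1 i else if i < 2 * n then cnj (c2 (i - n)) else c)" if "i < 2 * n + 1" for i
        unfolding c'_def using ix that by (simp add: bij_betw_def inv_into_f_f)
      have "v = (\<lambda>f. \<Sum>k\<in>UNIV. c' $ k * B k f)"
        unfolding sumB lm(3) c1 c2 vc vdefs using n(1) by (auto simp: ci intro!: ext sum.cong)
      then show "v \<in> range (\<lambda>(c::complex^'m) f. \<Sum>k\<in>UNIV. c $ k * B k f)" by blast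
    next
      fix v assume "v \<in> range (\<lambda>(c::complex^'m) f. \<Sum>k\<in>UNIV. c $ k * B k f)"
      then obtain c :: "complex^'m" where c: "v = (\<lambda>f. \<Sum>k\<in>UNIV. c $ k * B k f)" by blast
      define l where "l = (\<lambda>f. \<Sum>i<n. c $ ix i * e i f)"
      define m where "m = (\<lambda>f. \<Sum>i<n. cnj (c $ ix (n + i)) * e i f)"
      have "l \<in> L p" "m \<in> L p" unfolding l_def m_def e(2) by (rule exI, rule refl)+
      moreover have "v = vadd (vadd l (vconj m)) (vscale (c $ ix (2 * n)) (T p))"
        unfolding c sumB l_def m_def vc vdefs by simp
      ultimately show "v \<in> ctangent A p" using Tt by (simp add: vadd_ctangent vscale_ctangent vconj_ctangent Lsub)
    qed
    then show "\<exists>B :: 'm \<Rightarrow> 'a cvec. ctangent A p = range (\<lambda>(c::complex^'m) f. \<Sum>k\<in>UNIV. c $ k * B k f)" by blast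
  qed
  moreover have "\<exists>Z. smooth_section A UNIV L Z \<and> Z p \<noteq> vzero" for p
  proof -
    obtain W E where W: "open W" "p \<in> W" "\<forall>i<n. smooth_section A W L (E i)"
      "\<forall>q\<in>W. bij_betw (\<lambda>c f. \<Sum>i<n. c i * E i q f) ({..<n} \<rightarrow>\<^sub>E UNIV) (L q)" using frame[of p] by blast
    obtain U \<phi> where U: "(U, \<phi>) \<in> A" "p \<in> U" by (rule chart_cover)
    obtain \<eta> :: "'a \<Rightarrow> real" and C where \<eta>: "mfd_smooth A \<eta>" "closed C" "C \<subseteq> U \<inter> W" "\<And>q. q \<notin> C \<Longrightarrow> \<eta> q = 0" "\<eta> p > 0"
      using bump[OF U W(1,2)] by metis
    have c\<eta>: "mfd_smooth A (cf \<eta>)" by (intro sm_intros \<eta>)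
    have E0: "smooth_section A W L (E 0)" using W(3) n(1) by auto
    define Z where "Z q = (if q \<in> W then vscale (\<eta> q) (E 0 q) else vzero)" for q
    have zero: "vzero \<in> L q" for q
    proof -
      obtain e where e: "\<forall>i<n. e i \<in> L q" using img[of q] by blast
      have "vscale 0 (e 0) \<in> L q" using Lscale e n(1) by auto
      then show ?thesis by (simp add: vdefs)
    qed
    have "smooth_section A UNIV L Z"
      unfolding smooth_section_def
    proof (intro conjI ballI allI impI)
      show "Z q \<in> L q" for q using E0 zero Lscale unfolding Z_def smooth_section_def by auto
      fix g :: "'a \<Rightarrow> complex" assume g: "mfd_smooth A g"
      have "mfd_smooth_on A W (\<lambda>q. E 0 q g)" using E0 g unfolding smooth_section_def by blast
      from sm_extend[OF c\<eta> W(1) this \<eta>(2)] have "mfd_smooth A (\<lambda>q. of_real (\<eta> q) * E 0 q g)" using \<eta>(3,4) by auto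
      moreover have "(\<lambda>q. Z q g) = (\<lambda>q. of_real (\<eta> q) * E 0 q g)"
        using \<eta>(3,4) by (auto simp: Z_def vdefs fun_eq_iff)
      ultimately show "mfd_smooth A (\<lambda>q. Z q g)" by simp
    qed
    moreover have "Z p \<noteq> vzero"
    proof
      assume "Z p = vzero"
      then have z: "E 0 p f = 0" for f using W(2) \<eta>(5) by (auto simp: Z_def vdefs fun_eq_iff)
      have inj: "inj_on (\<lambda>c f. \<Sum>i<n. c i * E i p f) ({..<n} \<rightarrow>\<^sub>E UNIV)" using W(2,4) unfolding bij_betw_def by blast
      \<comment> \<open>If \<open>E 0 p\<close> were zero, these two different coefficient vectors
        would give the same tangent vector.\<close>
      define c1 :: "nat \<Rightarrow> complex" where "c1 = restrict (\<lambda>i. if i = 0 then 1 else 0) {..<n}"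
      define c0 :: "nat \<Rightarrow> complex" where "c0 = restrict (\<lambda>i. 0) {..<n}"
      have "(\<lambda>f. \<Sum>i<n. c1 i * E i p f) = (\<lambda>f. \<Sum>i<n. c0 i * E i p f)"
        by (intro ext sum.cong) (auto simp: c1_def c0_def z)
      then have "c1 = c0" using inj_onD[OF inj, of c1 c0] by (auto simp: c1_def c0_def)
      then have "c1 0 = c0 0" by simp
      then show False using n(1) by (simp add: c1_def c0_def)
    qed
    ultimately show ?thesis by blast
  qed
  ultimately show ?thesis
    using conn c Lsub Ladd Lscale T tr crT by unfold_locales blast+
qed

section \<open>Hessians of sums, and CR functions under deformation\<close>

lemma flat_shift_derivative:
  "((\<lambda>s. flat n (s - c)) has_real_derivative flat (n + 2) (s - c) - real n * flat (n + 1) (s - c)) (at s)"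
proof -
  have "((\<lambda>s. s - c) has_real_derivative 1) (at s)" by (auto intro!: derivative_eq_intros)
  from DERIV_chain2[OF flat_has_derivative this] show ?thesis by simp
qed

context cr_mfd begin

lemma nf_one_formI:
  assumes "\<And>Z. smooth_section A UNIV (ctangent A) Z \<Longrightarrow> mfd_smooth A (\<lambda>p. nf f p (Z p))"
  shows "real_one_form A (nf f)"
  unfolding real_one_form_def using nf_add nf_scale nf_conj assms by blast

lemma hess_const:
  assumes Z: "smooth_section A UNIV L Z" shows "hess (\<lambda>x. c) Z p = 0"
proof -
  note Zc = L_sec[OF Z]
  note Zb = sec_conj[OF Zc]
  obtain l m b where lm: "l \<in> L p" "m \<in> L p" and br: "conj_bracket Z p = tcomb p l m b"
    using tcomb_exists[OF conj_bracket_ctangent[OF Zc]] by metis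
  show ?thesis unfolding hess_def br dec_tcomb[OF lm] split ctangent_const[OF secD(1)[OF Zc]] ctangent_const[OF secD(1)[OF Zb]]
    ctangent_const[OF L_sub[OF lm(1)]] ctangent_const[OF vconj_ctangent[OF L_sub[OF lm(2)]]] by simp
qed

lemma hess_sum:
  assumes Z: "smooth_section A UNIV L Z" and g: "\<And>j. j \<in> I \<Longrightarrow> mfd_smooth A (g j)"
  shows "hess (\<lambda>x. \<Sum>j\<in>I. g j x) Z p = (\<Sum>j\<in>I. hess (g j) Z p)"
proof -
  note Zc = L_sec[OF Z]
  note Zb = sec_conj[OF Zc]
  obtain l m b where lm: "l \<in> L p" "m \<in> L p" and br: "conj_bracket Z p = tcomb p l m b"
    using tcomb_exists[OF conj_bracket_ctangent[OF Zc]] by metis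
  have 1: "v (\<lambda>q. W q (\<lambda>x. \<Sum>j\<in>I. g j x)) = (\<Sum>j\<in>I. v (\<lambda>q. W q (g j)))"
    if v: "v \<in> ctangent A p" and W: "smooth_section A UNIV (ctangent A) W" for v :: "'a cvec" and W :: "'a \<Rightarrow> 'a cvec"
  proof -
    have "W q (\<lambda>x. \<Sum>j\<in>I. g j x) = (\<Sum>j\<in>I. W q (g j))" for q by (rule ctangent_sum[OF secD(1)[OF W] g])
    moreover have "v (\<lambda>q. \<Sum>j\<in>I. W q (g j)) = (\<Sum>j\<in>I. v (\<lambda>q. W q (g j)))"
      by (rule ctangent_sum[OF v]) (intro secD(2)[OF W] g)
    ultimately show ?thesis by simp
  qed
  have 2: "l (\<lambda>x. \<Sum>j\<in>I. g j x) = (\<Sum>j\<in>I. l (g j))" by (rule ctangent_sum[OF L_sub[OF lm(1)] g])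
  have 3: "vconj m (\<lambda>x. \<Sum>j\<in>I. g j x) = (\<Sum>j\<in>I. vconj m (g j))"
    by (rule ctangent_sum[OF vconj_ctangent[OF L_sub[OF lm(2)]] g])
  show ?thesis unfolding hess_def br dec_tcomb[OF lm] split
    1[OF secD(1)[OF Zc] Zb] 1[OF secD(1)[OF Zb] Zc] 2 3
    by (simp add: sum.distrib sum_subtractf)
qed

text \<open>CR functions of weight \<open>\<gamma>\<close> for the flow of \<open>T\<close>. The CR
  equations are stated through the conjugate function, since vectors of \<open>L\<close> annihilate
  conjugates.\<close>

definition crf :: "real \<Rightarrow> ('a \<Rightarrow> complex) \<Rightarrow> bool" where
  "crf \<gamma> h \<longleftrightarrow> mfd_smooth A h \<and> (\<forall>p. \<forall>v\<in>L p. v (\<lambda>x. cnj (h x)) = 0) \<and> (\<forall>p. T p h = \<i> * \<gamma> * h p)"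

text \<open>For Z in \<open>L\<close> the CR equation of the deformed structure reads Z (conj g) =
  \<gamma> (Z f) (conj g), which has the integrating factor exp (- \<gamma> f). Invariance of
  \<open>f\<close> keeps the weight.\<close>

lemma crf_deform:
  assumes f: "tinv f" and g: "mfd_smooth A g" and cr: "\<And>p v. v \<in> deform L T f p \<Longrightarrow> v (\<lambda>x. cnj (g x)) = 0"
    and T: "\<And>p. T p g = \<i> * \<gamma> * g p"
  shows "crf \<gamma> (\<lambda>x. of_real (exp (- \<gamma> * f x)) * g x)"
proof -
  have fs: "mfd_smooth A f" by (rule tinvD(1)[OF f])
  have es: "mfd_smooth A (\<lambda>x. exp (- \<gamma> * f x))" by (intro sm_intros fs)
  have ec: "mfd_smooth A (cf (\<lambda>x. exp (- \<gamma> * f x)))" by (intro sm_intros fs)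
  have gc: "mfd_smooth A (\<lambda>x. cnj (g x))" by (intro sm_intros g)
  have ve: "v (cf (\<lambda>x. exp (- \<gamma> * f x))) = - \<gamma> * exp (- \<gamma> * f p) * v (cf f)" if v: "v \<in> ctangent A p" for v :: "'a cvec" and p
  proof -
    have "((\<lambda>s. exp (- \<gamma> * s)) has_real_derivative - \<gamma> * exp (- \<gamma> * f p)) (at (f p))"
      by (auto intro!: derivative_eq_intros)
    from ctangent_chain[OF span v fs es this] show ?thesis by simp
  qed
  have Tc: "T p (\<lambda>x. cnj (g x)) = - \<i> * \<gamma> * cnj (g p)" for p
    using T_cnj[of p "\<lambda>x. cnj (g x)"] T[of p] by simp
  have "v (\<lambda>x. cnj (of_real (exp (- \<gamma> * f x)) * g x)) = 0" if v: "v \<in> L p" for v p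
  proof -
    have "ldef T f p v (\<lambda>x. cnj (g x)) = 0" using cr v unfolding deform_eq by blast
    then have vg: "v (\<lambda>x. cnj (g x)) = \<gamma> * v (cf f) * cnj (g p)" unfolding ldef_def vdefs Tc by (simp add: algebra_simps)
    have "v (\<lambda>x. of_real (exp (- \<gamma> * f x)) * cnj (g x)) = 0"
      unfolding ctangentD(2)[OF L_sub[OF v] ec gc] ve[OF L_sub[OF v]] vg by simp
    then show ?thesis by simp
  qed
  moreover have "T p (\<lambda>x. of_real (exp (- \<gamma> * f x)) * g x) = \<i> * \<gamma> * (of_real (exp (- \<gamma> * f p)) * g p)" for p
    unfolding ctangentD(2)[OF T_tan ec g] ve[OF T_tan] tinvD(3)[OF f] T by simp
  ultimately show ?thesis unfolding crf_def using msm_mult[OF open_UNIV ec g] by blast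
qed

end

subsection \<open>Structures induced by a weighted sphere\<close>

text \<open>\<open>Fker\<close> condenses the embedding: a tangent vector killed by all coordinate
  functions is of type (0,1). It combines injectivity of the differential with the description of
  \<open>L\<close> by the (1,0) vectors tangent to the image.\<close>

locale cr_sphere = cr_mfd A L T
  for A :: "('a::{t2_space,second_countable_topology}, 'm::finite) atlas" and L T +
  fixes N :: nat and \<beta> :: "nat \<Rightarrow> real" and F :: "'a \<Rightarrow> nat \<Rightarrow> complex"
  assumes beta: "j < N \<Longrightarrow> \<beta> j > 0"
    and Fcrf: "j < N \<Longrightarrow> crf (\<beta> j) (\<lambda>x. F x j)"
    and Fker: "v \<in> ctangent A p \<Longrightarrow> (\<And>j. j < N \<Longrightarrow> v (\<lambda>x. F x j) = 0) \<Longrightarrow> vconj v \<in> L p"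
    and Fnorm: "(\<Sum>j<N. (cmod (F p j))\<^sup>2) = 1"
begin

lemma F_sm: "j < N \<Longrightarrow> mfd_smooth A (\<lambda>x. F x j)" "j < N \<Longrightarrow> mfd_smooth A (\<lambda>x. cnj (F x j))"
  using Fcrf unfolding crf_def by (auto intro: sm_intros)

lemma F_cr: "j < N \<Longrightarrow> v \<in> L p \<Longrightarrow> v (\<lambda>x. cnj (F x j)) = 0" "j < N \<Longrightarrow> v \<in> L p \<Longrightarrow> vconj v (\<lambda>x. F x j) = 0"
  using Fcrf unfolding crf_def vconj_def by auto

lemma F_T: "j < N \<Longrightarrow> T p (\<lambda>x. F x j) = \<i> * \<beta> j * F p j"
  "j < N \<Longrightarrow> T p (\<lambda>x. cnj (F x j)) = - \<i> * \<beta> j * cnj (F p j)"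
proof -
  show 1: "j < N \<Longrightarrow> T p (\<lambda>x. F x j) = \<i> * \<beta> j * F p j" using Fcrf unfolding crf_def by auto
  show "j < N \<Longrightarrow> T p (\<lambda>x. cnj (F x j)) = - \<i> * \<beta> j * cnj (F p j)"
    using T_cnj[of p "\<lambda>x. cnj (F x j)"] 1 by simp
qed

section \<open>Squared moduli of the coordinates and the Levi form of the sphere\<close>

definition rho :: "nat \<Rightarrow> 'a \<Rightarrow> real" where "rho j x = (cmod (F x j))\<^sup>2"

lemma rho_cf: "cf (rho j) = (\<lambda>x. F x j * cnj (F x j))"
  unfolding rho_def by (simp only: complex_norm_square)

lemma rho_Re: "rho j = (\<lambda>x. Re (F x j * cnj (F x j)))"
  unfolding rho_def by (simp only: complex_mult_cnj complex_norm cmod_power2 Re_complex_of_real)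

lemma rho_sm: "j < N \<Longrightarrow> mfd_smooth A (rho j)"
  unfolding rho_Re by (intro sm_intros F_sm)

lemma v_rho: "j < N \<Longrightarrow> v \<in> ctangent A p \<Longrightarrow> v (cf (rho j)) = v (\<lambda>x. F x j) * cnj (F p j) + F p j * v (\<lambda>x. cnj (F x j))"
  unfolding rho_cf using ctangentD(2) F_sm by blast

lemma rho_T: "j < N \<Longrightarrow> T p (cf (rho j)) = 0"
  by (simp add: v_rho[OF _ T_tan] F_T)

text \<open>\<open>B\<close> is the value of the standard contact form of the unit sphere on the
  weighted field, and \<open>P\<close> is the squared length of the pushed-forward vector. Up to a
  constant factor, P / B is the Levi form (\<open>levi0_eq\<close>).\<close>

definition B :: "'a \<Rightarrow> real" where "B p = (\<Sum>j<N. \<beta> j * rho j p)"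
definition P :: "('a \<Rightarrow> 'a cvec) \<Rightarrow> 'a \<Rightarrow> real" where "P Z p = (\<Sum>j<N. (cmod (Z p (\<lambda>x. F x j)))\<^sup>2)"

lemma rho_nonneg: "rho j p \<ge> 0" unfolding rho_def by simp

lemma rho_le: "j < N \<Longrightarrow> rho j p \<le> 1"
  using member_le_sum[of j "{..<N}" "\<lambda>j. rho j p"] Fnorm[of p] rho_nonneg unfolding rho_def by auto

lemma B_sm: "mfd_smooth A B"
  unfolding B_def[abs_def] by (intro sm_intros rho_sm) auto

lemma B_ge: "j < N \<Longrightarrow> \<beta> j * rho j p \<le> B p"
  unfolding B_def by (intro member_le_sum) (auto intro!: mult_nonneg_nonneg[OF less_imp_le[OF beta] rho_nonneg])

lemma rho_ex: "\<exists>j<N. rho j p > 0"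
proof (rule ccontr)
  assume *: "\<not> ?thesis"
  have "rho j p = 0" if "j < N" for j using * rho_nonneg[of j p] that by (metis order_le_less)
  then have "(\<Sum>j<N. rho j p) = 0" by (intro sum.neutral) auto
  then show False using Fnorm[of p] unfolding rho_def by simp
qed

lemma B_pos: "B p > 0"
proof -
  obtain j where "j < N" "rho j p > 0" using rho_ex by blast
  then show ?thesis using B_ge[of j p] beta[of j] by (smt (verit) mult_pos_pos)
qed

lemma B_le: "B p \<le> (\<Sum>j<N. \<beta> j)"
  unfolding B_def using beta rho_le[of _ p] rho_nonneg[of _ p] by (intro sum_mono) (simp add: mult_left_le less_imp_le)

text \<open>Z kills the conjugate of F_j and conj Z kills F_j. Mixed second derivatives therefore
  reduce to the bracket, and the weight enters through the \<open>T\<close> derivative of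
  F_j.\<close>

lemma hess_rho:
  assumes Z: "smooth_section A UNIV L Z" and j: "j < N"
  shows "hess (\<lambda>x. F x j * cnj (F x j)) Z p = 2 * (Z p (\<lambda>x. F x j) * cnj (Z p (\<lambda>x. F x j))) - 2 * \<i> * levi0 Z p * \<beta> j * (F p j * cnj (F p j))"
proof -
  note Zc = L_sec[OF Z]
  define W where "W q = vconj (Z q)" for q
  have W: "smooth_section A UNIV (ctangent A) W" unfolding W_def by (rule sec_conj[OF Zc])
  note z = secD(1)[OF Zc] and w = secD(1)[OF W] and zs = secD(2)[OF Zc] and ws = secD(2)[OF W]
  obtain l m b where lm: "l \<in> L p" "m \<in> L p" and br: "conj_bracket Z p = tcomb p l m b"
    using tcomb_exists[OF conj_bracket_ctangent[OF Zc]] by metis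
  note Fs = F_sm(1)[OF j] and Gs = F_sm(2)[OF j]
  have ZG: "Z q (\<lambda>x. cnj (F x j)) = 0" for q by (rule F_cr(1)[OF j secD(1)[OF Z]])
  have WF: "W q (\<lambda>x. F x j) = 0" for q unfolding W_def by (rule F_cr(2)[OF j secD(1)[OF Z]])
  have WG: "W q (\<lambda>x. cnj (F x j)) = cnj (Z q (\<lambda>x. F x j))" for q by (simp add: W_def vconj_def)
  have Zr: "Z q (\<lambda>x. F x j * cnj (F x j)) = Z q (\<lambda>x. F x j) * cnj (F q j)" for q
    unfolding ctangentD(2)[OF z Fs Gs] ZG by simp
  have Wr: "W q (\<lambda>x. F x j * cnj (F x j)) = F q j * W q (\<lambda>x. cnj (F x j))" for q
    unfolding ctangentD(2)[OF w Fs Gs] WF by simp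
  have br': "Z p (\<lambda>q. W q g) - W p (\<lambda>q. Z q g) = l g + vconj m g + b * T p g" for g
    using fun_cong[OF br, of g] by (simp add: conj_bracket_def lie_bracket_def tcomb_def vdefs W_def)
  have e1: "W p (\<lambda>q. Z q (\<lambda>x. F x j)) = - (l (\<lambda>x. F x j) + b * (\<i> * \<beta> j * F p j))"
  proof -
    have "x = - (y + t)" if "0 - x = y + 0 + t" for x y t :: complex
      using arg_cong[OF that, of uminus] by simp
    then show ?thesis using br'[of "\<lambda>x. F x j"] unfolding WF ctangent_const[OF z] F_T(1)[OF j] F_cr(2)[OF j lm(2)] by blast
  qed
  have e2: "Z p (\<lambda>q. W q (\<lambda>x. cnj (F x j))) = vconj m (\<lambda>x. cnj (F x j)) + b * (- \<i> * \<beta> j * cnj (F p j))"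
    using br'[of "\<lambda>x. cnj (F x j)"] unfolding ZG ctangent_const[OF w] F_T(2)[OF j] F_cr(1)[OF j lm(1)] by simp
  have e3: "Z p (\<lambda>q. F q j * W q (\<lambda>x. cnj (F x j))) = Z p (\<lambda>x. F x j) * W p (\<lambda>x. cnj (F x j)) + F p j * Z p (\<lambda>q. W q (\<lambda>x. cnj (F x j)))"
    by (rule ctangentD(2)[OF z Fs ws[OF Gs]])
  have e4: "W p (\<lambda>q. Z q (\<lambda>x. F x j) * cnj (F q j)) = W p (\<lambda>q. Z q (\<lambda>x. F x j)) * cnj (F p j) + Z p (\<lambda>x. F x j) * W p (\<lambda>x. cnj (F x j))"
    by (rule ctangentD(2)[OF w zs[OF Fs] Gs])
  have e5: "l (\<lambda>x. F x j * cnj (F x j)) = l (\<lambda>x. F x j) * cnj (F p j)"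
    unfolding ctangentD(2)[OF L_sub[OF lm(1)] Fs Gs] F_cr(1)[OF j lm(1)] by simp
  have e6: "vconj m (\<lambda>x. F x j * cnj (F x j)) = F p j * vconj m (\<lambda>x. cnj (F x j))"
    unfolding ctangentD(2)[OF vconj_ctangent[OF L_sub[OF lm(2)]] Fs Gs] F_cr(2)[OF j lm(2)] by simp
  have "hess (\<lambda>x. F x j * cnj (F x j)) Z p = Z p (\<lambda>q. W q (\<lambda>x. F x j * cnj (F x j))) + W p (\<lambda>q. Z q (\<lambda>x. F x j * cnj (F x j)))
     + l (\<lambda>x. F x j * cnj (F x j)) - vconj m (\<lambda>x. F x j * cnj (F x j))"
    unfolding hess_def br dec_tcomb[OF lm] W_def by simp
  also have "\<dots> = 2 * (Z p (\<lambda>x. F x j) * W p (\<lambda>x. cnj (F x j))) - 2 * \<i> * b * \<beta> j * (F p j * cnj (F p j))"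
    unfolding Zr Wr e3 e4 e5 e6 e1 e2 by (simp add: algebra_simps)
  finally show ?thesis unfolding WG levi0_def br dec_tcomb[OF lm] by simp
qed

text \<open>Sum \<open>hess_rho\<close> over j: the squared moduli add up to 1, whose Hessian is
  zero, and this determines the \<open>T\<close> component of the bracket.\<close>

lemma levi0_eq:
  assumes Z: "smooth_section A UNIV L Z"
  shows "levi0 Z p = - \<i> * of_real (P Z p / B p)"
proof -
  have "(\<lambda>x. \<Sum>j<N. F x j * cnj (F x j)) = (\<lambda>x. 1)"
    using Fnorm by (simp flip: complex_norm_square of_real_sum of_real_power)
  then have "0 = hess (\<lambda>x. \<Sum>j<N. F x j * cnj (F x j)) Z p" by (simp add: hess_const[OF Z])
  also have "\<dots> = (\<Sum>j<N. hess (\<lambda>x. F x j * cnj (F x j)) Z p)"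
    by (intro hess_sum[OF Z] sm_intros F_sm) auto
  also have "\<dots> = (\<Sum>j<N. 2 * (Z p (\<lambda>x. F x j) * cnj (Z p (\<lambda>x. F x j))) - 2 * \<i> * levi0 Z p * \<beta> j * (F p j * cnj (F p j)))"
    by (intro sum.cong hess_rho[OF Z]) auto
  also have "\<dots> = 2 * of_real (P Z p) - 2 * \<i> * levi0 Z p * of_real (B p)"
    unfolding P_def B_def rho_def of_real_sum of_real_mult of_real_power[symmetric] complex_norm_square sum_subtractf sum_distrib_left
    by (simp add: mult_ac)
  finally have "\<i> * levi0 Z p * of_real (B p) = of_real (P Z p)" by simp
  then have "- \<i> * (\<i> * levi0 Z p * of_real (B p)) = - \<i> * of_real (P Z p)" by simp
  then have "levi0 Z p * of_real (B p) = - \<i> * of_real (P Z p)" by (simp flip: mult.assoc)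
  then show ?thesis using B_pos[of p] by (simp add: field_simps)
qed

text \<open>A vector with P = 0 is killed by all coordinates, so by \<open>Fker\<close> it lies in
  \<open>L\<close> together with its conjugate; the direct sum then makes it zero.\<close>

lemma P_pos:
  assumes Z: "smooth_section A UNIV L Z" "Z p \<noteq> vzero"
  shows "P Z p > 0"
proof (rule ccontr)
  assume "\<not> P Z p > 0"
  then have "P Z p = 0" unfolding P_def by (meson antisym_conv3 not_less sum_nonneg zero_le_power2)
  then have "\<forall>j<N. Z p (\<lambda>x. F x j) = 0" unfolding P_def by (subst (asm) sum_nonneg_eq_0_iff) auto
  then have "vconj (Z p) \<in> L p" by (intro Fker L_sub secD(1)[OF Z(1)]) auto
  moreover have "tcomb p (Z p) vzero 0 = tcomb p vzero (vconj (Z p)) 0"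
    unfolding tcomb_def vconj_vconj by (simp add: vdefs vconj_def)
  ultimately show False using tcomb_unique(1)[OF secD(1)[OF Z(1)] L_zero L_zero] Z(2) by blast
qed

text \<open>Pairing with the conjugate coordinates isolates the \<open>T\<close> coefficient: the
  component in \<open>L\<close> drops out by differentiating the sphere equation, the conjugate one
  by the CR equations. The formula exhibits the form as smooth.\<close>

lemma nf0:
  assumes v: "v \<in> ctangent A p"
  shows "nf (\<lambda>x. 0) p v = - \<i> * (\<Sum>j<N. cnj (F p j) * v (\<lambda>x. F x j)) * inverse (of_real (B p))"
proof -
  obtain l m c where lm: "l \<in> L p" "m \<in> L p" "v = tcomb p l m c" using tcomb_exists[OF v] .
  have "(\<lambda>x. \<Sum>j<N. F x j * cnj (F x j)) = (\<lambda>x. 1)"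
    using Fnorm by (simp flip: complex_norm_square of_real_sum of_real_power)
  then have "0 = l (\<lambda>x. \<Sum>j<N. F x j * cnj (F x j))" using ctangent_const[OF L_sub[OF lm(1)]] by simp
  also have "\<dots> = (\<Sum>j<N. l (\<lambda>x. F x j * cnj (F x j)))"
    by (intro ctangent_sum[OF L_sub[OF lm(1)]] sm_intros F_sm) auto
  also have "\<dots> = (\<Sum>j<N. cnj (F p j) * l (\<lambda>x. F x j))"
    by (intro sum.cong refl) (simp add: ctangentD(2)[OF L_sub[OF lm(1)]] F_sm F_cr(1)[OF _ lm(1)])
  finally have l0: "(\<Sum>j<N. cnj (F p j) * l (\<lambda>x. F x j)) = 0" by simp
  have "(\<Sum>j<N. cnj (F p j) * v (\<lambda>x. F x j)) = (\<Sum>j<N. cnj (F p j) * l (\<lambda>x. F x j) + \<i> * c * of_real (\<beta> j * rho j p))"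
    unfolding lm(3) tcomb_def rho_def of_real_mult of_real_power[symmetric] complex_norm_square
    by (intro sum.cong refl) (simp add: vdefs F_cr(2)[OF _ lm(2)] F_T algebra_simps)
  also have "\<dots> = \<i> * c * of_real (B p)" by (simp add: sum.distrib l0 B_def sum_distrib_left)
  finally have "(\<Sum>j<N. cnj (F p j) * v (\<lambda>x. F x j)) = \<i> * c * of_real (B p)" .
  moreover have "nf (\<lambda>x. 0) p v = c"
    using ctangent_const[OF L_sub[OF lm(1)], of 0] ctangent_const[OF L_sub[OF lm(2)], of 0] unfolding lm(3) nf_tcomb[OF lm(1,2)] by simp
  moreover have "complex_of_real (B p) \<noteq> 0" using B_pos[of p] by simp
  ultimately show ?thesis by (simp add: field_simps)
qed

lemma nf0_sm:
  assumes Z: "smooth_section A UNIV (ctangent A) Z"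
  shows "mfd_smooth A (\<lambda>p. nf (\<lambda>x. 0) p (Z p))"
proof -
  have "of_real (B p) \<noteq> (0::complex)" for p using B_pos[of p] by simp
  then show ?thesis
    unfolding nf0[OF secD(1)[OF Z]] by (intro sm_intros F_sm B_sm secD(2)[OF Z]) auto
qed

lemma tinv0: "tinv (\<lambda>x. 0)"
  unfolding tinv_def using ctangent_const[OF T_tan, of _ 0] by (auto intro: sm_intros)

lemma good0: "good (\<lambda>x. 0)"
  unfolding good_def
proof (intro conjI tinv0 nf_one_formI nf0_sm)
  show "levi_pos (\<lambda>x. 0)"
    unfolding levi_pos_def
  proof (intro allI impI, elim conjE)
    fix Z p assume Z: "smooth_section A UNIV L Z" "Z p \<noteq> vzero"
    have "1 / (2 * \<i>) * lev (\<lambda>x. 0) Z p = of_real (P Z p / (2 * B p))"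
      unfolding lev_affine[OF Z(1) tinv0] levi0_eq[OF Z(1)] using hess_const[OF Z(1), of 0 p] by simp
    then show "\<exists>r>0. 1 / (2 * \<i>) * lev (\<lambda>x. 0) Z p = complex_of_real r"
      using P_pos[OF Z] B_pos[of p] by (intro exI[of _ "P Z p / (2 * B p)"]) auto
  qed
qed

text \<open>The constants are 2! = 2 and 4! + 2 * 3! = 36.\<close>

lemma flat_bounds: "0 \<le> flat 2 s" "flat 2 s \<le> 2" "\<bar>flat 4 s - 2 * flat 3 s\<bar> \<le> 36"
  using flat_nonneg[of 2 s] flat_nonneg[of 3 s] flat_nonneg[of 4 s] flat_le[of 2 s] flat_le[of 3 s] flat_le[of 4 s]
  by (auto simp: fact_numeral abs_le_iff)

text \<open>The Hessian of the flat function of \<open>rho j\<close> is bounded above by a constant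
  times \<open>P\<close>, while the Levi form of the base structure is at least P / (2 M). Hence one
  small \<epsilon> works at every point.\<close>

lemma good_flat:
  assumes j: "j < N"
  obtains \<epsilon> where "\<epsilon> > 0" "tinv (\<lambda>x. flat 0 (rho j x - c))" "good (\<lambda>x. \<epsilon> * flat 0 (rho j x - c))"
proof -
  define \<tau> where "\<tau> x = flat 0 (rho j x - c)" for x
  \<comment> \<open>\<open>\<kappa>\<close> and \<open>\<kappa>'\<close> are the first and second
    derivative of the flat profile, according to \<open>flat_has_derivative\<close>.\<close>
  define \<kappa> where "\<kappa> x = flat 2 (rho j x - c)" for x
  define \<kappa>' where "\<kappa>' x = flat 4 (rho j x - c) - 2 * flat 3 (rho j x - c)" for x
  have rs: "mfd_smooth A (rho j)" by (rule rho_sm[OF j])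
  have sm: "mfd_smooth A \<tau>" "mfd_smooth A \<kappa>" unfolding \<tau>_def \<kappa>_def by (intro sm_intros rs)+
  have v\<tau>: "v (cf \<tau>) = \<kappa> p * v (cf (rho j))" if v: "v \<in> ctangent A p" for v :: "'a cvec" and p
  proof -
    have "((\<lambda>s. flat 0 (s - c)) has_real_derivative \<kappa> p) (at (rho j p))"
      using flat_shift_derivative[of 0 c "rho j p"] unfolding \<kappa>_def by (simp add: numeral_2_eq_2)
    from ctangent_chain[OF span v rs _ this] sm(1) show ?thesis unfolding \<tau>_def by simp
  qed
  have v\<kappa>: "v (cf \<kappa>) = \<kappa>' p * v (cf (rho j))" if v: "v \<in> ctangent A p" for v :: "'a cvec" and p
  proof -
    have "((\<lambda>s. flat 2 (s - c)) has_real_derivative \<kappa>' p) (at (rho j p))"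
      using flat_shift_derivative[of 2 c "rho j p"] unfolding \<kappa>'_def by simp
    from ctangent_chain[OF span v rs _ this] sm(2) show ?thesis unfolding \<kappa>_def by simp
  qed
  have ti: "tinv \<tau>" unfolding tinv_def using sm(1) v\<tau>[OF T_tan] rho_T[OF j] by simp
  have hs: "hess (cf \<tau>) Z p = \<kappa> p * hess (cf (rho j)) Z p + 2 * \<kappa>' p * (Z p (cf (rho j)) * vconj (Z p) (cf (rho j)))"
    if Z: "smooth_section A UNIV L Z" for Z p
  proof -
    note Zc = L_sec[OF Z]
    note W = sec_conj[OF Zc]
    obtain l m b where lm: "l \<in> L p" "m \<in> L p" and br: "conj_bracket Z p = tcomb p l m b"
      using tcomb_exists[OF conj_bracket_ctangent[OF Zc]] by metis
    have 1: "v (\<lambda>q. Y q (cf \<tau>)) = \<kappa>' p * v (cf (rho j)) * Y p (cf (rho j)) + \<kappa> p * v (\<lambda>q. Y q (cf (rho j)))"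
      if v: "v \<in> ctangent A p" and Y: "smooth_section A UNIV (ctangent A) Y" for v :: "'a cvec" and Y :: "'a \<Rightarrow> 'a cvec"
      unfolding v\<tau>[OF secD(1)[OF Y]]
      using ctangentD(2)[OF v msm_of_real[OF open_UNIV sm(2)] secD(2)[OF Y msm_of_real[OF open_UNIV rs]]] v\<kappa>[OF v] by simp
    show ?thesis unfolding hess_def br dec_tcomb[OF lm] split
      1[OF secD(1)[OF Zc] W] 1[OF secD(1)[OF W] Zc] v\<tau>[OF L_sub[OF lm(1)]] v\<tau>[OF vconj_ctangent[OF L_sub[OF lm(2)]]]
      by (simp add: algebra_simps)
  qed
  define M where "M = (\<Sum>j<N. \<beta> j)"
  \<comment> \<open>Below, \<open>H\<close> is at most (4 + 72) P, so the Levi form decreases by at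
    most 38 \<epsilon> P, which is less than P / (2 M).\<close>
  define \<epsilon> where "\<epsilon> = 1 / (100 * M)"
  obtain p0 :: 'a where True by blast
  have M: "M > 0" using B_pos[of p0] B_le[of p0] unfolding M_def by linarith
  then have \<epsilon>: "\<epsilon> > 0" unfolding \<epsilon>_def by simp
  have ti2: "tinv (\<lambda>x. \<epsilon> * \<tau> x)" using tinv_comb(1)[OF ti ti, of \<epsilon> 0] by simp
  have "good (\<lambda>x. \<epsilon> * \<tau> x)"
    unfolding good_def
  proof (intro conjI nf_one_formI ti2)
    fix Z assume Z: "smooth_section A UNIV (ctangent A) Z"
    \<comment> \<open>The components of \<open>Z p\<close> are only known pointwise. The derivatives
      of F_j along them are therefore expressed by those along \<open>Z\<close> itself, whose
      smoothness is known, corrected by the \<open>T\<close> part.\<close>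
    have "nf (\<lambda>x. \<epsilon> * \<tau> x) p (Z p) = nf (\<lambda>x. 0) p (Z p) + \<epsilon> * \<kappa> p * (\<i> * (cnj (F p j) * Z p (\<lambda>x. F x j)) - \<i> * (F p j * Z p (\<lambda>x. cnj (F x j)))
       + 2 * \<beta> j * rho j p * nf (\<lambda>x. 0) p (Z p))" for p
    proof -
      obtain l m c where lm: "l \<in> L p" "m \<in> L p" "Z p = tcomb p l m c" using tcomb_exists[OF secD(1)[OF Z]] .
      have n0: "nf (\<lambda>x. 0) p (Z p) = c"
        using ctangent_const[OF L_sub[OF lm(1)], of 0] ctangent_const[OF L_sub[OF lm(2)], of 0] unfolding lm(3) nf_tcomb[OF lm(1,2)] by simp
      have v\<epsilon>: "v (cf (\<lambda>x. \<epsilon> * \<tau> x)) = \<epsilon> * \<kappa> p * (v (\<lambda>x. F x j) * cnj (F p j))" if v: "v \<in> L p" for v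
        using tinv_comb(2)[OF ti ti L_sub[OF v], of \<epsilon> 0] v\<tau>[OF L_sub[OF v]] v_rho[OF j L_sub[OF v]] F_cr(1)[OF j v] by simp
      have ZF: "Z p (\<lambda>x. F x j) = l (\<lambda>x. F x j) + c * (\<i> * \<beta> j * F p j)"
        unfolding lm(3) tcomb_def using F_cr(2)[OF j lm(2)] F_T(1)[OF j] by (simp add: vdefs)
      have ZG: "Z p (\<lambda>x. cnj (F x j)) = cnj (m (\<lambda>x. F x j)) + c * (- \<i> * \<beta> j * cnj (F p j))"
        unfolding lm(3) tcomb_def using F_cr(1)[OF j lm(1)] F_T(2)[OF j] by (simp add: vdefs vconj_def)
      have rc: "of_real (rho j p) = F p j * cnj (F p j)" using fun_cong[OF rho_cf] .
      show ?thesis unfolding ZF ZG n0 unfolding lm(3) nf_tcomb[OF lm(1,2)] v\<epsilon>[OF lm(1)] v\<epsilon>[OF lm(2)] unfolding of_real_mult rc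
        by (simp add: algebra_simps)
    qed
    then show "mfd_smooth A (\<lambda>p. nf (\<lambda>x. \<epsilon> * \<tau> x) p (Z p))"
      by (simp only:) (intro sm_intros nf0_sm[OF Z] sm rs F_sm[OF j] secD(2)[OF Z])
  next
    show "levi_pos (\<lambda>x. \<epsilon> * \<tau> x)"
      unfolding levi_pos_def
    proof (intro allI impI, elim conjE)
      fix Z p assume Z: "smooth_section A UNIV L Z" "Z p \<noteq> vzero"
      define z where "z = (cmod (Z p (\<lambda>x. F x j)))\<^sup>2"
      define R where "R = \<beta> j * rho j p * (P Z p / B p)"
      define H where "H = \<kappa> p * (2 * z - 2 * R) + 2 * \<kappa>' p * (z * rho j p)"
      have zc: "Z p (\<lambda>x. F x j) * cnj (Z p (\<lambda>x. F x j)) = of_real z" unfolding z_def by (simp only: complex_norm_square)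
      have rc: "F p j * cnj (F p j) = of_real (rho j p)" using fun_cong[OF rho_cf, of j p] by simp
      have hr: "hess (cf (rho j)) Z p = of_real (2 * z - 2 * R)"
        unfolding rho_cf hess_rho[OF Z(1) j] zc rc levi0_eq[OF Z(1)] R_def by (simp add: algebra_simps)
      have Zp: "Z p \<in> L p" by (rule secD(1)[OF Z(1)])
      have zz: "Z p (cf (rho j)) * vconj (Z p) (cf (rho j)) = of_real (z * rho j p)"
      proof -
        have "Z p (cf (rho j)) = Z p (\<lambda>x. F x j) * cnj (F p j)" using v_rho[OF j L_sub[OF Zp]] F_cr(1)[OF j Zp] by simp
        then have "Z p (cf (rho j)) * vconj (Z p) (cf (rho j)) = (Z p (\<lambda>x. F x j) * cnj (Z p (\<lambda>x. F x j))) * (F p j * cnj (F p j))"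
          by (simp add: vconj_cf)
        then show ?thesis unfolding zc rc by simp
      qed
      have hH: "hess (cf \<tau>) Z p = of_real H" unfolding hs[OF Z(1)] hr zz H_def by simp
      have he: "hess (cf (\<lambda>x. \<epsilon> * \<tau> x)) Z p = \<epsilon> * of_real H" using hess_comb[OF ti ti Z(1), of \<epsilon> 0 p] hH by simp
      define r where "r = P Z p / (2 * B p) - \<epsilon> * H / 2"
      have "1 / (2 * \<i>) * lev (\<lambda>x. \<epsilon> * \<tau> x) Z p = of_real r"
        unfolding lev_affine[OF Z(1) ti2] levi0_eq[OF Z(1)] he r_def using B_pos[of p] by (simp add: field_simps)
      moreover have "r > 0"
      proof -
        have Pp: "P Z p > 0" by (rule P_pos[OF Z])
        have z: "0 \<le> z" "z \<le> P Z p" unfolding z_def P_def using j by (auto intro!: member_le_sum[of j "{..<N}" "\<lambda>j. (cmod (Z p (\<lambda>x. F x j)))\<^sup>2"])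
        have "R = (\<beta> j * rho j p / B p) * P Z p" unfolding R_def by simp
        moreover have "\<beta> j * rho j p / B p \<le> 1" using B_ge[OF j, of p] B_pos[of p] by simp
        ultimately have R: "R \<le> P Z p" using Pp by (metis less_imp_le mult.commute mult_left_le)
        have R0: "R \<ge> 0" unfolding R_def using beta[OF j] rho_nonneg[of j p] Pp B_pos[of p] by (simp add: less_imp_le)
        have "\<kappa> p * (2 * z - 2 * R) \<le> \<kappa> p * (2 * P Z p)" using flat_bounds(1) z R0 unfolding \<kappa>_def by (intro mult_left_mono) auto
        also have "\<dots> \<le> 2 * (2 * P Z p)" using flat_bounds(2) Pp unfolding \<kappa>_def by (intro mult_right_mono) auto
        finally have 1: "\<kappa> p * (2 * z - 2 * R) \<le> 4 * P Z p" by simp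
        have "z * rho j p \<le> P Z p" using z rho_le[OF j, of p] rho_nonneg[of j p] by (meson mult_left_le order_trans)
        then have "\<kappa>' p * (z * rho j p) \<le> 36 * P Z p"
          using flat_bounds(3) z(1) rho_nonneg[of j p] unfolding \<kappa>'_def by (intro mult_mono) (auto simp: abs_le_iff)
        then have "H \<le> 76 * P Z p" unfolding H_def using 1 by simp
        then have "\<epsilon> * H / 2 \<le> \<epsilon> * (38 * P Z p)" using \<epsilon> by simp
        also have "\<dots> < P Z p / (2 * M)" unfolding \<epsilon>_def using M Pp by (simp add: field_simps)
        also have "\<dots> \<le> P Z p / (2 * B p)" using B_le[of p] B_pos[of p] Pp unfolding M_def by (intro divide_left_mono) auto
        finally show ?thesis unfolding r_def by simp
      qed
      ultimately show "\<exists>r>0. 1 / (2 * \<i>) * lev (\<lambda>x. \<epsilon> * \<tau> x) Z p = complex_of_real r" by blast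
    qed
  qed
  then show thesis using that[OF \<epsilon>] ti unfolding \<tau>_def by simp
qed

text \<open>If every squared modulus had zero differential, choose \<open>j\<close> with F_j nonzero
  at \<open>p\<close>. Then Z F_j = 0 and the Hessian of \<open>rho j\<close> vanishes, so
  \<open>hess_rho\<close> forces \<open>levi0\<close> to be zero although \<open>P\<close> is
  positive.\<close>

lemma rho_nonconstant:
  obtains p j v where "j < N" "v \<in> ctangent A p" "v (cf (rho j)) \<noteq> 0"
proof -
  have "\<exists>p j v. j < N \<and> v \<in> ctangent A p \<and> v (cf (rho j)) \<noteq> 0"
  proof (rule ccontr)
    assume "\<not> ?thesis"
    then have 0: "v (cf (rho j)) = 0" if "j < N" "v \<in> ctangent A p" for v :: "'a cvec" and p j using that by blast
    obtain p :: 'a where True by blast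
    obtain Z where Z: "smooth_section A UNIV L Z" "Z p \<noteq> vzero" using sec by blast
    obtain j where j: "j < N" "rho j p > 0" using rho_ex by blast
    note Zc = L_sec[OF Z(1)]
    note Zp = secD(1)[OF Zc] and Wp = secD(1)[OF sec_conj[OF Zc]]
    obtain l m b where lm: "l \<in> L p" "m \<in> L p" and br: "conj_bracket Z p = tcomb p l m b"
      using tcomb_exists[OF conj_bracket_ctangent[OF Zc]] by metis
    have "hess (cf (rho j)) Z p = 0"
      unfolding hess_def br dec_tcomb[OF lm] split 0[OF j(1) Zp] 0[OF j(1) Wp] ctangent_const[OF Zp] ctangent_const[OF Wp]
        0[OF j(1) L_sub[OF lm(1)]] 0[OF j(1) vconj_ctangent[OF L_sub[OF lm(2)]]] by simp
    then have "2 * (Z p (\<lambda>x. F x j) * cnj (Z p (\<lambda>x. F x j))) = 2 * \<i> * levi0 Z p * \<beta> j * (F p j * cnj (F p j))"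
      unfolding rho_cf hess_rho[OF Z(1) j(1)] by simp
    moreover have "Z p (\<lambda>x. F x j) = 0"
      using v_rho[OF j(1) Zp, of p] 0[OF j(1) Zp, of p] F_cr(1)[OF j(1) secD(1)[OF Z(1)]] j(2) unfolding rho_def by auto
    ultimately have "levi0 Z p = 0" using beta[OF j(1)] j(2) unfolding rho_def by auto
    then show False unfolding levi0_eq[OF Z(1)] using P_pos[OF Z] B_pos[of p] by simp
  qed
  then show thesis using that by blast
qed

end

subsection \<open>Holomorphic discs\<close>

text \<open>The relation \<open>R z w w'\<close> plays the role of \<open>w' = J w\<close> for an almost complex structure \<open>J\<close> for which
  the functions \<open>h j\<close> are holomorphic and separate directions. In the chart given by
  the adjoint of the differential of \<open>h\<close> at \<open>z0\<close>, \<open>J\<close> becomes constant.\<close>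
lemma disc_exists:
  fixes h :: "nat \<Rightarrow> 'e::euclidean_space \<Rightarrow> complex" and D :: "nat \<Rightarrow> 'e \<Rightarrow> 'e \<Rightarrow> complex"
  assumes S: "open S" "z0 \<in> S"
    and der: "\<And>j z. j < N \<Longrightarrow> z \<in> S \<Longrightarrow> (h j has_derivative D j z) (at z)"
    and cont: "\<And>j w. j < N \<Longrightarrow> continuous_on S (\<lambda>z. D j z w)"
    and inj: "\<And>w. (\<And>j. j < N \<Longrightarrow> D j z0 w = 0) \<Longrightarrow> w = 0"
    and ex: "\<And>z w. z \<in> S \<Longrightarrow> \<exists>w'. R z w w'"
    and R: "\<And>j z w w'. j < N \<Longrightarrow> z \<in> S \<Longrightarrow> R z w w' \<Longrightarrow> D j z w' = \<i> * D j z w"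
  obtains r :: real and \<sigma> :: "complex \<Rightarrow> 'e" and w0 where "r > 0" "\<sigma> 0 = z0"
    "(\<sigma> has_derivative (\<lambda>d. Re d *\<^sub>R e + Im d *\<^sub>R w0)) (at 0)"
    "\<And>\<zeta>. \<zeta> \<in> ball 0 r \<Longrightarrow> \<sigma> \<zeta> \<in> S \<and> (\<exists>w w'. R (\<sigma> \<zeta>) w w' \<and> (\<sigma> has_derivative (\<lambda>d. Re d *\<^sub>R w + Im d *\<^sub>R w')) (at \<zeta>))"
proof -
  define K where "K j = adjoint (D j z0)" for j
  have lin: "linear (D j z)" if "j < N" "z \<in> S" for j z using der[OF that] has_derivative_linear by blast
  have K: "K j c \<bullet> x = c \<bullet> D j z0 x" if "j < N" for j c x
    using adjoint_works[OF lin[OF that S(2)], of x c] by (simp add: K_def inner_commute)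
  have Kl: "bounded_linear (K j)" if "j < N" for j
    unfolding K_def using adjoint_linear[OF lin[OF that S(2)]] by (simp add: linear_conv_bounded_linear)
  \<comment> \<open>The differential of \<open>G\<close> at \<open>z0\<close> is the sum of the
    products of the adjoint of \<open>D j z0\<close> with \<open>D j z0\<close>, positive definite
    by \<open>inj\<close>. So any number N of functions yields a map between spaces of equal
    dimension.\<close>
  define G where "G z = (\<Sum>j<N. K j (h j z))" for z
  define G' where "G' z w = (\<Sum>j<N. K j (D j z w))" for z w
  have dG: "(G has_derivative G' z) (at z)" if "z \<in> S" for z
    unfolding G_def[abs_def] G'_def[abs_def]
    by (intro has_derivative_sum bounded_linear.has_derivative[OF Kl] der that) auto
  have bl: "bounded_linear (G' z)" if "z \<in> S" for z using dG[OF that] has_derivative_bounded_linear by blast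
  have ap: "blinfun_apply (Blinfun (G' z)) = G' z" if "z \<in> S" for z using bl[OF that] by (rule bounded_linear_Blinfun_apply)
  have cG: "continuous_on S (\<lambda>z. Blinfun (G' z))"
  proof (rule continuous_on_blinfun_componentwise)
    fix i :: 'e
    have "continuous_on S (\<lambda>z. G' z i)"
      unfolding G'_def by (intro continuous_on_sum bounded_linear.continuous_on[OF Kl] cont) auto
    then show "continuous_on S (\<lambda>z. blinfun_apply (Blinfun (G' z)) i)"
      using ap by (subst continuous_on_cong[OF refl, of S _ "\<lambda>z. G' z i"]) auto
  qed
  have inj0: "w = 0" if "G' z0 w = 0" for w
  proof (rule inj)
    have "(\<Sum>j<N. D j z0 w \<bullet> D j z0 w) = G' z0 w \<bullet> w" unfolding G'_def inner_sum_left by (simp add: K)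
    then have "(\<Sum>j<N. D j z0 w \<bullet> D j z0 w) = 0" using that by simp
    then show "D j z0 w = 0" if "j < N" for j using that by (subst (asm) sum_nonneg_eq_0_iff) auto
  qed
  have l0: "linear (G' z0)" using bl[OF S(2)] by (simp add: linear_conv_bounded_linear)
  have "inj (G' z0)" using inj0 l0 by (simp add: linear_injective_0)
  then obtain I where I: "linear I" "\<And>x. I (G' z0 x) = x" using linear_injective_isomorphism[OF l0] by blast
  have inv: "Blinfun I o\<^sub>L Blinfun (G' z0) = id_blinfun"
    using I by (intro blinfun_eqI) (simp add: ap[OF S(2)] bounded_linear_Blinfun_apply linear_conv_bounded_linear)
  obtain U' V g g' where IF: "open U'" "U' \<subseteq> S" "z0 \<in> U'" "open V" "G z0 \<in> V" "homeomorphism U' V G g"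
    "\<And>y. y \<in> V \<Longrightarrow> (g has_derivative (g' y)) (at y)"
    "\<And>y. y \<in> V \<Longrightarrow> g' y = inv (blinfun_apply (Blinfun (G' (g y))))"
    "\<And>y. y \<in> V \<Longrightarrow> bij (blinfun_apply (Blinfun (G' (g y))))"
    using inverse_function_theorem[OF S(1) _ cG S(2) inv] dG ap by (metis (no_types, lifting))
  have gV: "g y \<in> U'" "g y \<in> S" if "y \<in> V" for y using IF(2,6) that unfolding homeomorphism_def by blast+
  have gG: "g (G z0) = z0" using IF(3,6) unfolding homeomorphism_def by blast
  obtain e1 where e1: "R z0 e e1" using ex[OF S(2)] by blast
  define a where "a = G' z0 e"
  define b where "b = G' z0 e1"
  \<comment> \<open>Multiplication by \<open>\<i>\<close> is skew for the real inner product. Hence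
    the differential of \<open>G\<close> carries J at any point to minus the adjoint of J at
    \<open>z0\<close>, which no longer depends on the point.\<close>
  have key: "G' z w' \<bullet> x = - (G' z w \<bullet> x')" if "z \<in> S" "R z w w'" "R z0 x x'" for z w w' x x'
  proof -
    have "(\<i> * c) \<bullet> d = - (c \<bullet> (\<i> * d))" for c d :: complex by (simp add: inner_complex_def algebra_simps)
    then show ?thesis
      unfolding G'_def inner_sum_left sum_negf[symmetric]
      by (intro sum.cong refl) (simp add: K R[OF _ that(1,2)] R[OF _ S(2) that(3)])
  qed
  \<comment> \<open>A complex line for that constant structure: \<open>a\<close> is the image of the
    prescribed direction \<open>e\<close> and \<open>b\<close> the image of its rotation.\<close>
  define c where "c \<zeta> = G z0 + (Re \<zeta> *\<^sub>R a + Im \<zeta> *\<^sub>R b)" for \<zeta>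
  define \<sigma> where "\<sigma> \<zeta> = g (c \<zeta>)" for \<zeta>
  have dc: "(c has_derivative (\<lambda>d. Re d *\<^sub>R a + Im d *\<^sub>R b)) (at \<zeta>)" for \<zeta>
    unfolding c_def by (auto intro!: derivative_eq_intros)
  have "continuous_on UNIV c" unfolding c_def by (intro continuous_intros)
  then have "open (c -` V)" using IF(4) by (intro open_vimage)
  moreover have "0 \<in> c -` V" using IF(5) by (simp add: c_def)
  ultimately obtain r where r: "r > 0" "ball 0 r \<subseteq> c -` V" unfolding open_contains_ball by blast
  have ds: "\<exists>w'. R (\<sigma> \<zeta>) (g' (c \<zeta>) a) w' \<and> (\<sigma> has_derivative (\<lambda>d. Re d *\<^sub>R (g' (c \<zeta>) a) + Im d *\<^sub>R w')) (at \<zeta>)"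
    if \<zeta>: "c \<zeta> \<in> V" for \<zeta>
  proof -
    let ?y = "c \<zeta>"
    note zS = gV(2)[OF \<zeta>]
    have g': "g' ?y = inv (G' (g ?y))" "bij (G' (g ?y))" using IF(8,9)[OF \<zeta>] ap[OF zS] by auto
    define w where "w = g' ?y a"
    have Gw: "G' (g ?y) w = a" unfolding w_def g'(1) using g'(2) by (simp add: bij_is_surj surj_f_inv_f)
    obtain w' where w': "R (g ?y) w w'" using ex[OF zS] by blast
    \<comment> \<open>Both sides have inner product - (a, x') with every \<open>x\<close>, where
      \<open>x'\<close> is the rotation of \<open>x\<close> at \<open>z0\<close>.\<close>
    have "G' (g ?y) w' = b"
    proof (rule vector_eq_rdot[THEN iffD1], rule allI)
      fix x
      obtain x' where x': "R z0 x x'" using ex[OF S(2)] by blast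
      show "G' (g ?y) w' \<bullet> x = b \<bullet> x"
        using key[OF zS w' x'] key[OF S(2) e1 x'] Gw unfolding a_def b_def by simp
    qed
    then have gb: "g' ?y b = w'" unfolding g'(1) using g'(2) by (metis bij_inv_eq_iff)
    have lg: "linear (g' ?y)" using IF(7)[OF \<zeta>] has_derivative_linear by blast
    have "(\<sigma> has_derivative (\<lambda>d. g' ?y (Re d *\<^sub>R a + Im d *\<^sub>R b))) (at \<zeta>)"
      unfolding \<sigma>_def[abs_def] using has_derivative_compose[OF dc IF(7)[OF \<zeta>]] .
    then show ?thesis using w' unfolding \<sigma>_def w_def by (auto simp: linear_add[OF lg] linear_cmul[OF lg] gb)
  qed
  have c0: "c 0 = G z0" "c 0 \<in> V" using IF(5) by (simp_all add: c_def)
  have s0: "\<sigma> 0 = z0" unfolding \<sigma>_def c0 gG ..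
  have "g' (c 0) a = e"
  proof -
    have "g' (c 0) = inv (G' z0)" "bij (G' z0)" using IF(8,9)[OF IF(5)] ap[OF S(2)] gG c0 by auto
    then show ?thesis unfolding a_def by (metis bij_inv_eq_iff)
  qed
  then obtain w0 where "(\<sigma> has_derivative (\<lambda>d. Re d *\<^sub>R e + Im d *\<^sub>R w0)) (at 0)" using ds[OF c0(2)] by auto
  moreover have "\<sigma> \<zeta> \<in> S \<and> (\<exists>w w'. R (\<sigma> \<zeta>) w w' \<and> (\<sigma> has_derivative (\<lambda>d. Re d *\<^sub>R w + Im d *\<^sub>R w')) (at \<zeta>))"
    if "\<zeta> \<in> ball 0 r" for \<zeta>
  proof -
    have "c \<zeta> \<in> V" using r(2) that by blast
    then show ?thesis using ds[of \<zeta>] gV(2)[of "c \<zeta>"] unfolding \<sigma>_def by blast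
  qed
  ultimately show thesis using that[of r \<sigma> w0] r(1) s0 by blast
qed

context cr_sphere begin

text \<open>On \<open>X \<times> \<real>\<close>, with \<open>X\<close> read in a chart, a CR function \<open>h\<close> with \<open>T h = \<i> \<gamma> h\<close> extends
  to the holomorphic function \<open>exp (- \<gamma> s) h\<close> of the cone.\<close>
definition cone_fun :: "'a set \<Rightarrow> ('a \<Rightarrow> real^'m) \<Rightarrow> real \<Rightarrow> ('a \<Rightarrow> complex) \<Rightarrow> (real^'m) \<times> real \<Rightarrow> complex" where
  "cone_fun U \<phi> \<gamma> h z = of_real (exp (- \<gamma> * snd z)) * h (inv_into U \<phi> (fst z))"

definition cone_der :: "'a set \<Rightarrow> ('a \<Rightarrow> real^'m) \<Rightarrow> real \<Rightarrow> ('a \<Rightarrow> complex) \<Rightarrow> (real^'m) \<times> real \<Rightarrow> (real^'m) \<times> real \<Rightarrow> complex" where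
  "cone_der U \<phi> \<gamma> h z w = of_real (exp (- \<gamma> * snd z)) *
     ((\<Sum>k\<in>UNIV. (fst w $ k) *\<^sub>R pder k (h \<circ> inv_into U \<phi>) (fst z)) - of_real (\<gamma> * snd w) * h (inv_into U \<phi> (fst z)))"

lemma cone_has_derivative:
  assumes U: "(U, \<phi>) \<in> A" and h: "mfd_smooth A h" and z: "fst z \<in> \<phi> ` U"
  shows "(cone_fun U \<phi> \<gamma> h has_derivative cone_der U \<phi> \<gamma> h z) (at z)"
proof -
  have a: "((\<lambda>z. (h \<circ> inv_into U \<phi>) (fst z)) has_derivative (\<lambda>w. \<Sum>k\<in>UNIV. (fst w $ k) *\<^sub>R pder k (h \<circ> inv_into U \<phi>) (fst z))) (at z)"
    by (rule has_derivative_compose[OF has_derivative_fst[OF has_derivative_ident] smooth_on_has_derivative[OF sm_chart[OF h U] z]])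
  have "((\<lambda>z::(real^'m) \<times> real. exp (- \<gamma> * snd z)) has_derivative (\<lambda>w. exp (- \<gamma> * snd z) * (- \<gamma> * snd w))) (at z)"
    by (auto intro!: derivative_eq_intros)
  from bounded_linear.has_derivative[OF bounded_linear_of_real this]
  have e: "((\<lambda>z::(real^'m) \<times> real. complex_of_real (exp (- \<gamma> * snd z))) has_derivative (\<lambda>w. of_real (exp (- \<gamma> * snd z) * (- \<gamma> * snd w)))) (at z)" .
  show ?thesis
    using has_derivative_mult[OF e a] unfolding cone_fun_def[abs_def] o_def
    by (rule has_derivative_eq_rhs) (auto simp: cone_der_def fun_eq_iff o_def algebra_simps)
qed

lemma cone_der_continuous:
  assumes U: "(U, \<phi>) \<in> A" and h: "mfd_smooth A h"
  shows "continuous_on (\<phi> ` U \<times> UNIV) (\<lambda>z. cone_der U \<phi> \<gamma> h z w)"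
proof -
  have hs: "smooth_on (\<phi> ` U) (h \<circ> inv_into U \<phi>)" by (rule sm_chart[OF h U])
  have f: "continuous_on (\<phi> ` U \<times> UNIV) (\<lambda>z. f (fst z))" if "continuous_on (\<phi> ` U) f" for f :: "real^'m \<Rightarrow> complex"
    by (rule continuous_on_compose2[OF that continuous_on_fst[OF continuous_on_id]]) auto
  have 1: "continuous_on (\<phi> ` U \<times> UNIV) (\<lambda>z. pder k (h \<circ> inv_into U \<phi>) (fst z))" for k
    by (intro f smooth_on_continuous_on smooth_on_pder hs)
  have 2: "continuous_on (\<phi> ` U \<times> UNIV) (\<lambda>z. h (inv_into U \<phi> (fst z)))"
    using f[OF smooth_on_continuous_on[OF hs]] by simp
  show ?thesis unfolding cone_der_def by (intro continuous_intros 1 2)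
qed

lemma cone_der_vec:
  assumes "mfd_smooth A h" "(U, \<phi>) \<in> A" "q \<in> U"
  shows "cone_der U \<phi> \<gamma> h (\<phi> q, s) (w, c) = of_real (exp (- \<gamma> * s)) * (chart_vec A U \<phi> q w h - of_real (\<gamma> * c) * h q)"
  using assms(1) chart_inv(3)[OF assms(2,3)] by (simp add: cone_der_def chart_vec_def)

lemma real_vec:
  assumes U: "(U, \<phi>) \<in> A" "q \<in> U" and v: "v \<in> ctangent A q" "vconj v = v"
  obtains w where "v = chart_vec A U \<phi> q w"
proof -
  obtain a b where ab: "v = vadd (chart_vec A U \<phi> q a) (vscale \<i> (chart_vec A U \<phi> q b))"
    using span U v(1) unfolding spanned_def by blast
  have r: "vconj (chart_vec A U \<phi> q x) = chart_vec A U \<phi> q x" for x using chart_vec_rtangent[OF U] by (simp add: rtangent_def)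
  have "vconj v = vadd (chart_vec A U \<phi> q a) (vscale (-\<i>) (chart_vec A U \<phi> q b))"
    unfolding ab vconj_add vconj_scale r by simp
  then have e: "vadd (chart_vec A U \<phi> q a) (vscale \<i> (chart_vec A U \<phi> q b)) = vadd (chart_vec A U \<phi> q a) (vscale (-\<i>) (chart_vec A U \<phi> q b))"
    using v(2) ab by simp
  have z: "chart_vec A U \<phi> q b f = 0" for f :: "'a \<Rightarrow> complex" using fun_cong[OF e, of f] by (simp add: vdefs)
  have "v f = chart_vec A U \<phi> q a f" for f :: "'a \<Rightarrow> complex" unfolding ab using z[of f] by (simp add: vdefs)
  then have "v = chart_vec A U \<phi> q a" by (rule ext)
  then show thesis by (rule that)
qed

lemma real_tcomb:
  assumes v: "v \<in> ctangent A q" "vconj v = v"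
  obtains l a where "l \<in> L q" "v = tcomb q l l (complex_of_real a)"
proof -
  obtain l m c where lm: "l \<in> L q" "m \<in> L q" "v = tcomb q l m c" using tcomb_exists[OF v(1)] .
  have "tcomb q m l (cnj c) = tcomb q l m c" using v(2) unfolding lm(3) tcomb_conj .
  from tcomb_unique[OF lm(2,1,1,2) this] have "m = l" "cnj c = c" by auto
  then have "c = complex_of_real (Re c)" by (simp add: complex_eq_iff)
  then show thesis using that[of l "Re c"] lm \<open>m = l\<close> by simp
qed

lemma tcomb_crf: "l \<in> L q \<Longrightarrow> m \<in> L q \<Longrightarrow> crf \<gamma> h \<Longrightarrow> tcomb q l m c h = l h + c * (\<i> * \<gamma> * h q)"
  unfolding crf_def tcomb_def by (simp add: vdefs vconj_def)

text \<open>The complex structure of the cone multiplies the component in \<open>L\<close> by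
  \<open>\<i>\<close>, sends \<open>T\<close> to the height direction and the latter to minus
  \<open>T\<close>. One rotated vector serves all weights and CR functions.\<close>

lemma cone_rotation:
  assumes U: "(U, \<phi>) \<in> A" and z: "fst z \<in> \<phi> ` U"
  shows "\<exists>w'. \<forall>\<gamma> h. crf \<gamma> h \<longrightarrow> cone_der U \<phi> \<gamma> h z w' = \<i> * cone_der U \<phi> \<gamma> h z w"
proof -
  obtain q s where q: "q \<in> U" "z = (\<phi> q, s)" using z by (cases z) auto
  obtain x c where w: "w = (x, c)" by fastforce
  have "chart_vec A U \<phi> q x \<in> ctangent A q" "vconj (chart_vec A U \<phi> q x) = chart_vec A U \<phi> q x"
    using chart_vec_rtangent[OF U q(1)] unfolding rtangent_def by auto
  then obtain l a where l: "l \<in> L q" "chart_vec A U \<phi> q x = tcomb q l l (complex_of_real a)" using real_tcomb by metis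
  have l': "vscale \<i> l \<in> L q" by (rule L_scale[OF l(1)])
  define v where "v = tcomb q (vscale \<i> l) (vscale \<i> l) (- complex_of_real c)"
  have "v \<in> ctangent A q" "vconj v = v" unfolding v_def by (auto simp: tcomb_conj tcomb_ctangent l')
  then obtain y where y: "v = chart_vec A U \<phi> q y" using real_vec[OF U q(1)] by metis
  have "cone_der U \<phi> \<gamma> h z (y, a) = \<i> * cone_der U \<phi> \<gamma> h z w" if h: "crf \<gamma> h" for \<gamma> h
  proof -
    have hs: "mfd_smooth A h" using h unfolding crf_def by blast
    show ?thesis unfolding q(2) w cone_der_vec[OF hs U q(1)] l(2) y[symmetric] v_def
      tcomb_crf[OF l(1) l(1) h] tcomb_crf[OF l' l' h] by (simp add: vdefs algebra_simps)
  qed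
  then show ?thesis by blast
qed

text \<open>Trade the height component c for an imaginary multiple of \<open>T\<close>: the complex
  vector l + (a + i c) T is killed by every F_j. By \<open>Fker\<close> its conjugate lies in
  \<open>L\<close>, and uniqueness of the decomposition leaves only zero.\<close>

lemma cone_injective:
  assumes U: "(U, \<phi>) \<in> A" and q: "q \<in> U" and 0: "\<And>j. j < N \<Longrightarrow> cone_der U \<phi> (\<beta> j) (\<lambda>x. F x j) (\<phi> q, s) w = 0"
  shows "w = 0"
proof -
  obtain x c where w: "w = (x, c)" by fastforce
  have "chart_vec A U \<phi> q x \<in> ctangent A q" "vconj (chart_vec A U \<phi> q x) = chart_vec A U \<phi> q x"
    using chart_vec_rtangent[OF U q(1)] unfolding rtangent_def by auto
  then obtain l a where l: "l \<in> L q" "chart_vec A U \<phi> q x = tcomb q l l (complex_of_real a)" using real_tcomb by metis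
  define d where "d = complex_of_real a + \<i> * of_real c"
  define u where "u = tcomb q l vzero d"
  have u: "u \<in> ctangent A q" unfolding u_def by (intro tcomb_ctangent l L_zero)
  have "u (\<lambda>x. F x j) = 0" if j: "j < N" for j
  proof -
    have "tcomb q l l (complex_of_real a) (\<lambda>x. F x j) = of_real (\<beta> j * c) * F q j"
      using 0[OF j] unfolding w cone_der_vec[OF F_sm(1)[OF j] U q] l(2) by simp
    then have "l (\<lambda>x. F x j) + of_real a * (\<i> * \<beta> j * F q j) = of_real (\<beta> j * c) * F q j"
      unfolding tcomb_crf[OF l(1) l(1) Fcrf[OF j]] .
    then show ?thesis unfolding u_def tcomb_crf[OF l(1) L_zero Fcrf[OF j]] d_def by (simp add: algebra_simps)
  qed
  then have v: "vconj u \<in> L q" by (rule Fker[OF u])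
  have "tcomb q l vzero d = tcomb q vzero (vconj u) 0"
    unfolding u_def[symmetric] unfolding tcomb_def vconj_vconj by (simp add: vdefs)
  from tcomb_unique[OF l(1) L_zero L_zero v this] have "l = vzero" "d = 0" by auto
  then have a: "a = 0" "c = 0" unfolding d_def by (simp_all add: complex_eq_iff)
  have cv: "chart_vec A U \<phi> q x f = 0" for f unfolding l(2) \<open>l = vzero\<close> a by (simp add: tcomb_def vdefs vconj_def)
  obtain X :: "'m \<Rightarrow> 'a \<Rightarrow> complex" and e :: real where X: "e > 0" "\<And>a k. chart_vec A U \<phi> q a (X k) = of_real (e * a $ k)"
    using coordinate_functions[OF U q] by metis
  have "x $ k = 0" for k using X(2)[of x k] cv[of "X k"] X(1) by simp
  then show ?thesis using a w by (simp add: vec_eq_iff zero_prod_def)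
qed

lemma disc:
  assumes U: "(U, \<phi>) \<in> A" "p \<in> U"
  obtains r :: real and q :: "complex \<Rightarrow> 'a" and s :: "complex \<Rightarrow> real" where
    "r > 0" "q 0 = p" "s 0 = 0" "continuous_on (ball 0 r) s"
    "\<And>f :: 'a \<Rightarrow> real. mfd_smooth A f \<Longrightarrow> continuous_on (ball 0 r) (\<lambda>\<zeta>. f (q \<zeta>))"
    "\<And>\<gamma> h. crf \<gamma> h \<Longrightarrow> (\<lambda>\<zeta>. of_real (exp (- \<gamma> * s \<zeta>)) * h (q \<zeta>)) holomorphic_on ball 0 r"
    "\<And>f :: 'a \<Rightarrow> real. mfd_smooth A f \<Longrightarrow> ((\<lambda>x. f (q (of_real x))) has_real_derivative (\<Sum>k\<in>UNIV. v $ k * pder k (f \<circ> inv_into U \<phi>) (\<phi> p))) (at 0)"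
proof -
  let ?S = "\<phi> ` U \<times> (UNIV :: real set)"
  \<comment> \<open>Quantified over all weights and CR functions: the disc is built from
    \<open>F\<close>, but it must serve the components of every other embedding too.\<close>
  define R where "R z w w' \<longleftrightarrow> (\<forall>\<gamma> h. crf \<gamma> h \<longrightarrow> cone_der U \<phi> \<gamma> h z w' = \<i> * cone_der U \<phi> \<gamma> h z w)" for z w w'
  have S: "open ?S" "(\<phi> p, 0) \<in> ?S" using chart_homeo(2)[OF U(1)] U(2) by (auto intro: open_Times)
  obtain r :: real and \<sigma> :: "complex \<Rightarrow> (real^'m) \<times> real" and w0 where r: "r > 0" "\<sigma> 0 = (\<phi> p, 0)"
    "(\<sigma> has_derivative (\<lambda>d. Re d *\<^sub>R (v, 0) + Im d *\<^sub>R w0)) (at 0)"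
    "\<And>\<zeta>. \<zeta> \<in> ball 0 r \<Longrightarrow> \<sigma> \<zeta> \<in> ?S \<and> (\<exists>w w'. R (\<sigma> \<zeta>) w w' \<and> (\<sigma> has_derivative (\<lambda>d. Re d *\<^sub>R w + Im d *\<^sub>R w')) (at \<zeta>))"
  proof (rule disc_exists[OF S, of N "\<lambda>j. cone_fun U \<phi> (\<beta> j) (\<lambda>x. F x j)" "\<lambda>j. cone_der U \<phi> (\<beta> j) (\<lambda>x. F x j)" R "(v, 0)"])
    show "(cone_fun U \<phi> (\<beta> j) (\<lambda>x. F x j) has_derivative cone_der U \<phi> (\<beta> j) (\<lambda>x. F x j) z) (at z)" if "j < N" "z \<in> ?S" for j z
      using that by (intro cone_has_derivative U F_sm) auto
    show "continuous_on ?S (\<lambda>z. cone_der U \<phi> (\<beta> j) (\<lambda>x. F x j) z w)" if "j < N" for j w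
      by (intro cone_der_continuous U F_sm that)
    show "w = 0" if "\<And>j. j < N \<Longrightarrow> cone_der U \<phi> (\<beta> j) (\<lambda>x. F x j) (\<phi> p, 0) w = 0" for w
      by (rule cone_injective[OF U that])
    show "\<exists>w'. R z w w'" if "z \<in> ?S" for z w
      unfolding R_def using that by (intro cone_rotation U) auto
    show "cone_der U \<phi> (\<beta> j) (\<lambda>x. F x j) z w' = \<i> * cone_der U \<phi> (\<beta> j) (\<lambda>x. F x j) z w" if "j < N" "z \<in> ?S" "R z w w'" for j z w w'
      using that(3) Fcrf[OF that(1)] unfolding R_def by blast
  qed (rule that)
  define q where "q \<zeta> = inv_into U \<phi> (fst (\<sigma> \<zeta>))" for \<zeta>
  define s where "s \<zeta> = snd (\<sigma> \<zeta>)" for \<zeta>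
  have cs: "continuous_on (ball 0 r) \<sigma>"
    using r(4) by (meson continuous_at_imp_continuous_on has_derivative_continuous)
  have fU: "fst (\<sigma> \<zeta>) \<in> \<phi> ` U" if "\<zeta> \<in> ball 0 r" for \<zeta> using r(4)[OF that] by (auto simp: mem_Times_iff)
  show thesis
  proof (rule that[OF r(1), of q s])
    show "q 0 = p" "s 0 = 0" using chart_inv(3)[OF U] by (simp_all add: q_def s_def r(2))
    show "continuous_on (ball 0 r) s" unfolding s_def by (intro continuous_on_snd cs)
    fix f :: "'a \<Rightarrow> real" assume f: "mfd_smooth A f"
    show "continuous_on (ball 0 r) (\<lambda>\<zeta>. f (q \<zeta>))"
    proof -
      have "(\<lambda>\<zeta>. fst (\<sigma> \<zeta>)) ` ball 0 r \<subseteq> \<phi> ` U" using fU by blast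
      from continuous_on_compose2[OF smooth_on_continuous_on[OF sm_chart[OF f U(1)]] continuous_on_fst[OF cs] this]
      show ?thesis unfolding q_def by simp
    qed
    have "(\<sigma> has_derivative (\<lambda>d. Re d *\<^sub>R (v, 0) + Im d *\<^sub>R w0)) (at (of_real 0))" using r(3) by simp
    from has_derivative_fst[OF has_derivative_compose[OF bounded_linear_imp_has_derivative[OF bounded_linear_of_real] this]]
    have "((\<lambda>x. fst (\<sigma> (of_real x))) has_derivative (\<lambda>d. d *\<^sub>R v)) (at 0)"
      by simp
    moreover have "((f \<circ> inv_into U \<phi>) has_derivative (\<lambda>v. \<Sum>k\<in>UNIV. (v $ k) *\<^sub>R pder k (f \<circ> inv_into U \<phi>) (\<phi> p))) (at (fst (\<sigma> (of_real 0))))"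
      using smooth_on_has_derivative[OF sm_chart[OF f U(1)]] U(2) r(2) by simp
    ultimately have "((\<lambda>x. (f \<circ> inv_into U \<phi>) (fst (\<sigma> (of_real x)))) has_derivative (\<lambda>d. \<Sum>k\<in>UNIV. ((d *\<^sub>R v) $ k) *\<^sub>R pder k (f \<circ> inv_into U \<phi>) (\<phi> p))) (at 0)"
      by (rule has_derivative_compose)
    then show "((\<lambda>x. f (q (of_real x))) has_real_derivative (\<Sum>k\<in>UNIV. v $ k * pder k (f \<circ> inv_into U \<phi>) (\<phi> p))) (at 0)"
      unfolding has_field_derivative_def q_def o_def
      by (rule has_derivative_eq_rhs) (auto simp: fun_eq_iff sum_distrib_left sum_distrib_right mult_ac)
  next
    fix \<gamma> h assume h: "crf \<gamma> h"
    then have hs: "mfd_smooth A h" unfolding crf_def by blast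
    have "((\<lambda>\<zeta>. cone_fun U \<phi> \<gamma> h (\<sigma> \<zeta>)) has_field_derivative cone_der U \<phi> \<gamma> h (\<sigma> \<zeta>) w) (at \<zeta>)"
      if \<zeta>: "\<zeta> \<in> ball 0 r" and w: "R (\<sigma> \<zeta>) w w'" "(\<sigma> has_derivative (\<lambda>d. Re d *\<^sub>R w + Im d *\<^sub>R w')) (at \<zeta>)" for \<zeta> w w'
    proof -
      note d = cone_has_derivative[OF U(1) hs fU[OF \<zeta>], of \<gamma>]
      have lin: "linear (cone_der U \<phi> \<gamma> h (\<sigma> \<zeta>))" using d by (rule has_derivative_linear)
      have "cone_der U \<phi> \<gamma> h (\<sigma> \<zeta>) (Re d *\<^sub>R w + Im d *\<^sub>R w') = cone_der U \<phi> \<gamma> h (\<sigma> \<zeta>) w * d" for d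
      proof -
        have "cone_der U \<phi> \<gamma> h (\<sigma> \<zeta>) (Re d *\<^sub>R w + Im d *\<^sub>R w') = (of_real (Re d) + \<i> * of_real (Im d)) * cone_der U \<phi> \<gamma> h (\<sigma> \<zeta>) w"
          using w(1) h unfolding linear_add[OF lin] linear_cmul[OF lin] R_def by (simp add: scaleR_conv_of_real algebra_simps)
        then show ?thesis by (simp add: complex_eq[symmetric] mult.commute)
      qed
      then show ?thesis using has_derivative_compose[OF w(2) d] by (simp add: has_field_derivative_def)
    qed
    then have "\<exists>d. ((\<lambda>\<zeta>. cone_fun U \<phi> \<gamma> h (\<sigma> \<zeta>)) has_field_derivative d) (at \<zeta>)" if "\<zeta> \<in> ball 0 r" for \<zeta>
      using r(4)[OF that] that by blast
    then have "(\<lambda>\<zeta>. cone_fun U \<phi> \<gamma> h (\<sigma> \<zeta>)) holomorphic_on ball 0 r"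
      by (auto simp: holomorphic_on_open)
    then show "(\<lambda>\<zeta>. of_real (exp (- \<gamma> * s \<zeta>)) * h (q \<zeta>)) holomorphic_on ball 0 r"
      unfolding cone_fun_def s_def q_def .
  qed
qed

end

subsection \<open>Real-analyticity along a disc\<close>

text \<open>On the real axis |h_j|^2 agrees with the holomorphic function h_j (z) conj (h_j (conj
  z)). After this replacement the equation is holomorphic in both variables, and its derivative in
  the second is nonzero at the base point.\<close>

lemma implicit_holomorphic:
  fixes \<gamma> :: "nat \<Rightarrow> real" and h :: "nat \<Rightarrow> complex \<Rightarrow> complex" and u :: "real \<Rightarrow> real"
  assumes r: "r > 0" and \<gamma>: "\<And>j. j < N \<Longrightarrow> \<gamma> j > 0" and h: "\<And>j. j < N \<Longrightarrow> h j holomorphic_on ball 0 r"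
    and u: "continuous (at 0) u" and eq: "\<And>x. \<bar>x\<bar> < r \<Longrightarrow> (\<Sum>j<N. exp (2 * \<gamma> j * u x) * (cmod (h j (of_real x)))\<^sup>2) = 1"
  obtains \<delta> \<upsilon> where "\<delta> > 0" "\<upsilon> holomorphic_on ball 0 \<delta>" "\<And>x. \<bar>x\<bar> < \<delta> \<Longrightarrow> \<upsilon> (of_real x) = complex_of_real (u x)"
proof -
  define k where "k j z = h j z * cnj (h j (cnj z))" for j z
  have k: "k j holomorphic_on ball 0 r" if "j < N" for j
  proof -
    have "cnj ` ball 0 r \<subseteq> ball 0 r" by auto
    then have "(cnj \<circ> h j \<circ> cnj) holomorphic_on ball 0 r"
      by (intro holomorphic_on_compose_cnj_cnj holomorphic_on_subset[OF h[OF that]]) auto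
    then show ?thesis unfolding k_def by (intro holomorphic_intros h that) (simp add: o_def)
  qed
  have kd: "(k j has_field_derivative deriv (k j) z) (at z)" if "j < N" "z \<in> ball 0 r" for j z
    using holomorphic_derivI[OF k[OF that(1)] open_ball that(2)] .
  define \<Psi> where "\<Psi> z = (\<Sum>j<N. exp (2 * \<gamma> j * snd z) * k j (fst z))" for z :: "complex \<times> complex"
  define \<Psi>1 where "\<Psi>1 z = (\<Sum>j<N. exp (2 * \<gamma> j * snd z) * deriv (k j) (fst z))" for z :: "complex \<times> complex"
  define \<Psi>2 where "\<Psi>2 z = (\<Sum>j<N. 2 * \<gamma> j * exp (2 * \<gamma> j * snd z) * k j (fst z))" for z :: "complex \<times> complex"
  define S where "S = ball (0::complex) r \<times> (UNIV :: complex set)"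
  have S: "open S" unfolding S_def by (intro open_Times) auto
  define z0 where "z0 = (0::complex, complex_of_real (u 0))"
  have z0: "z0 \<in> S" using r by (simp add: S_def z0_def)
  \<comment> \<open>The solution is read off from the local inverse of this map on the points with
    second coordinate 1.\<close>
  define G where "G z = (fst z, \<Psi> z)" for z
  define G' where "G' z w = (fst w, \<Psi>1 z * fst w + \<Psi>2 z * snd w)" for z w :: "complex \<times> complex"
  have bl: "bounded_linear (G' z)" for z unfolding G'_def
    by (intro bounded_linear_Pair bounded_linear_add bounded_linear_const_mult bounded_linear_fst bounded_linear_snd)
  have d\<Psi>: "(\<Psi> has_derivative (\<lambda>w. \<Psi>1 z * fst w + \<Psi>2 z * snd w)) (at z)" if z: "z \<in> S" for z
  proof -
    have "((\<lambda>z. exp (2 * \<gamma> j * snd z) * k j (fst z)) has_derivative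
       (\<lambda>w. exp (2 * \<gamma> j * snd z) * (deriv (k j) (fst z) * fst w) + (exp (2 * \<gamma> j * snd z) * (2 * \<gamma> j * snd w)) * k j (fst z))) (at z)" if j: "j < N" for j
    proof (rule has_derivative_mult)
      have "(k j has_derivative (*) (deriv (k j) (fst z))) (at (fst z))"
        using kd[OF j] z by (simp add: has_field_derivative_def S_def mem_Times_iff)
      from has_derivative_compose[OF has_derivative_fst[OF has_derivative_ident] this]
      show "((\<lambda>z. k j (fst z)) has_derivative (\<lambda>w. deriv (k j) (fst z) * fst w)) (at z)" .
      have "((\<lambda>w. exp (2 * \<gamma> j * w)) has_field_derivative exp (2 * \<gamma> j * snd z) * (2 * \<gamma> j)) (at (snd z))"
        by (auto intro!: derivative_eq_intros)
      then have "((\<lambda>w. exp (2 * \<gamma> j * w)) has_derivative (\<lambda>w. exp (2 * \<gamma> j * snd z) * (2 * \<gamma> j) * w)) (at (snd z))"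
        by (simp add: has_field_derivative_def)
      from has_derivative_compose[OF has_derivative_snd[OF has_derivative_ident] this]
      show "((\<lambda>z. exp (2 * \<gamma> j * snd z)) has_derivative (\<lambda>w. exp (2 * \<gamma> j * snd z) * (2 * \<gamma> j * snd w))) (at z)"
        by (simp add: mult.assoc)
    qed
    then have "(\<Psi> has_derivative (\<lambda>w. \<Sum>j<N. exp (2 * \<gamma> j * snd z) * (deriv (k j) (fst z) * fst w) + (exp (2 * \<gamma> j * snd z) * (2 * \<gamma> j * snd w)) * k j (fst z))) (at z)"
      unfolding \<Psi>_def[abs_def] by (intro has_derivative_sum) auto
    then show ?thesis
      by (rule has_derivative_eq_rhs) (simp add: \<Psi>1_def \<Psi>2_def sum.distrib sum_distrib_left sum_distrib_right mult_ac fun_eq_iff)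
  qed
  have dG: "(G has_derivative blinfun_apply (Blinfun (G' z))) (at z)" if z: "z \<in> S" for z
    unfolding bounded_linear_Blinfun_apply[OF bl] unfolding G_def[abs_def] G'_def
    by (intro has_derivative_Pair has_derivative_fst[OF has_derivative_ident] d\<Psi> z)
  have cG: "continuous_on S (\<lambda>z. Blinfun (G' z))"
  proof (rule continuous_on_blinfun_componentwise)
    fix i :: "complex \<times> complex"
    have f: "continuous_on S (\<lambda>z. f (fst z))" if "f holomorphic_on ball 0 r" for f
    proof -
      have "fst ` S \<subseteq> ball 0 r" unfolding S_def by auto
      from continuous_on_compose2[OF holomorphic_on_imp_continuous_on[OF that] continuous_on_fst[OF continuous_on_id] this]
      show ?thesis .
    qed
    have 1: "continuous_on S \<Psi>1" unfolding \<Psi>1_def[abs_def]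
      by (intro continuous_intros f holomorphic_deriv k open_ball) auto
    have 2: "continuous_on S \<Psi>2" unfolding \<Psi>2_def[abs_def]
      by (intro continuous_intros f k) auto
    show "continuous_on S (\<lambda>z. blinfun_apply (Blinfun (G' z)) i)"
      unfolding bounded_linear_Blinfun_apply[OF bl] G'_def by (intro continuous_intros 1 2)
  qed
  have kx: "k j (of_real x) = of_real ((cmod (h j (of_real x)))\<^sup>2)" for j x
    unfolding k_def by (simp only: complex_cnj_complex_of_real complex_norm_square)
  have p2: "\<Psi>2 z0 \<noteq> 0"
  proof -
    define s where "s = (\<Sum>j<N. 2 * \<gamma> j * (exp (2 * \<gamma> j * u 0) * (cmod (h j 0))\<^sup>2))"
    have "\<Psi>2 z0 = of_real s" using kx[of _ 0] unfolding \<Psi>2_def z0_def s_def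
      by (simp flip: exp_of_real add: mult.assoc)
    \<comment> \<open>All terms are non-negative and the weights positive; if the sum vanished, so
      would every term of the equation at 0, whose sum is 1.\<close>
    moreover have "s \<noteq> 0"
    proof
      assume "s = 0"
      then have "\<forall>j<N. 2 * \<gamma> j * (exp (2 * \<gamma> j * u 0) * (cmod (h j 0))\<^sup>2) = 0"
        unfolding s_def by (subst (asm) sum_nonneg_eq_0_iff) (auto intro!: mult_nonneg_nonneg less_imp_le[OF \<gamma>])
      then have "exp (2 * \<gamma> j * u 0) * (cmod (h j 0))\<^sup>2 = 0" if "j < N" for j using \<gamma>[OF that] that by auto
      then have "(\<Sum>j<N. exp (2 * \<gamma> j * u 0) * (cmod (h j (of_real 0)))\<^sup>2) = 0" by simp
      then show False using eq[of 0] r by simp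
    qed
    ultimately show ?thesis by simp
  qed
  define I where "I w = (fst w, inverse (\<Psi>2 z0) * (snd w - \<Psi>1 z0 * fst w))" for w :: "complex \<times> complex"
  have Ib: "bounded_linear I" unfolding I_def
    by (intro bounded_linear_Pair bounded_linear_sub bounded_linear_const_mult bounded_linear_fst bounded_linear_snd)
  have inv: "Blinfun I o\<^sub>L Blinfun (G' z0) = id_blinfun"
    using p2 by (intro blinfun_eqI) (simp add: bounded_linear_Blinfun_apply[OF bl] bounded_linear_Blinfun_apply[OF Ib] I_def G'_def prod_eq_iff flip: mult.assoc)
  obtain U' V g g' where IF: "open U'" "U' \<subseteq> S" "z0 \<in> U'" "open V" "G z0 \<in> V" "homeomorphism U' V G g"
    "\<And>y. y \<in> V \<Longrightarrow> (g has_derivative (g' y)) (at y)"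
    "\<And>y. y \<in> V \<Longrightarrow> g' y = inv (blinfun_apply (Blinfun (G' (g y))))"
    "\<And>y. y \<in> V \<Longrightarrow> bij (blinfun_apply (Blinfun (G' (g y))))"
    using inverse_function_theorem[OF S dG cG z0 inv] by blast
  have Gx: "G (of_real x, complex_of_real (u x)) = (of_real x, 1)" if "\<bar>x\<bar> < r" for x
    using arg_cong[OF eq[OF that], of complex_of_real] kx[of _ x] unfolding G_def \<Psi>_def by (simp flip: exp_of_real)
  have y0: "G z0 = (0, 1)" using Gx[of 0] r unfolding z0_def by simp
  define \<upsilon> where "\<upsilon> \<zeta> = snd (g (\<zeta>, 1))" for \<zeta> :: complex
  have "open ((\<lambda>\<zeta>::complex. (\<zeta>, 1::complex)) -` V)" by (intro open_vimage IF(4) continuous_intros)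
  moreover have "0 \<in> (\<lambda>\<zeta>::complex. (\<zeta>, 1::complex)) -` V" using IF(5) y0 by simp
  ultimately obtain d1 where d1: "d1 > 0" "ball 0 d1 \<subseteq> (\<lambda>\<zeta>::complex. (\<zeta>, 1::complex)) -` V" unfolding open_contains_ball by blast
  have "\<exists>d. (\<upsilon> has_field_derivative d) (at \<zeta>)" if "\<zeta> \<in> ball 0 d1" for \<zeta>
  proof -
    have y: "(\<zeta>, 1) \<in> V" using that d1(2) by blast
    let ?z = "g (\<zeta>, 1)"
    have b: "bij (G' ?z)" "g' (\<zeta>, 1) = inv (G' ?z)" using IF(8,9)[OF y] bounded_linear_Blinfun_apply[OF bl] by auto
    have n: "\<Psi>2 ?z \<noteq> 0"
    proof
      assume "\<Psi>2 ?z = 0"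
      then have "G' ?z (0, 1) = G' ?z (0, 0)" by (simp add: G'_def)
      then show False using b(1) by (simp add: bij_def inj_eq)
    qed
    \<comment> \<open>The inverse function theorem used is real. That the solution is holomorphic
      shows in this complex linear form of its derivative.\<close>
    have i: "inv (G' ?z) (a, 0) = (a, - (\<Psi>1 ?z / \<Psi>2 ?z) * a)" for a
    proof -
      have "G' ?z (a, - (\<Psi>1 ?z / \<Psi>2 ?z) * a) = (a, 0)" using n by (simp add: G'_def field_simps)
      then show ?thesis using b(1) by (metis bij_inv_eq_iff)
    qed
    have "((\<lambda>\<zeta>::complex. (\<zeta>, 1::complex)) has_derivative (\<lambda>a. (a, 0))) (at \<zeta>)" by (auto intro!: derivative_eq_intros)
    from has_derivative_snd[OF has_derivative_compose[OF this IF(7)[OF y]]]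
    have "(\<upsilon> has_derivative (\<lambda>a. - (\<Psi>1 ?z / \<Psi>2 ?z) * a)) (at \<zeta>)" unfolding \<upsilon>_def[abs_def] b(2) i by simp
    then show ?thesis unfolding has_field_derivative_def by blast
  qed
  then have hol: "\<upsilon> holomorphic_on ball 0 d1" by (auto simp: holomorphic_on_open)
  \<comment> \<open>Continuity of \<open>u\<close> keeps its graph in the domain of the local
    inverse, so the holomorphic branch is the given \<open>u\<close>.\<close>
  have "continuous (at 0) (\<lambda>x. (complex_of_real x, complex_of_real (u x)))" by (intro continuous_intros u)
  then have "((\<lambda>x. (complex_of_real x, complex_of_real (u x))) \<longlongrightarrow> z0) (at 0)" by (simp add: continuous_at z0_def)
  then have "eventually (\<lambda>x. (complex_of_real x, complex_of_real (u x)) \<in> U') (at 0)" using IF(1,3) by (rule topological_tendstoD)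
  then obtain d2 where d2: "d2 > 0" "\<And>x. x \<noteq> 0 \<Longrightarrow> \<bar>x\<bar> < d2 \<Longrightarrow> (complex_of_real x, complex_of_real (u x)) \<in> U'"
    unfolding eventually_at by (auto simp: dist_norm)
  have real: "\<upsilon> (of_real x) = complex_of_real (u x)" if x: "\<bar>x\<bar> < r" "\<bar>x\<bar> < d2" for x
  proof -
    have "(complex_of_real x, complex_of_real (u x)) \<in> U'" using d2(2)[OF _ x(2)] IF(3) unfolding z0_def by (cases "x = 0") auto
    then have "g (G (of_real x, complex_of_real (u x))) = (of_real x, complex_of_real (u x))" using IF(6) unfolding homeomorphism_def by blast
    then show ?thesis unfolding Gx[OF x(1)] \<upsilon>_def by simp
  qed
  show thesis
  proof (rule that[of "min d1 (min d2 r)" \<upsilon>])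
    show "\<upsilon> holomorphic_on ball 0 (min d1 (min d2 r))" by (rule holomorphic_on_subset[OF hol]) auto
  qed (use d1(1) d2(1) r real in auto)
qed

text \<open>Subtracting the value at 0 makes the condition blind to additive constants, as the
  quotient requires; the bound \<open>K\<close> provides the normal family for Montel's
  theorem.\<close>

definition holo_ext :: "real \<Rightarrow> real \<Rightarrow> (real \<Rightarrow> real) \<Rightarrow> bool" where
  "holo_ext \<delta> K w \<longleftrightarrow> (\<exists>h. h holomorphic_on ball 0 \<delta> \<and> (\<forall>\<zeta>\<in>ball 0 \<delta>. cmod (h \<zeta>) \<le> K) \<and>
     (\<forall>x. \<bar>x\<bar> < \<delta> \<longrightarrow> h (of_real x) = of_real (w x - w 0)))"

text \<open>Half the radius makes the extension bounded by compactness; one natural number then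
  dominates both the bound and the inverse radius.\<close>

lemma holo_extI:
  assumes "\<delta> > 0" "\<upsilon> holomorphic_on ball 0 \<delta>" "\<And>x. \<bar>x\<bar> < \<delta> \<Longrightarrow> \<upsilon> (of_real x) = complex_of_real (w x)"
  obtains k :: nat where "holo_ext (1 / (real k + 1)) (real k + 1) w"
proof -
  define h where "h z = \<upsilon> z - of_real (w 0)" for z
  have hh: "h holomorphic_on ball 0 \<delta>" unfolding h_def by (intro holomorphic_intros assms)
  have "compact (h ` cball 0 (\<delta> / 2))"
    using assms(1) by (intro compact_continuous_image continuous_on_subset[OF holomorphic_on_imp_continuous_on[OF hh]]) auto
  then obtain B where B: "\<And>z. z \<in> cball 0 (\<delta> / 2) \<Longrightarrow> cmod (h z) \<le> B"
    using compact_imp_bounded bounded_iff by (metis imageI)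
  obtain k1 :: nat where k1: "B \<le> real k1" using real_arch_simple by blast
  obtain k2 :: nat where k2: "2 / \<delta> \<le> real k2" using real_arch_simple by blast
  define k where "k = max k1 k2"
  have k: "B \<le> real k + 1" "1 / (real k + 1) \<le> \<delta> / 2"
  proof -
    show "B \<le> real k + 1" using k1 unfolding k_def by (simp add: max_def)
    have "2 / \<delta> \<le> real k + 1" using k2 unfolding k_def by (simp add: max_def)
    then show "1 / (real k + 1) \<le> \<delta> / 2" using assms(1) by (simp add: field_simps)
  qed
  have "holo_ext (1 / (real k + 1)) (real k + 1) w"
    unfolding holo_ext_def
  proof (intro exI[of _ h] conjI ballI allI impI)
    show "h holomorphic_on ball 0 (1 / (real k + 1))" using k(2) assms(1) by (intro holomorphic_on_subset[OF hh]) auto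
    show "cmod (h \<zeta>) \<le> real k + 1" if "\<zeta> \<in> ball 0 (1 / (real k + 1))" for \<zeta>
    proof -
      have "\<zeta> \<in> cball 0 (\<delta> / 2)" using that k(2) by simp
      from B[OF this] k(1) show ?thesis by linarith
    qed
    show "h (of_real x) = of_real (w x - w 0)" if "\<bar>x\<bar> < 1 / (real k + 1)" for x
      using assms(3)[of x] that k(2) assms(1) by (simp add: h_def)
  qed
  then show thesis by (rule that)
qed

lemma holo_ext_cong: "(\<And>x. w x - w 0 = w' x - w' 0) \<Longrightarrow> holo_ext \<delta> K w \<longleftrightarrow> holo_ext \<delta> K w'"
  unfolding holo_ext_def by simp

lemma holo_ext_mono: "holo_ext \<delta> K w \<Longrightarrow> \<delta>' \<le> \<delta> \<Longrightarrow> holo_ext \<delta>' K w"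
  unfolding holo_ext_def
  by (elim ex_forward) (auto elim!: holomorphic_on_subset)

text \<open>Approximate at 0 and at the first rationals of the interval, with error tending to 0. A
  subsequence of the bounded extensions converges by Montel; its limit agrees with \<open>w\<close>
  at the rationals, up to the value at 0, and hence on the interval by continuity.\<close>

lemma holo_ext_limit:
  assumes \<delta>: "\<delta> > 0" and w: "continuous_on {-\<delta><..<\<delta>} w"
    and ap: "\<And>X e. finite X \<Longrightarrow> X \<subseteq> {-\<delta><..<\<delta>} \<Longrightarrow> e > 0 \<Longrightarrow> \<exists>w'. holo_ext \<delta> K w' \<and> (\<forall>x\<in>X. \<bar>w' x - w x\<bar> < e)"
  shows "holo_ext \<delta> K w"
proof -
  define Q where "Q = \<rat> \<inter> {-\<delta><..<\<delta>}"
  have Q: "countable Q" "Q \<noteq> {}" unfolding Q_def using \<delta> countable_rat by (auto intro!: exI[of _ 0])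
  define d where "d = from_nat_into Q"
  have d: "d i \<in> {-\<delta><..<\<delta>}" for i using from_nat_into[OF Q(2)] unfolding d_def Q_def by blast
  have "\<exists>w'. holo_ext \<delta> K w' \<and> (\<forall>x\<in>insert 0 (d ` {..n}). \<bar>w' x - w x\<bar> < 1 / (real n + 1))" for n
    using d \<delta> by (intro ap) auto
  then obtain W where W: "\<And>n. holo_ext \<delta> K (W n)" "\<And>n x. x \<in> insert 0 (d ` {..n}) \<Longrightarrow> \<bar>W n x - w x\<bar> < 1 / (real n + 1)"
    by metis
  then obtain h where h: "\<And>n. h n holomorphic_on ball 0 \<delta>" "\<And>n \<zeta>. \<zeta> \<in> ball 0 \<delta> \<Longrightarrow> cmod (h n \<zeta>) \<le> K"
    "\<And>n x. \<bar>x\<bar> < \<delta> \<Longrightarrow> h n (of_real x) = of_real (W n x - W n 0)" unfolding holo_ext_def by metis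
  obtain g r where g: "g holomorphic_on ball 0 \<delta>" "strict_mono (r :: nat \<Rightarrow> nat)"
    "\<And>x. x \<in> ball 0 \<delta> \<Longrightarrow> ((\<lambda>n. h (r n) x) \<longlongrightarrow> g x) sequentially"
  proof (rule Montel[of "ball (0::complex) \<delta>" "range h" h])
    show "\<exists>B. \<forall>h\<in>range h. \<forall>z\<in>C. cmod (h z) \<le> B" if "compact C" "C \<subseteq> ball 0 \<delta>" for C
      using h(2) that(2) by blast
  qed (use h(1) in auto)
  have lim: "(\<lambda>n. W n x) \<longlonglongrightarrow> w x" if "eventually (\<lambda>n. x \<in> insert 0 (d ` {..n})) sequentially" for x
  proof -
    have "(\<lambda>n. W n x - w x) \<longlonglongrightarrow> 0"
    proof (rule Lim_null_comparison)
      show "eventually (\<lambda>n. norm (W n x - w x) \<le> 1 / (real n + 1)) sequentially"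
        using that by eventually_elim (use W(2) in \<open>auto intro: less_imp_le\<close>)
      show "(\<lambda>n. 1 / (real n + 1)) \<longlonglongrightarrow> 0" by real_asymp
    qed
    then show ?thesis by (simp add: LIM_zero_iff)
  qed
  have gQ: "g (of_real x) = of_real (w x - w 0)" if x: "x \<in> Q" for x
  proof -
    obtain i where i: "x = d i" using from_nat_into_surj[OF Q(1) x] unfolding d_def by metis
    have "(\<lambda>n. W n x) \<longlonglongrightarrow> w x"
      by (rule lim) (auto simp: eventually_sequentially i intro!: exI[of _ i])
    moreover have "(\<lambda>n. W n 0) \<longlonglongrightarrow> w 0" by (rule lim) simp
    ultimately have "(\<lambda>n. complex_of_real (W n x - W n 0)) \<longlonglongrightarrow> of_real (w x - w 0)" by (intro tendsto_intros)
    then have "(\<lambda>n. h n (of_real x)) \<longlonglongrightarrow> of_real (w x - w 0)" using h(3)[of x] x unfolding Q_def by (simp add: abs_less_iff)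
    then have "((\<lambda>n. h n (of_real x)) \<circ> r) \<longlonglongrightarrow> of_real (w x - w 0)" by (rule LIMSEQ_subseq_LIMSEQ[OF _ g(2)])
    moreover have "((\<lambda>n. h n (of_real x)) \<circ> r) \<longlonglongrightarrow> g (of_real x)" using g(3)[of "of_real x"] x unfolding Q_def o_def by (auto simp: abs_less_iff)
    ultimately show ?thesis using LIMSEQ_unique by blast
  qed
  define f where "f x = g (of_real x) - of_real (w x - w 0)" for x
  have cg: "continuous_on {-\<delta><..<\<delta>} (\<lambda>x. g (of_real x))"
  proof -
    have "of_real ` {-\<delta><..<\<delta>} \<subseteq> ball (0::complex) \<delta>" by auto
    from continuous_on_compose2[OF holomorphic_on_imp_continuous_on[OF g(1)] _ this] show ?thesis by (simp add: continuous_on_of_real_id)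
  qed
  have cf: "continuous_on {-\<delta><..<\<delta>} f" unfolding f_def by (intro continuous_intros cg w)
  have f0: "f x = 0" if x: "x \<in> {-\<delta><..<\<delta>}" for x
  proof (rule ccontr)
    assume "f x \<noteq> 0"
    have "open (f -` (- {0}) \<inter> {-\<delta><..<\<delta>})" using continuous_on_open_vimage[THEN iffD1, OF open_greaterThanLessThan cf] by blast
    moreover have "x \<in> f -` (- {0}) \<inter> {-\<delta><..<\<delta>}" using x \<open>f x \<noteq> 0\<close> by simp
    ultimately obtain e where e: "e > 0" "ball x e \<subseteq> f -` (- {0}) \<inter> {-\<delta><..<\<delta>}" unfolding open_contains_ball by blast
    obtain y where y: "y \<in> \<rat>" "x < y" "y < x + e" using Rats_dense_in_real[of x "x + e"] e(1) by auto
    then have "y \<in> f -` (- {0}) \<inter> {-\<delta><..<\<delta>}" using e(2) by (auto simp: dist_real_def subset_iff)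
    then show False using gQ[of y] y(1) unfolding f_def Q_def by simp
  qed
  show ?thesis unfolding holo_ext_def
  proof (intro exI[of _ g] conjI ballI allI impI g(1))
    show "cmod (g \<zeta>) \<le> K" if "\<zeta> \<in> ball 0 \<delta>" for \<zeta>
      using tendsto_norm[OF g(3)[OF that]] h(2)[OF that] by (intro LIMSEQ_le_const2) auto
    show "g (of_real x) = of_real (w x - w 0)" if "\<bar>x\<bar> < \<delta>" for x
      using f0[of x] that unfolding f_def by (simp add: abs_less_iff)
  qed
qed

text \<open>The combination is zero at 0, so the subtracted constants disappear and it extends
  holomorphically. Zero to the left of 0, it is zero on the whole disc, against \<open>pos\<close>.
  The three functions will be those of the perturbed potential, of the original one and of
  \<open>\<phi>0\<close>.\<close>

lemma holo_ext_flat: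
  assumes w: "holo_ext \<delta>1 K1 w1" "holo_ext \<delta>2 K2 w2" "holo_ext \<delta>3 K3 w3" and \<delta>: "\<delta>1 > 0" "\<delta>2 > 0" "\<delta>3 > 0" "e > 0"
    and 0: "\<And>x. -e < x \<Longrightarrow> x \<le> 0 \<Longrightarrow> a1 * w1 x + a2 * w2 x + a3 * w3 x = 0"
    and pos: "\<And>x. 0 < x \<Longrightarrow> x < e \<Longrightarrow> a1 * w1 x + a2 * w2 x + a3 * w3 x \<noteq> 0"
  shows False
proof -
  define \<delta> where "\<delta> = min \<delta>1 (min \<delta>2 (min \<delta>3 e))"
  have d: "\<delta> > 0" "\<delta> \<le> \<delta>1" "\<delta> \<le> \<delta>2" "\<delta> \<le> \<delta>3" "\<delta> \<le> e" using \<delta> unfolding \<delta>_def by auto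
  obtain h1 where h1: "h1 holomorphic_on ball 0 \<delta>1" "\<And>x. \<bar>x\<bar> < \<delta>1 \<Longrightarrow> h1 (of_real x) = of_real (w1 x - w1 0)" using w(1) unfolding holo_ext_def by blast
  obtain h2 where h2: "h2 holomorphic_on ball 0 \<delta>2" "\<And>x. \<bar>x\<bar> < \<delta>2 \<Longrightarrow> h2 (of_real x) = of_real (w2 x - w2 0)" using w(2) unfolding holo_ext_def by blast
  obtain h3 where h3: "h3 holomorphic_on ball 0 \<delta>3" "\<And>x. \<bar>x\<bar> < \<delta>3 \<Longrightarrow> h3 (of_real x) = of_real (w3 x - w3 0)" using w(3) unfolding holo_ext_def by blast
  define h where "h z = of_real a1 * h1 z + of_real a2 * h2 z + of_real a3 * h3 z" for z
  have hh: "h holomorphic_on ball 0 \<delta>" unfolding h_def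
    using d by (intro holomorphic_intros holomorphic_on_subset[OF h1(1)] holomorphic_on_subset[OF h2(1)] holomorphic_on_subset[OF h3(1)]) auto
  have "a1 * w1 0 + a2 * w2 0 + a3 * w3 0 = 0" using 0[of 0] \<delta> by simp
  then have c0: "a1 * (w1 x - w1 0) + a2 * (w2 x - w2 0) + a3 * (w3 x - w3 0) = a1 * w1 x + a2 * w2 x + a3 * w3 x" for x
    by (simp add: algebra_simps)
  have hx: "h (of_real x) = of_real (a1 * w1 x + a2 * w2 x + a3 * w3 x)" if "\<bar>x\<bar> < \<delta>" for x
    using that d h1(2)[of x] h2(2)[of x] h3(2)[of x] unfolding h_def c0[symmetric] by simp
  have lim: "(0::complex) islimpt of_real ` {-\<delta><..<0}"
    unfolding islimpt_approachable
  proof (intro allI impI)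
    fix t :: real assume t: "t > 0"
    define y where "y = - min \<delta> t / 2"
    have y: "-\<delta> < y" "y < 0" "\<bar>y\<bar> < t" using t d(1) unfolding y_def by (auto simp: min_def)
    then have "complex_of_real y \<in> complex_of_real ` {-\<delta><..<0}" by (intro imageI) simp
    then show "\<exists>x'\<in>complex_of_real ` {-\<delta><..<0}. x' \<noteq> 0 \<and> dist x' 0 < t"
      using y by (intro bexI[of _ "of_real y"]) auto
  qed
  have "h (of_real (\<delta> / 2)) = 0"
  proof (rule analytic_continuation[OF hh, of "of_real ` {-\<delta><..<0}" 0])
    show "h z = 0" if z: "z \<in> of_real ` {-\<delta><..<0}" for z
    proof -
      obtain x where x: "z = of_real x" "-\<delta> < x" "x < 0" using z by auto
      show ?thesis unfolding x(1) using hx[of x] 0[of x] x d by simp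
    qed
  qed (use d lim in \<open>auto simp: connected_ball\<close>)
  then show False using hx[of "\<delta> / 2"] pos[of "\<delta> / 2"] d by (simp del: of_real_add of_real_mult)
qed

subsection \<open>The smooth topology\<close>

context smooth_mfd begin

lemma openin_point_nhd:
  fixes f :: "'a \<Rightarrow> real"
  assumes "mfd_smooth A f" "e > 0"
  shows "openin (smooth_topology A) {g. mfd_smooth A g \<and> \<bar>g y - f y\<bar> < e}"
proof -
  obtain U \<phi> where U: "(U, \<phi>) \<in> A" "y \<in> U" by (rule chart_cover)
  have "{g. mfd_smooth A g \<and> \<bar>g y - f y\<bar> < e} = {g. mfd_smooth A g \<and>
          (\<forall>x\<in>{\<phi> y}. \<bar>iter_partial [] (g \<circ> inv_into U \<phi>) x - iter_partial [] (f \<circ> inv_into U \<phi>) x\<bar> < e)}"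
    using chart_inv(3)[OF U] by simp
  then show ?thesis unfolding smooth_topology_def using assms U
    by (intro topology_generated_by_Basis CollectI exI[of _ f] exI[of _ U] exI[of _ \<phi>] exI[of _ "{\<phi> y}"] exI[of _ "[]"] exI[of _ e]) auto
qed

lemma openin_finite_nhd:
  fixes f :: "'a \<Rightarrow> real"
  assumes f: "mfd_smooth A f" "e > 0" and Y: "finite Y"
  shows "openin (smooth_topology A) {g. mfd_smooth A g \<and> (\<forall>y\<in>Y. \<bar>g y - f y\<bar> < e)}"
  using Y
proof induction
  case empty
  then show ?case using openin_topspace[of "smooth_topology A"] topspace_smooth_topology[OF atlas] by simp
next
  case (insert y Y)
  have "{g. mfd_smooth A g \<and> (\<forall>y\<in>insert y Y. \<bar>g y - f y\<bar> < e)} =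
    {g. mfd_smooth A g \<and> \<bar>g y - f y\<bar> < e} \<inter> {g. mfd_smooth A g \<and> (\<forall>y\<in>Y. \<bar>g y - f y\<bar> < e)}" by auto
  then show ?case using insert.IH openin_point_nhd[OF f] by auto
qed

text \<open>It suffices to treat subbasic sets, where the iterated derivative is affine in
  \<open>t\<close>. Compactness of \<open>K\<close> leaves a gap below \<open>e\<close>, and a bound
  on the derivative of \<open>\<psi>\<close> turns the gap into a bound on \<open>t\<close>.\<close>

lemma line_continuous:
  fixes f \<psi> :: "'a \<Rightarrow> real"
  assumes W: "openin (smooth_topology A) W" and f: "f \<in> W" and \<psi>: "mfd_smooth A \<psi>"
  shows "\<exists>d>0. \<forall>t. \<bar>t\<bar> < d \<longrightarrow> (\<lambda>x. f x + t * \<psi> x) \<in> W"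
proof -
  have fs: "mfd_smooth A f" using openin_subset[OF W] f topspace_smooth_topology[OF atlas] by auto
  have "generate_topology_on {{g. mfd_smooth A g \<and>
          (\<forall>x\<in>K. \<bar>iter_partial is (g \<circ> inv_into U \<phi>) x - iter_partial is (f \<circ> inv_into U \<phi>) x\<bar> < e)}
      | (f :: 'a \<Rightarrow> real) U \<phi> K is e.
        mfd_smooth A f \<and> (U, \<phi>) \<in> A \<and> compact K \<and> K \<subseteq> \<phi> ` U \<and> e > 0} W"
    using W unfolding smooth_topology_def by (rule openin_topology_generated_by)
  then show ?thesis using f
  proof induction
    case (Int a b)
    then obtain d1 d2 where "d1 > 0" "\<forall>t. \<bar>t\<bar> < d1 \<longrightarrow> (\<lambda>x. f x + t * \<psi> x) \<in> a"
      "d2 > 0" "\<forall>t. \<bar>t\<bar> < d2 \<longrightarrow> (\<lambda>x. f x + t * \<psi> x) \<in> b" by blast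
    then show ?case by (intro exI[of _ "min d1 d2"]) auto
  next
    case (UN K)
    then show ?case by blast
  next
    case (Basis s)
    then obtain g :: "'a \<Rightarrow> real" and U \<phi> K "is" e where s: "s = {h. mfd_smooth A h \<and>
          (\<forall>x\<in>K. \<bar>iter_partial is (h \<circ> inv_into U \<phi>) x - iter_partial is (g \<circ> inv_into U \<phi>) x\<bar> < e)}"
      and g: "mfd_smooth A g" "(U, \<phi>) \<in> A" "compact K" "K \<subseteq> \<phi> ` U" "e > 0" by blast
    note O = chart_homeo(2)[OF g(2)]
    define a where "a x = \<bar>iter_partial is (f \<circ> inv_into U \<phi>) x - iter_partial is (g \<circ> inv_into U \<phi>) x\<bar>" for x
    define b where "b x = \<bar>iter_partial is (\<psi> \<circ> inv_into U \<phi>) x\<bar>" for x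
    have sm: "continuous_on K (iter_partial is (h \<circ> inv_into U \<phi>))" if "mfd_smooth A h" for h :: "'a \<Rightarrow> real"
      by (rule continuous_on_subset[OF smooth_on_continuous_on[OF smooth_on_iter[OF sm_chart[OF that g(2)]]] g(4)])
    have ca: "continuous_on K a" unfolding a_def[abs_def] by (intro continuous_intros sm fs g)
    have cb: "continuous_on K b" unfolding b_def[abs_def] by (intro continuous_intros sm \<psi>)
    have "\<exists>m<e. \<forall>x\<in>K. a x \<le> m"
    proof (cases "K = {}")
      case False
      then obtain x where x: "x \<in> K" "\<And>y. y \<in> K \<Longrightarrow> a y \<le> a x" using continuous_attains_sup[OF g(3) _ ca] by blast
      have "a x < e" using Basis.prems x(1) unfolding s a_def by auto
      then show ?thesis using x(2) by blast
    qed (use g(5) in \<open>auto intro!: exI[of _ 0]\<close>)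
    then obtain m where m: "m < e" "\<And>x. x \<in> K \<Longrightarrow> a x \<le> m" by blast
    obtain B where B: "B > 0" "\<And>x. x \<in> K \<Longrightarrow> b x \<le> B"
    proof -
      have "bounded (b ` K)" by (intro compact_imp_bounded compact_continuous_image cb g)
      then obtain B where "B > 0" "\<forall>y\<in>b ` K. norm y \<le> B" using bounded_pos by blast
      then show ?thesis using that[of B] by force
    qed
    show ?case
    proof (intro exI[of _ "(e - m) / B"] conjI allI impI)
      show "(e - m) / B > 0" using m B by simp
      fix t :: real assume t: "\<bar>t\<bar> < (e - m) / B"
      have "\<bar>iter_partial is ((\<lambda>x. f x + t * \<psi> x) \<circ> inv_into U \<phi>) x - iter_partial is (g \<circ> inv_into U \<phi>) x\<bar> < e" if x: "x \<in> K" for x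
      proof -
        have xO: "x \<in> \<phi> ` U" using x g(4) by blast
        have tp: "smooth_on (\<phi> ` U) (\<lambda>y. t * (\<psi> \<circ> inv_into U \<phi>) y)"
          by (intro smooth_on_mult O smooth_on_const sm_chart[OF \<psi> g(2)])
        have "iter_partial is ((\<lambda>x. f x + t * \<psi> x) \<circ> inv_into U \<phi>) x = iter_partial is (f \<circ> inv_into U \<phi>) x + t * iter_partial is (\<psi> \<circ> inv_into U \<phi>) x"
          using iter_partial_add[OF O sm_chart[OF fs g(2)] tp xO, of "is"] iter_partial_linear[OF O sm_chart[OF \<psi> g(2)] bounded_linear_mult_right xO, of "is" t]
          by (simp add: o_def)
        then have "\<bar>iter_partial is ((\<lambda>x. f x + t * \<psi> x) \<circ> inv_into U \<phi>) x - iter_partial is (g \<circ> inv_into U \<phi>) x\<bar> \<le> a x + \<bar>t\<bar> * b x"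
          unfolding a_def b_def by (simp flip: abs_mult)
        also have "\<dots> \<le> m + \<bar>t\<bar> * B" using m(2)[OF x] B(2)[OF x] by (intro add_mono mult_left_mono) auto
        also have "\<dots> < e" using t B(1) by (simp add: pos_less_divide_eq algebra_simps)
        finally show ?thesis .
      qed
      moreover have "mfd_smooth A (\<lambda>x. f x + t * \<psi> x)" by (intro sm_intros fs \<psi>)
      ultimately show "(\<lambda>x. f x + t * \<psi> x) \<in> s" unfolding s by blast
    qed
  qed simp
qed

end

section \<open>Unpacking a sphere embedding, and classes modulo constants\<close>

context cr_mfd begin

lemma induced_data:
  assumes "induced_by_weighted_sphere A L T"
  obtains N :: nat and \<beta> :: "nat \<Rightarrow> real" and F :: "'a \<Rightarrow> nat \<Rightarrow> complex"
    where "\<And>j. j < N \<Longrightarrow> \<beta> j > 0" "\<And>j. j < N \<Longrightarrow> mfd_smooth A (\<lambda>x. F x j)"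
    "\<And>p v j. v \<in> L p \<Longrightarrow> j < N \<Longrightarrow> v (\<lambda>x. cnj (F x j)) = 0"
    "\<And>p j. j < N \<Longrightarrow> T p (\<lambda>x. F x j) = \<i> * of_real (\<beta> j) * F p j"
    "\<And>p. (\<Sum>j<N. (cmod (F p j))\<^sup>2) = 1"
    "\<And>p v. v \<in> ctangent A p \<Longrightarrow> \<forall>j<N. v (\<lambda>x. F x j) = 0 \<Longrightarrow> vconj v \<in> L p"
proof -
  obtain N \<beta> F where b: "\<forall>j<N. \<beta> j > 0" and e: "smooth_embedding A N F"
    and i: "\<forall>p. pushforward F N ` L p = pushforward F N ` ctangent A p \<inter> T10_space N"
    and n: "\<forall>p. L2_set (\<lambda>j. cmod (F p j)) {..<N} = 1"
    and t: "\<forall>p. pushforward F N (T p) = weighted_field N \<beta> (F p)"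
    using assms unfolding induced_by_weighted_sphere_def by blast
  show thesis
  proof (rule that[of N \<beta> F])
    show "\<beta> j > 0" "mfd_smooth A (\<lambda>x. F x j)" if "j < N" for j using b e that unfolding smooth_embedding_def by auto
    show "v (\<lambda>x. cnj (F x j)) = 0" if v: "v \<in> L p" "j < N" for p v j
    proof -
      have "pushforward F N v \<in> T10_space N" using i v(1) by blast
      then have "snd (pushforward F N v) j = 0" unfolding T10_space_def by auto
      then show ?thesis using v(2) by (simp add: pushforward_def)
    qed
    show "T p (\<lambda>x. F x j) = \<i> * of_real (\<beta> j) * F p j" if "j < N" for p j
    proof -
      have "fst (pushforward F N (T p)) j = fst (weighted_field N \<beta> (F p)) j" using t by simp
      then show ?thesis using that by (simp add: pushforward_def weighted_field_def)
    qed
    show "(\<Sum>j<N. (cmod (F p j))\<^sup>2) = 1" for p using n unfolding L2_set_def by simp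
    \<comment> \<open>The conjugate of such a \<open>v\<close> has an image of type (1,0), hence the
      same image as some vector of \<open>L\<close>; injectivity of the differential identifies the
      two.\<close>
    show "vconj v \<in> L p" if v: "v \<in> ctangent A p" and z: "\<forall>j<N. v (\<lambda>x. F x j) = 0" for p v
    proof -
      have "pushforward F N (vconj v) \<in> T10_space N"
        unfolding T10_space_def pushforward_def complex_space_def by (auto simp: vconj_def z)
      then have "pushforward F N (vconj v) \<in> pushforward F N ` L p" using i vconj_ctangent[OF v] by blast
      then obtain l where l: "l \<in> L p" "pushforward F N (vconj v) = pushforward F N l" by blast
      have "inj_on (pushforward F N) (ctangent A p)" using e unfolding smooth_embedding_def by blast
      from inj_onD[OF this l(2) vconj_ctangent[OF v] L_sub[OF l(1)]] show ?thesis using l(1) by simp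
    qed
  qed
qed

lemma admissible_iff: "\<phi> \<in> admissible A L T \<longleftrightarrow> tinv \<phi> \<and> strictly_pseudoconvex A (deform L T \<phi>)"
  unfolding admissible_def tinv_def by auto

end

lemma const_class_eq: "const_class \<phi> = const_class \<psi> \<longleftrightarrow> (\<exists>c. \<forall>x. \<psi> x = \<phi> x + c)"
proof
  assume "const_class \<phi> = const_class \<psi>"
  moreover have "\<psi> \<in> const_class \<psi>" unfolding const_class_def by (auto intro!: exI[of _ 0])
  ultimately have "\<psi> \<in> const_class \<phi>" by simp
  then show "\<exists>c. \<forall>x. \<psi> x = \<phi> x + c" unfolding const_class_def by auto
next
  assume "\<exists>c. \<forall>x. \<psi> x = \<phi> x + c"
  then obtain c where c: "\<psi> = (\<lambda>x. \<phi> x + c)" by blast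
  have "(\<lambda>x. \<phi> x + d) \<in> const_class \<psi>" for d
    unfolding const_class_def c by (auto intro!: exI[of _ "d - c"])
  moreover have "(\<lambda>x. \<psi> x + d) \<in> const_class \<phi>" for d
    unfolding const_class_def c by (auto intro!: exI[of _ "c + d"])
  ultimately show "const_class \<phi> = const_class \<psi>" unfolding const_class_def[of \<phi>] const_class_def[of \<psi>] by auto
qed

lemma first_category_in_empty: "first_category_in Y {}"
  unfolding first_category_in_def nowhere_dense_in_def by (intro exI[of _ "\<lambda>_. {}"]) (simp add: interior_of_empty)

subsection \<open>Induced potentials are analytic along the disc\<close>

context cr_sphere begin

text \<open>The disc, given by \<open>q\<close> and \<open>s\<close>, is independent of the
  potential; only the index \<open>k\<close> depends on it. The embedding is unpacked in the
  deformed structure and its components are returned to the base structure by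
  \<open>crf_deform\<close>.\<close>

lemma induced_analytic:
  assumes f: "tinv f" and ind: "induced_by_weighted_sphere A (deform L T f) T"
    and r: "r > 0" and s: "continuous_on (ball 0 r) s" and fq: "continuous_on (ball 0 r) (\<lambda>\<zeta>. f (q \<zeta>))"
    and hol: "\<And>\<gamma> h. crf \<gamma> h \<Longrightarrow> (\<lambda>\<zeta>. of_real (exp (- \<gamma> * s \<zeta>)) * h (q \<zeta>)) holomorphic_on ball 0 r"
  obtains k :: nat where "holo_ext (1 / (real k + 1)) (real k + 1) (\<lambda>x. f (q (of_real x)) + s (of_real x))"
proof -
  interpret D: cr_mfd A "deform L T f" T by (rule deform_cr[OF f])
  obtain M :: nat and \<gamma> :: "nat \<Rightarrow> real" and G :: "'a \<Rightarrow> nat \<Rightarrow> complex"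
    where G: "\<And>j. j < M \<Longrightarrow> \<gamma> j > 0" "\<And>j. j < M \<Longrightarrow> mfd_smooth A (\<lambda>x. G x j)"
    "\<And>p v j. v \<in> deform L T f p \<Longrightarrow> j < M \<Longrightarrow> v (\<lambda>x. cnj (G x j)) = 0"
    "\<And>p j. j < M \<Longrightarrow> T p (\<lambda>x. G x j) = \<i> * of_real (\<gamma> j) * G p j"
    "\<And>p. (\<Sum>j<M. (cmod (G p j))\<^sup>2) = 1"
    "\<And>p v. v \<in> ctangent A p \<Longrightarrow> \<forall>j<M. v (\<lambda>x. G x j) = 0 \<Longrightarrow> vconj v \<in> deform L T f p"
    by (rule D.induced_data[OF ind]) (rule that)
  define h where "h j \<zeta> = complex_of_real (exp (- \<gamma> j * s \<zeta>)) * (of_real (exp (- \<gamma> j * f (q \<zeta>))) * G (q \<zeta>) j)" for j \<zeta>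
  have h: "h j holomorphic_on ball 0 r" if "j < M" for j
    unfolding h_def
  proof (rule hol, rule crf_deform[OF f G(2)[OF that]])
    show "v (\<lambda>x. cnj (G x j)) = 0" if v: "v \<in> deform L T f p" for p v by (rule G(3)[OF v \<open>j < M\<close>])
    show "T p (\<lambda>x. G x j) = \<i> * of_real (\<gamma> j) * G p j" for p by (rule G(4)[OF that])
  qed
  define u where "u x = f (q (of_real x)) + s (of_real x)" for x :: real
  \<comment> \<open>The factor exp (2 \<gamma> u) undoes both exponentials in \<open>h\<close>; what
    remains is the sphere equation for \<open>G\<close>.\<close>
  have eq: "(\<Sum>j<M. exp (2 * \<gamma> j * u x) * (cmod (h j (of_real x)))\<^sup>2) = 1" for x
  proof -
    have "exp (2 * \<gamma> j * u x) * (cmod (h j (of_real x)))\<^sup>2 = (cmod (G (q (of_real x)) j))\<^sup>2" for j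
    proof -
      have "(cmod (h j (of_real x)))\<^sup>2 = (exp (- \<gamma> j * s (of_real x)) * exp (- \<gamma> j * f (q (of_real x))))\<^sup>2 * (cmod (G (q (of_real x)) j))\<^sup>2"
        by (simp add: h_def norm_mult power_mult_distrib)
      also have "(exp (- \<gamma> j * s (of_real x)) * exp (- \<gamma> j * f (q (of_real x))))\<^sup>2 = exp (- 2 * \<gamma> j * u x)"
        unfolding exp_add[symmetric] exp_double[symmetric] u_def by (simp add: algebra_simps)
      finally show ?thesis by (simp add: exp_minus)
    qed
    then show ?thesis using G(5) by simp
  qed
  have u: "continuous (at 0) u"
  proof -
    have "continuous (at 0) (\<lambda>\<zeta>. f (q \<zeta>) + s \<zeta>)"
      using continuous_on_interior[OF continuous_on_add[OF fq s], of 0] r by simp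
    then have "((\<lambda>\<zeta>. f (q \<zeta>) + s \<zeta>) \<longlongrightarrow> f (q 0) + s 0) (at (of_real 0))" by (simp add: continuous_at)
    then have "((\<lambda>x. f (q (of_real x)) + s (of_real x)) \<longlongrightarrow> f (q 0) + s 0) (at (0::real))"
      by (rule tendsto_compose_at[OF _ _ , of of_real, unfolded o_def, rotated]) (auto intro!: tendsto_eq_intros)
    then show ?thesis by (simp add: continuous_at u_def[abs_def])
  qed
  obtain \<delta> \<upsilon> where "\<delta> > 0" "\<upsilon> holomorphic_on ball 0 \<delta>" "\<And>x. \<bar>x\<bar> < \<delta> \<Longrightarrow> \<upsilon> (of_real x) = complex_of_real (u x)"
    by (rule implicit_holomorphic[OF r G(1) h u eq]) (assumption | rule that)+
  then obtain k :: nat where "holo_ext (1 / (real k + 1)) (real k + 1) u" by (rule holo_extI)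
  then show thesis using that unfolding u_def by blast
qed

text \<open>The disc leaves \<open>p\<close> in a direction in which some \<open>rho j\<close>
  increases, and the flat profile is switched on exactly at the value \<open>rho j p\<close>. Along
  the diameter \<open>g\<close> is therefore zero up to 0 and nonzero right after.\<close>

lemma analytic_conditions:
  obtains r :: real and q :: "complex \<Rightarrow> 'a" and s :: "complex \<Rightarrow> real" and g :: "'a \<Rightarrow> real" and e :: real where
    "r > 0" "continuous_on (ball 0 r) s" "\<And>f :: 'a \<Rightarrow> real. mfd_smooth A f \<Longrightarrow> continuous_on (ball 0 r) (\<lambda>\<zeta>. f (q \<zeta>))"
    "\<And>\<gamma> h. crf \<gamma> h \<Longrightarrow> (\<lambda>\<zeta>. of_real (exp (- \<gamma> * s \<zeta>)) * h (q \<zeta>)) holomorphic_on ball 0 r"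
    "good g" "e > 0" "\<And>x. - e < x \<Longrightarrow> x \<le> 0 \<Longrightarrow> g (q (of_real x)) = 0" "\<And>x. 0 < x \<Longrightarrow> x < e \<Longrightarrow> g (q (of_real x)) \<noteq> 0"
proof -
  obtain p j v0 where j: "j < N" and v0: "v0 \<in> ctangent A p" "v0 (cf (rho j)) \<noteq> 0" by (rule rho_nonconstant)
  obtain U \<phi> where U: "(U, \<phi>) \<in> A" "p \<in> U" by (rule chart_cover)
  define D where "D v = (\<Sum>k\<in>UNIV. v $ k * pder k (rho j \<circ> inv_into U \<phi>) (\<phi> p))" for v :: "real^'m"
  note rs = rho_sm[OF j]
  have cD: "chart_vec A U \<phi> p v (cf (rho j)) = of_real (D v)" for v
    using msm_of_real[OF open_UNIV rs] pder_of_real[OF U rs] by (simp add: chart_vec_def D_def scaleR_conv_of_real)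
  obtain a b where "v0 = vadd (chart_vec A U \<phi> p a) (vscale \<i> (chart_vec A U \<phi> p b))"
    using span U v0(1) unfolding spanned_def by blast
  then have "D a \<noteq> 0 \<or> D b \<noteq> 0" using v0(2) by (auto simp: vdefs cD)
  then obtain v1 where v1: "D v1 \<noteq> 0" by blast
  \<comment> \<open>Reversing the direction if necessary makes the derivative positive.\<close>
  have "D (- v1) = - D v1" by (simp add: D_def sum_negf)
  then obtain v where v: "D v > 0" using v1 by (metis neg_0_less_iff_less not_less_iff_gr_or_eq)
  obtain r :: real and q :: "complex \<Rightarrow> 'a" and s :: "complex \<Rightarrow> real" where d:
    "r > 0" "q 0 = p" "s 0 = 0" "continuous_on (ball 0 r) s"
    "\<And>f :: 'a \<Rightarrow> real. mfd_smooth A f \<Longrightarrow> continuous_on (ball 0 r) (\<lambda>\<zeta>. f (q \<zeta>))"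
    "\<And>\<gamma> h. crf \<gamma> h \<Longrightarrow> (\<lambda>\<zeta>. of_real (exp (- \<gamma> * s \<zeta>)) * h (q \<zeta>)) holomorphic_on ball 0 r"
    "\<And>f :: 'a \<Rightarrow> real. mfd_smooth A f \<Longrightarrow> ((\<lambda>x. f (q (of_real x))) has_real_derivative (\<Sum>k\<in>UNIV. v $ k * pder k (f \<circ> inv_into U \<phi>) (\<phi> p))) (at 0)"
    by (rule disc[OF U, where v = v]) (rule that)
  define w where "w x = rho j (q (of_real x))" for x :: real
  have dw: "(w has_real_derivative D v) (at 0)" using d(7)[OF rs] unfolding w_def D_def .
  have w0: "w 0 = rho j p" by (simp add: w_def d(2))
  obtain d1 where d1: "d1 > 0" "\<And>h. h > 0 \<Longrightarrow> h < d1 \<Longrightarrow> w 0 < w (0 + h)" using DERIV_pos_inc_right[OF dw v] by blast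
  obtain d2 where d2: "d2 > 0" "\<And>h. h > 0 \<Longrightarrow> h < d2 \<Longrightarrow> w (0 - h) < w 0" using DERIV_pos_inc_left[OF dw v] by blast
  obtain \<epsilon> where \<epsilon>: "\<epsilon> > 0" "good (\<lambda>x. \<epsilon> * flat 0 (rho j x - rho j p))" using good_flat[OF j, of "rho j p" thesis] by blast
  show thesis
  proof (rule that[where e = "min d1 d2", OF d(1,4,5,6) \<epsilon>(2)])
    show "min d1 d2 > 0" using d1 d2 by simp
    show "\<epsilon> * flat 0 (rho j (q (of_real x)) - rho j p) = 0" if "- min d1 d2 < x" "x \<le> 0" for x
    proof -
      have "w x \<le> w 0" using d2(2)[of "- x"] that by (cases "x = 0") (auto simp: less_imp_le)
      then show ?thesis unfolding w0 by (simp add: w_def flat_def)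
    qed
    show "\<epsilon> * flat 0 (rho j (q (of_real x)) - rho j p) \<noteq> 0" if "0 < x" "x < min d1 d2" for x
    proof -
      have "w x > w 0" using d1(2)[of x] that by auto
      then show ?thesis using \<epsilon>(1) unfolding w0 by (simp add: w_def flat_def)
    qed
  qed
qed

end

section \<open>The category argument in the quotient\<close>

theorem theorem1p17:
  fixes A :: "('a::{t2_space,second_countable_topology}, 'm::finite) atlas"
    and n :: nat
    and L :: "'a \<Rightarrow> 'a cvec set"
    and T :: "'a \<Rightarrow> 'a cvec"
  assumes "sasakian A n L T"
    and "compact (UNIV :: 'a set)"
  shows "first_category_in (moduli A L T) (sphere_induced A L T)"
proof (cases "\<exists>\<phi>. \<phi> \<in> admissible A L T \<and> induced_by_weighted_sphere A (deform L T \<phi>) T")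
  case False
  then have "sphere_induced A L T = {}" unfolding sphere_induced_def by blast
  then show ?thesis by (simp add: first_category_in_empty)
next
  case True
  interpret X: cr_mfd A L T by (rule sasakian_cr_mfd[OF assms])
  obtain \<phi>0 where \<phi>0: "\<phi>0 \<in> admissible A L T" "induced_by_weighted_sphere A (deform L T \<phi>0) T" using True by blast
  have t0: "X.tinv \<phi>0" using \<phi>0(1) unfolding X.admissible_iff by blast
  \<comment> \<open>New origin: potentials are measured from \<open>\<phi>0\<close> through
    \<open>sub\<close>, so that the known embedding belongs to the base structure.\<close>
  define L0 where "L0 = deform L T \<phi>0"
  interpret Y: cr_mfd A L0 T unfolding L0_def by (rule X.deform_cr[OF t0])
  obtain N :: nat and \<beta> :: "nat \<Rightarrow> real" and F :: "'a \<Rightarrow> nat \<Rightarrow> complex"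
    where F: "\<And>j. j < N \<Longrightarrow> \<beta> j > 0" "\<And>j. j < N \<Longrightarrow> mfd_smooth A (\<lambda>x. F x j)"
    "\<And>p v j. v \<in> L0 p \<Longrightarrow> j < N \<Longrightarrow> v (\<lambda>x. cnj (F x j)) = 0"
    "\<And>p j. j < N \<Longrightarrow> T p (\<lambda>x. F x j) = \<i> * of_real (\<beta> j) * F p j"
    "\<And>p. (\<Sum>j<N. (cmod (F p j))\<^sup>2) = 1"
    "\<And>p v. v \<in> ctangent A p \<Longrightarrow> \<forall>j<N. v (\<lambda>x. F x j) = 0 \<Longrightarrow> vconj v \<in> L0 p"
    by (rule Y.induced_data[OF \<phi>0(2)[folded L0_def]]) (rule that)
  interpret S: cr_sphere A L0 T N \<beta> F
  proof unfold_locales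
    show "Y.crf (\<beta> j) (\<lambda>x. F x j)" if "j < N" for j unfolding Y.crf_def using F(2,3,4) that by blast
  qed (use F in blast)+
  obtain r :: real and q :: "complex \<Rightarrow> 'a" and s :: "complex \<Rightarrow> real" and g :: "'a \<Rightarrow> real" and e :: real where d:
    "r > 0" "continuous_on (ball 0 r) s" "\<And>f :: 'a \<Rightarrow> real. mfd_smooth A f \<Longrightarrow> continuous_on (ball 0 r) (\<lambda>\<zeta>. f (q \<zeta>))"
    "\<And>\<gamma> h. Y.crf \<gamma> h \<Longrightarrow> (\<lambda>\<zeta>. of_real (exp (- \<gamma> * s \<zeta>)) * h (q \<zeta>)) holomorphic_on ball 0 r"
    "Y.good g" "e > 0" "\<And>x. - e < x \<Longrightarrow> x \<le> 0 \<Longrightarrow> g (q (of_real x)) = 0" "\<And>x. 0 < x \<Longrightarrow> x < e \<Longrightarrow> g (q (of_real x)) \<noteq> 0"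
    by (rule S.analytic_conditions) (rule that)
  have gt: "Y.tinv g" using d(5) unfolding Y.good_def by blast
  define sub where "sub \<phi> x = \<phi> x - \<phi>0 x" for \<phi> :: "'a \<Rightarrow> real" and x
  have tsub: "Y.tinv (sub \<phi>)" if "X.tinv \<phi>" for \<phi>
    using X.tinv_comb(1)[OF that t0, of 1 "-1"] unfolding sub_def[abs_def] by simp
  have dsub: "deform L0 T (sub \<phi>) = deform L T \<phi>" if "X.tinv \<phi>" for \<phi>
    unfolding L0_def X.deform_deform[OF t0 tsub[OF that]] by (simp add: sub_def)
  define w where "w \<phi> x = sub \<phi> (q (of_real x)) + s (of_real x)" for \<phi> and x :: real
  \<comment> \<open>Capped by \<open>r\<close>, so that \<open>w \<phi>\<close> is continuous on the
    whole interval, as \<open>holo_ext_limit\<close> demands.\<close>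
  define \<delta> where "\<delta> k = min r (1 / (real k + 1))" for k :: nat
  have \<delta>: "\<delta> k > 0" "\<delta> k \<le> r" for k unfolding \<delta>_def using d(1) by auto
  \<comment> \<open>The condition no longer mentions an embedding, only a bounded extension of
    controlled radius; in this form it survives limits.\<close>
  define C where "C k = {\<phi> \<in> admissible A L T. holo_ext (\<delta> k) (real k + 1) (w \<phi>)}" for k :: nat
  have C_analytic: "\<exists>k. \<phi> \<in> C k" if \<phi>: "\<phi> \<in> admissible A L T" "induced_by_weighted_sphere A (deform L T \<phi>) T" for \<phi>
  proof -
    have t: "X.tinv \<phi>" using \<phi>(1) unfolding X.admissible_iff by blast
    obtain k :: nat where "holo_ext (1 / (real k + 1)) (real k + 1) (\<lambda>x. sub \<phi> (q (of_real x)) + s (of_real x))"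
      using S.induced_analytic[OF tsub[OF t] _ d(1,2) d(3)[OF Y.tinvD(1)[OF tsub[OF t]]] d(4)] \<phi>(2) unfolding dsub[OF t] by metis
    then have "holo_ext (\<delta> k) (real k + 1) (\<lambda>x. sub \<phi> (q (of_real x)) + s (of_real x))"
      by (rule holo_ext_mono) (simp add: \<delta>_def)
    then show ?thesis using \<phi>(1) unfolding C_def w_def[abs_def] by blast
  qed
  \<comment> \<open>\<open>C k\<close> is saturated within the admissible potentials, which
    transfers closedness to the quotient.\<close>
  have sat: "\<psi> \<in> C k" if C: "\<phi> \<in> C k" "\<psi> \<in> admissible A L T" "const_class \<phi> = const_class \<psi>" for \<phi> \<psi> k
  proof -
    obtain c where "\<And>x. \<psi> x = \<phi> x + c" using C(3) unfolding const_class_eq by blast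
    then have "w \<phi> x - w \<phi> 0 = w \<psi> x - w \<psi> 0" for x unfolding w_def sub_def by simp
    then show ?thesis using holo_ext_cong[of "w \<phi>" "w \<psi>"] C(1,2) unfolding C_def by blast
  qed
  let ?Y = "subtopology (smooth_topology A) (admissible A L T)"
  have tY: "topspace ?Y = admissible A L T"
    using topspace_smooth_topology[OF X.atlas] by (auto simp: admissible_def)
  have wc: "continuous_on {-\<delta> k<..<\<delta> k} (w \<phi>)" if "X.tinv \<phi>" for \<phi> k
  proof -
    have "complex_of_real ` {-\<delta> k<..<\<delta> k} \<subseteq> ball 0 r" using \<delta>(2)[of k] by auto
    from continuous_on_compose2[OF continuous_on_add[OF d(3)[OF Y.tinvD(1)[OF tsub[OF that]]] d(2)] continuous_on_of_real_id this]
    show ?thesis unfolding w_def[abs_def] .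
  qed
  have openC: "openin ?Y (admissible A L T - C k)" for k
  proof (subst openin_subopen, intro ballI)
    fix \<phi> assume \<phi>: "\<phi> \<in> admissible A L T - C k"
    have t: "X.tinv \<phi>" using DiffD1[OF \<phi>] unfolding X.admissible_iff by blast
    have nh: "\<not> holo_ext (\<delta> k) (real k + 1) (w \<phi>)" using \<phi> unfolding C_def by blast
    have fs: "mfd_smooth A \<phi>" by (rule X.tinvD(1)[OF t])
    \<comment> \<open>Contrapositive of \<open>holo_ext_limit\<close>: failure is detected at
      finitely many points up to a tolerance, which is an open condition.\<close>
    have "\<exists>X e. finite X \<and> e > 0 \<and> (\<forall>w'. holo_ext (\<delta> k) (real k + 1) w' \<longrightarrow> \<not> (\<forall>x\<in>X. \<bar>w' x - w \<phi> x\<bar> < e))"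
      using nh holo_ext_limit[OF \<delta>(1) wc[OF t], of k "real k + 1"] by blast
    then obtain X :: "real set" and \<epsilon> where X: "finite X" "\<epsilon> > 0"
      "\<And>w'. holo_ext (\<delta> k) (real k + 1) w' \<Longrightarrow> \<not> (\<forall>x\<in>X. \<bar>w' x - w \<phi> x\<bar> < \<epsilon>)" by blast
    define W where "W = {\<psi>. mfd_smooth A \<psi> \<and> (\<forall>y\<in>(\<lambda>x. q (of_real x)) ` X. \<bar>\<psi> y - \<phi> y\<bar> < \<epsilon>)}"
    have "openin (smooth_topology A) W" unfolding W_def by (intro X.openin_finite_nhd fs X(2) finite_imageI X(1))
    then have "openin ?Y (W \<inter> admissible A L T)" unfolding openin_subtopology by blast
    moreover have "\<phi> \<in> W \<inter> admissible A L T" using fs X(2) \<phi> unfolding W_def by simp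
    moreover have "W \<inter> admissible A L T \<subseteq> admissible A L T - C k"
    proof
      fix \<psi> assume \<psi>: "\<psi> \<in> W \<inter> admissible A L T"
      then have "\<forall>x\<in>X. \<bar>w \<psi> x - w \<phi> x\<bar> < \<epsilon>" unfolding W_def w_def sub_def by auto
      then show "\<psi> \<in> admissible A L T - C k" using X(3)[of "w \<psi>"] \<psi> unfolding C_def by blast
    qed
    ultimately show "\<exists>W. openin ?Y W \<and> \<phi> \<in> W \<and> W \<subseteq> admissible A L T - C k" by blast
  qed
  have topM: "topspace (moduli A L T) = const_class ` admissible A L T" by (rule topspace_moduli[OF X.atlas])
  have closedC: "closedin (moduli A L T) (const_class ` C k)" for k
  proof -
    have "{\<phi> \<in> topspace ?Y. const_class \<phi> \<in> const_class ` admissible A L T - const_class ` C k} = admissible A L T - C k"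
      unfolding tY using sat by blast
    then have "openin (moduli A L T) (const_class ` admissible A L T - const_class ` C k)"
      unfolding moduli_def openin_quotient_topology using openC[of k] by (auto simp: tY)
    moreover have "C k \<subseteq> admissible A L T" unfolding C_def by blast
    ultimately show ?thesis unfolding closedin_def topM by blast
  qed
  have sm0: "Y.tinv (\<lambda>x. 0)" by (rule S.tinv0)
  \<comment> \<open>Since \<open>sub \<phi>0\<close> is zero, \<open>w \<phi>0\<close> is the height
    itself; its extendability makes it possible to eliminate \<open>s\<close> below.\<close>
  obtain k0 where k0: "\<phi>0 \<in> C k0" using C_analytic[OF \<phi>0] by blast
  have emptyC: "W = {}" if W: "openin (moduli A L T) W" "W \<subseteq> const_class ` C k" for W k
  proof (rule ccontr)
    assume "W \<noteq> {}"
    then obtain \<phi> where \<phi>: "\<phi> \<in> C k" "const_class \<phi> \<in> W" using W(2) by blast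
    have \<phi>a: "\<phi> \<in> admissible A L T" using \<phi>(1) unfolding C_def by blast
    then have t: "X.tinv \<phi>" and sp: "strictly_pseudoconvex A (deform L T \<phi>)" unfolding X.admissible_iff by auto
    have "openin ?Y {x \<in> topspace ?Y. const_class x \<in> W}" using W(1) unfolding moduli_def openin_quotient_topology by blast
    then obtain V where V: "openin (smooth_topology A) V" "{x \<in> topspace ?Y. const_class x \<in> W} = V \<inter> admissible A L T"
      unfolding openin_subtopology by blast
    have \<phi>V: "\<phi> \<in> V" using V(2) \<phi>(2) \<phi>a unfolding tY by blast
    have ts: "Y.tinv (sub \<phi>)" by (rule tsub[OF t])
    \<comment> \<open>Admissibility yields some contact form; comparison with the potential 0 of the
      sphere turns it into the normalised one.\<close>
    have gs: "Y.good (sub \<phi>)" by (rule Y.psc_good[OF ts _ S.good0]) (use sp in \<open>simp add: dsub[OF t]\<close>)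
    \<comment> \<open>The direction from \<open>\<phi>\<close> to the potential
      \<open>\<phi>0 + g\<close>; the segment between them stays admissible by convexity.\<close>
    define \<psi> where "\<psi> x = g x - sub \<phi> x" for x
    have "mfd_smooth A \<psi>" unfolding \<psi>_def by (intro X.msm_diff open_UNIV Y.tinvD(1) gt ts)
    then obtain \<eta> where \<eta>: "\<eta> > 0" "\<And>t. \<bar>t\<bar> < \<eta> \<Longrightarrow> (\<lambda>x. \<phi> x + t * \<psi> x) \<in> V"
      using X.line_continuous[OF V(1) \<phi>V] by blast
    \<comment> \<open>Less than 1 for the convex combination, less than \<open>\<eta>\<close> to
      remain in \<open>V\<close>.\<close>
    define \<tau> where "\<tau> = min 1 \<eta> / 2"
    have \<tau>: "0 < \<tau>" "\<tau> < 1" "\<bar>\<tau>\<bar> < \<eta>" using \<eta>(1) unfolding \<tau>_def by (auto simp: min_def)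
    define \<phi>1 where "\<phi>1 x = \<phi> x + \<tau> * \<psi> x" for x
    have s1: "sub \<phi>1 = (\<lambda>x. (1 - \<tau>) * sub \<phi> x + \<tau> * g x)" unfolding sub_def \<phi>1_def \<psi>_def by (auto simp: algebra_simps)
    have g1: "Y.good (sub \<phi>1)" unfolding s1 using \<tau> by (intro Y.good_convex gs d(5)) auto
    then have ts1: "Y.tinv (sub \<phi>1)" unfolding Y.good_def by blast
    have p1: "\<phi>1 = (\<lambda>x. \<phi>0 x + sub \<phi>1 x)" by (simp add: sub_def)
    have "deform L0 T (sub \<phi>1) = deform L T \<phi>1"
      unfolding L0_def X.deform_deform[OF t0 ts1] by (simp flip: p1)
    then have "strictly_pseudoconvex A (deform L T \<phi>1)" using Y.good_imp_psc[OF g1] by simp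
    moreover have "X.tinv \<phi>1" using X.tinv_comb(1)[OF t0 ts1, of 1 1] p1 by simp
    ultimately have a1: "\<phi>1 \<in> admissible A L T" unfolding X.admissible_iff by blast
    have "\<phi>1 \<in> V" using \<eta>(2)[OF \<tau>(3)] unfolding \<phi>1_def[abs_def] .
    then have "const_class \<phi>1 \<in> W" using V(2) a1 by blast
    then obtain \<phi>2 where "\<phi>2 \<in> C k" "const_class \<phi>2 = const_class \<phi>1" using W(2) by (metis imageE subsetD)
    then have c1: "\<phi>1 \<in> C k" using sat a1 by blast
    \<comment> \<open>The coefficients add up to 0, so the height cancels and only a nonzero
      multiple of the flat function remains.\<close>
    have e0: "1 * w \<phi>1 x + (\<tau> - 1) * w \<phi> x + (- \<tau>) * w \<phi>0 x = \<tau> * g (q (of_real x))" for x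
      unfolding w_def s1 by (simp add: sub_def algebra_simps)
    have h: "holo_ext (\<delta> k) (real k + 1) (w \<phi>1)" "holo_ext (\<delta> k) (real k + 1) (w \<phi>)" "holo_ext (\<delta> k0) (real k0 + 1) (w \<phi>0)"
      using c1 \<phi>(1) k0 unfolding C_def by auto
    show False
      by (rule holo_ext_flat[OF h \<delta>(1) \<delta>(1) \<delta>(1) d(6), of 1 "\<tau> - 1" "- \<tau>"]; unfold e0) (use d(7,8) \<tau> in auto)
  qed
  \<comment> \<open>First category is defined by an exact union, so the closed sets are cut back to
    the induced potentials; being nowhere dense passes to subsets.\<close>
  define D where "D k = const_class ` {\<phi> \<in> C k. induced_by_weighted_sphere A (deform L T \<phi>) T}" for k
  have "nowhere_dense_in (moduli A L T) (D k)" for k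
    unfolding nowhere_dense_in_def
  proof
    have DC: "D k \<subseteq> const_class ` C k" unfolding D_def by blast
    then show "D k \<subseteq> topspace (moduli A L T)" using closedin_subset[OF closedC[of k]] by blast
    have "moduli A L T closure_of D k \<subseteq> const_class ` C k" by (rule closure_of_minimal[OF DC closedC])
    then have "moduli A L T interior_of (moduli A L T closure_of D k) \<subseteq> const_class ` C k"
      by (rule order_trans[OF interior_of_subset])
    then show "moduli A L T interior_of (moduli A L T closure_of D k) = {}"
      by (rule emptyC[OF openin_interior_of])
  qed
  moreover have "sphere_induced A L T = (\<Union>k. D k)"
  proof
    show "sphere_induced A L T \<subseteq> (\<Union>k. D k)"
    proof
      fix c assume "c \<in> sphere_induced A L T"
      then obtain \<phi> where \<phi>: "c = const_class \<phi>" "\<phi> \<in> admissible A L T" "induced_by_weighted_sphere A (deform L T \<phi>) T"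
        unfolding sphere_induced_def by blast
      then obtain k where "\<phi> \<in> C k" using C_analytic by blast
      then have "c \<in> D k" using \<phi> unfolding D_def by simp
      then show "c \<in> (\<Union>k. D k)" by blast
    qed
    show "(\<Union>k. D k) \<subseteq> sphere_induced A L T"
    proof
      fix c assume "c \<in> (\<Union>k. D k)"
      then obtain k where "c \<in> D k" by blast
      then obtain \<phi> where "c = const_class \<phi>" "\<phi> \<in> C k" "induced_by_weighted_sphere A (deform L T \<phi>) T"
        unfolding D_def by blast
      then show "c \<in> sphere_induced A L T" unfolding sphere_induced_def C_def by blast
    qed
  qed
  ultimately show ?thesis unfolding first_category_in_def by blast
qed

end
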